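(* Let $m\ge 0$, $p\ge 2m+1$ be integers, and let $u\in C^{p+2}(\bar\Omega)$ with $u^{(k)}(a)=u^{(k)}(b)=0$ for $k=0,\ldots,m$ satisfy $$(f,v)=a(u,v)\qquad\text{for all } v\in H_0^{m+1}(\Omega).$$ Let $W_{p,m,\Gamma_\Omega}\in S_0^{p,m,\Gamma_\Omega}$ be the piecewise Hermite-Jacobi interpolant of $u$ and let $U_{p,m,\Gamma_\Omega}\in S_0^{p,m,\Gamma_\Omega}$ be the finite element solution, i.e. $(f,V)=a(U_{p,m,\Gamma_\Omega},V)$ for all $V\in S_0^{p,m,\Gamma_\Omega}$. Then there exists a constant $\tilde C=\tilde C(p,m,P_{\max},p'_{\max},|\Omega|)$ such that $$\Vert W_{p,m,\Gamma_\Omega}-U_{p,m,\Gamma_\Omega}\Vert_{m+1,\Omega}\le \tilde C(p,m,P_{\max},p'_{\max},|\Omega|)\,\Vert u\Vert_{p+2}\,H^{p-m+1}.$$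
   Context: $\Omega=[a,b]$, $|\Omega|=b-a$; $\Vert\cdot\Vert_{k}=\Vert\cdot\Vert_{k,\Omega}$ is the $H^k(\Omega)$ norm; $(\cdot,\cdot)$ is the $L^2(\Omega)$ inner product. The functions $f,p_k\in C^p(\bar\Omega)$, $k=0,\ldots,m+1$, are given with $p_{m+1}(x)>0$; $P_{\max}=\max_{k\in\{0,\ldots,m+1\},\,x\in\Omega}|p_k(x)|$, $p'_{\max}=\max_{x\in\Omega}|p_{m+1}'(x)|$. The bilinear form is $a(u,v)=\sum_{k=0}^{m+1}\int_\Omega p_k(x)u^{(k)}(x)v^{(k)}(x)\,dx$; the equation $(f,v)=a(u,v)$ is the weak form of $f=\sum_{k=1}^{m+1}((-1)^kp_ku^{(k)})^{(k)}+p_0u$ on $\Omega$ with $u^{(k)}(a)=u^{(k)}(b)=0$, $k=0,\ldots,m$, of which $u$ is the solution. Partition: $\Gamma_\Omega=\{a=x_0<\cdots<x_N=b\}$, $\Omega_j=(x_{j-1},x_j)$, $h_j=x_j-x_{j-1}$, $m_j=(x_{j-1}+x_j)/2$, $H=\max_jh_j$, $\beta H=\min_jh_j$ with $\beta$ bounded below by a positive constant independently of $N$. $S^{p,m,\Gamma_\Omega}$ is the space of $C^m(\bar\Omega)$ functions that are polynomials of degree at most $p$ on each $\Omega_j$; $S_0^{p,m,\Gamma_\Omega}$ is the subspace of those whose derivatives of order $0,\ldots,m$ vanish at $a$ and $b$. Piecewise Hermite-Jacobi interpolant: let $\mu_2<\cdots<\mu_{p-2m}$ be the $p-2m-1$ roots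 (real, simple, in $(-1,1)$; none if $p=2m+1$) of the $(m+1)$-st derivative $P_{p-m}^{(m+1)}$ of the Legendre polynomial $P_{p-m}$. $W_{p,m,\Gamma_\Omega}$ is, on each $\bar\Omega_j$, the polynomial of degree at most $p$ whose derivatives of order $0,\ldots,m$ agree with those of $u$ at $x_{j-1}$ and $x_j$ and which agrees with $u$ at $m_j+h_j\mu_i/2$, $i=2,\ldots,p-2m$.
   Formalization: Adds the assumption that a(v,v) ≥ α‖v‖²_{m+1} for all v in H_0^{m+1}(Ω) with some fixed α > 0, and lets the constant C̃ depend on α as well; without this the claim as printed is false. *)

theory Defs
  imports "HOL-Analysis.Analysis" "HOL-Computational_Algebra.Polynomial"
begin

section \<open>Classical smoothness on a closed interval\<close>

text \<open>Derivatives are taken within \<open>S\<close>, hence one-sided at the end points when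
  \<open>S = {a..b}\<close>; values outside \<open>S\<close> play no role.\<close>

primrec nderiv :: "real set \<Rightarrow> nat \<Rightarrow> (real \<Rightarrow> real) \<Rightarrow> real \<Rightarrow> real" where
  "nderiv S 0 u = u"
| "nderiv S (Suc k) u = (\<lambda>x. vector_derivative (nderiv S k u) (at x within S))"

definition C_on :: "nat \<Rightarrow> real set \<Rightarrow> (real \<Rightarrow> real) \<Rightarrow> bool" where
  "C_on k S u \<longleftrightarrow> (\<forall>j<k. nderiv S j u differentiable_on S) \<and> continuous_on S (nderiv S k u)"

definition vanishing_boundary_derivs :: "nat \<Rightarrow> real \<Rightarrow> real \<Rightarrow> (real \<Rightarrow> real) \<Rightarrow> bool" where
  "vanishing_boundary_derivs m a b u \<longleftrightarrow>
     (\<forall>k\<le>m. nderiv {a..b} k u a = 0 \<and> nderiv {a..b} k u b = 0)"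


section \<open>Sobolev spaces on an interval\<close>

definition L2_inner :: "real \<Rightarrow> real \<Rightarrow> (real \<Rightarrow> real) \<Rightarrow> (real \<Rightarrow> real) \<Rightarrow> real" where
  "L2_inner a b u v = (\<integral>x. u x * v x \<partial>lebesgue_on {a..b})"

definition L2_space :: "real \<Rightarrow> real \<Rightarrow> (real \<Rightarrow> real) set" where
  "L2_space a b = {v. v \<in> borel_measurable (lebesgue_on {a..b}) \<and>
                      integrable (lebesgue_on {a..b}) (\<lambda>x. (v x)\<^sup>2)}"

text \<open>Smooth functions with compact support in the open interval.\<close>

definition test_functions :: "real \<Rightarrow> real \<Rightarrow> (real \<Rightarrow> real) set" where
  "test_functions a b = {\<phi>. (\<forall>k. C_on k UNIV \<phi>) \<and>
     (\<exists>c d. a < c \<and> d < b \<and> (\<forall>x. x \<notin> {c..d} \<longrightarrow> \<phi> x = 0))}"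

definition is_weak_deriv :: "real \<Rightarrow> real \<Rightarrow> nat \<Rightarrow> (real \<Rightarrow> real) \<Rightarrow> (real \<Rightarrow> real) \<Rightarrow> bool" where
  "is_weak_deriv a b k v g \<longleftrightarrow>
     (\<forall>\<phi>\<in>test_functions a b. L2_inner a b v (nderiv UNIV k \<phi>) = (-1) ^ k * L2_inner a b g \<phi>)"

definition H_space :: "nat \<Rightarrow> real \<Rightarrow> real \<Rightarrow> (real \<Rightarrow> real) set" where
  "H_space k a b = {v \<in> L2_space a b. \<forall>j\<le>k. \<exists>g\<in>L2_space a b. is_weak_deriv a b j v g}"

text \<open>The weak derivative is determined only almost everywhere, so \<open>weak_deriv\<close> picks a
  representative; it is used only under integrals, where the choice is immaterial.\<close>

definition weak_deriv :: "real \<Rightarrow> real \<Rightarrow> nat \<Rightarrow> (real \<Rightarrow> real) \<Rightarrow> real \<Rightarrow> real" where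
  "weak_deriv a b k v = (SOME g. g \<in> L2_space a b \<and> is_weak_deriv a b k v g)"

definition H_norm :: "nat \<Rightarrow> real \<Rightarrow> real \<Rightarrow> (real \<Rightarrow> real) \<Rightarrow> real" where
  "H_norm k a b v = sqrt (\<Sum>j\<le>k. \<integral>x. (weak_deriv a b j v x)\<^sup>2 \<partial>lebesgue_on {a..b})"

text \<open>Closure of the test functions in the Sobolev norm.\<close>

definition H0_space :: "nat \<Rightarrow> real \<Rightarrow> real \<Rightarrow> (real \<Rightarrow> real) set" where
  "H0_space k a b = {v \<in> H_space k a b.
     \<forall>\<epsilon>>0. \<exists>\<phi>\<in>test_functions a b. H_norm k a b (\<lambda>x. v x - \<phi> x) < \<epsilon>}"


section \<open>The bilinear form\<close>

text \<open>\<open>P k\<close> is the coefficient $p_k$, for $k = 0, \ldots, m+1$.\<close>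

definition bilinear_form ::
  "nat \<Rightarrow> real \<Rightarrow> real \<Rightarrow> (nat \<Rightarrow> real \<Rightarrow> real) \<Rightarrow> (real \<Rightarrow> real) \<Rightarrow> (real \<Rightarrow> real) \<Rightarrow> real" where
  "bilinear_form m a b P u v =
     (\<Sum>k\<le>m+1. \<integral>x. P k x * weak_deriv a b k u x * weak_deriv a b k v x \<partial>lebesgue_on {a..b})"

text \<open>The sign conditions on the coefficients concern only \<open>P (m+1)\<close>, so ellipticity does not follow
  from them: for $m = 0$, $p_1 = 1$, $p_0 = -12$ on $[0,1]$ the form vanishes on the hat function with
  peak at $1/2$, and finite element solutions for two equal cells are not unique.\<close>

definition elliptic ::
  "real \<Rightarrow> nat \<Rightarrow> real \<Rightarrow> real \<Rightarrow> (nat \<Rightarrow> real \<Rightarrow> real) \<Rightarrow> bool" where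
  "elliptic \<alpha> m a b P \<longleftrightarrow>
     (\<forall>v\<in>H0_space (m+1) a b. \<alpha> * (H_norm (m+1) a b v)\<^sup>2 \<le> bilinear_form m a b P v v)"

definition P_max :: "nat \<Rightarrow> real \<Rightarrow> real \<Rightarrow> (nat \<Rightarrow> real \<Rightarrow> real) \<Rightarrow> real" where
  "P_max m a b P = (SUP (k, x) \<in> {0..m+1} \<times> {a..b}. \<bar>P k x\<bar>)"

definition dP_max :: "nat \<Rightarrow> real \<Rightarrow> real \<Rightarrow> (nat \<Rightarrow> real \<Rightarrow> real) \<Rightarrow> real" where
  "dP_max m a b P = (SUP x\<in>{a..b}. \<bar>nderiv {a..b} 1 (P (m+1)) x\<bar>)"


section \<open>Partitions and piecewise polynomials\<close>

definition is_partition :: "real \<Rightarrow> real \<Rightarrow> nat \<Rightarrow> (nat \<Rightarrow> real) \<Rightarrow> bool" where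
  "is_partition a b N x \<longleftrightarrow> 1 \<le> N \<and> x 0 = a \<and> x N = b \<and> (\<forall>j\<in>{1..N}. x (j-1) < x j)"

definition mesh_max :: "nat \<Rightarrow> (nat \<Rightarrow> real) \<Rightarrow> real" where
  "mesh_max N x = Max ((\<lambda>j. x j - x (j-1)) ` {1..N})"

definition mesh_min :: "nat \<Rightarrow> (nat \<Rightarrow> real) \<Rightarrow> real" where
  "mesh_min N x = Min ((\<lambda>j. x j - x (j-1)) ` {1..N})"

definition spline_space :: "nat \<Rightarrow> nat \<Rightarrow> nat \<Rightarrow> (nat \<Rightarrow> real) \<Rightarrow> (real \<Rightarrow> real) set" where
  "spline_space p m N x = {v. C_on m {x 0..x N} v \<and>
     (\<forall>j\<in>{1..N}. \<exists>q :: real poly. degree q \<le> p \<and> (\<forall>t\<in>{x (j-1)<..<x j}. v t = poly q t))}"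

definition spline_space0 :: "nat \<Rightarrow> nat \<Rightarrow> nat \<Rightarrow> (nat \<Rightarrow> real) \<Rightarrow> (real \<Rightarrow> real) set" where
  "spline_space0 p m N x =
     {v \<in> spline_space p m N x. vanishing_boundary_derivs m (x 0) (x N) v}"


section \<open>The piecewise Hermite-Jacobi interpolant\<close>

text \<open>Rodrigues' formula.\<close>

definition legendre_poly :: "nat \<Rightarrow> real poly" where
  "legendre_poly n = smult (1 / (2 ^ n * fact n)) ((pderiv ^^ n) ([:-1, 0, 1:] ^ n))"

text \<open>The interior nodes $\mu_2 < \cdots < \mu_{p-2m}$ on the reference interval, as a set.\<close>

definition jacobi_nodes :: "nat \<Rightarrow> nat \<Rightarrow> real set" where
  "jacobi_nodes p m = {\<mu>. poly ((pderiv ^^ (m+1)) (legendre_poly (p - m))) \<mu> = 0}"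

definition is_hermite_jacobi_interpolant ::
  "nat \<Rightarrow> nat \<Rightarrow> nat \<Rightarrow> (nat \<Rightarrow> real) \<Rightarrow> (real \<Rightarrow> real) \<Rightarrow> (real \<Rightarrow> real) \<Rightarrow> bool" where
  "is_hermite_jacobi_interpolant p m N x u W \<longleftrightarrow>
     (\<forall>j\<in>{1..N}. \<exists>q :: real poly. degree q \<le> p \<and>
        (\<forall>t\<in>{x (j-1)..x j}. W t = poly q t) \<and>
        (\<forall>k\<le>m. \<forall>t\<in>{x (j-1), x j}. poly ((pderiv ^^ k) q) t = nderiv {x 0..x N} k u t) \<and>
        (\<forall>\<mu>\<in>jacobi_nodes p m.
           let t = (x (j-1) + x j) / 2 + (x j - x (j-1)) * \<mu> / 2 in poly q t = u t))"

end

theory Submission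
  imports Defs
begin

text \<open>Put $e = W - U$. Ellipticity and Galerkin orthogonality give
  $\alpha \Vert e \Vert^2 \le a(e, e) = a(W - u, e)$, so the sum of the integrals of
  $p_k (W-u)^{(k)} e^{(k)}$ has to be bounded cell by cell. The error $u - W$ has $p + 1$ zeros per cell
  (with multiplicity), so by Rolle's theorem each derivative of order $k \le p$ has a zero there, and
  integrating downwards gives $|(u-W)^{(k)}| \le h^{p-k} \int |u^{(p+1)}|$, which is enough for $k \le m$.
  For $k = m + 1$ one more power of $h$ is needed. Freezing $p_{m+1}$ at an end point costs a factor
  $h\,p'_{\max}$, and the derivative of order $m+1$ of the nodal polynomial
  $\omega = ((t-c)(t-d))^{m+1} P_{p-m}^{(m+1)}$ is orthogonal to all polynomials of degree below $p - m$, hence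
  to $e^{(m+1)}$. Subtracting the right multiple of $\omega$ from $u - W$ makes the derivative of order
  $p + 1$ vanish at a point, so the error is controlled by $u^{(p+2)}$ with the extra power of $h$.\<close>

section \<open>Bounded measurable functions on an interval\<close>

text \<open>Two obstacles outweigh the estimate itself. \<open>H_norm\<close> and
  \<open>bilinear_form\<close> are built on weak derivatives picked by \<open>SOME\<close>, so
  nothing can be computed until these are identified almost everywhere with classical derivatives;
  this rests on the fundamental lemma of the calculus of variations, hence on explicit bump
  functions. And ellipticity is available only on the closure of the test functions, so e has to be
  approximated in H^(m+1) although its derivative of order m + 1 jumps at mesh points: that
  derivative is approximated in L2 and integrated back m + 1 times.

  The constant is ((m+1) P_max max(1,|Omega|)^m + P_max + P'_max) / \<alpha>. No factor N arises in
  the sum over the cells because each cell estimate is a product of two local L2 norms.\<close>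

definition bounded_measurable :: "real \<Rightarrow> real \<Rightarrow> (real \<Rightarrow> real) \<Rightarrow> bool" where
  "bounded_measurable a b f \<longleftrightarrow>
     f \<in> borel_measurable (lebesgue_on {a..b}) \<and> (\<exists>B. \<forall>x\<in>{a..b}. \<bar>f x\<bar> \<le> B)"

lemma bounded_measurable_continuous:
  assumes "continuous_on {a..b} f"
  shows "bounded_measurable a b f"
proof -
  have "bounded (f ` {a..b})"
    using assms compact_continuous_image compact_imp_bounded by blast
  then show ?thesis
    using assms unfolding bounded_measurable_def bounded_iff
    by (auto intro: continuous_imp_measurable_on_sets_lebesgue)
qed

lemma bounded_measurable_imp_measurable:
  "bounded_measurable a b f \<Longrightarrow> f \<in> borel_measurable (lebesgue_on {a..b})"
  by (simp only: bounded_measurable_def)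

lemma bounded_measurable_const [simp]: "bounded_measurable a b (\<lambda>x. c)"
  unfolding bounded_measurable_def by auto

lemma bounded_measurable_add:
  assumes "bounded_measurable a b f" "bounded_measurable a b g"
  shows "bounded_measurable a b (\<lambda>x. f x + g x)"
proof -
  obtain B C where "\<forall>x\<in>{a..b}. \<bar>f x\<bar> \<le> B" "\<forall>x\<in>{a..b}. \<bar>g x\<bar> \<le> C"
    using assms unfolding bounded_measurable_def by blast
  then have "\<forall>x\<in>{a..b}. \<bar>f x + g x\<bar> \<le> B + C"
    by (meson abs_triangle_ineq add_mono order_trans)
  then show ?thesis using assms unfolding bounded_measurable_def by auto
qed

lemma bounded_measurable_mult:
  assumes "bounded_measurable a b f" "bounded_measurable a b g"
  shows "bounded_measurable a b (\<lambda>x. f x * g x)"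
proof -
  obtain B C where "\<forall>x\<in>{a..b}. \<bar>f x\<bar> \<le> B" "\<forall>x\<in>{a..b}. \<bar>g x\<bar> \<le> C"
    using assms unfolding bounded_measurable_def by blast
  then have "\<forall>x\<in>{a..b}. \<bar>f x * g x\<bar> \<le> B * C"
    by (auto simp: abs_mult intro!: mult_mono intro: order_trans[OF abs_ge_zero])
  then show ?thesis using assms unfolding bounded_measurable_def by auto
qed

lemma bounded_measurable_uminus:
  "bounded_measurable a b f \<Longrightarrow> bounded_measurable a b (\<lambda>x. - f x)"
  using bounded_measurable_mult[of a b "\<lambda>x. -1" f] by simp

lemma bounded_measurable_diff:
  "bounded_measurable a b f \<Longrightarrow> bounded_measurable a b g \<Longrightarrow> bounded_measurable a b (\<lambda>x. f x - g x)"
  using bounded_measurable_add[of a b f "\<lambda>x. - g x"] bounded_measurable_uminus[of a b g] by simp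

lemma bounded_measurable_abs:
  "bounded_measurable a b f \<Longrightarrow> bounded_measurable a b (\<lambda>x. \<bar>f x\<bar>)"
  unfolding bounded_measurable_def by auto

lemma bounded_measurable_power2:
  "bounded_measurable a b f \<Longrightarrow> bounded_measurable a b (\<lambda>x. (f x)\<^sup>2)"
  using bounded_measurable_mult[of a b f f] by (simp add: power2_eq_square)

lemma bounded_measurable_sum:
  "(\<And>i. i \<in> I \<Longrightarrow> bounded_measurable a b (f i)) \<Longrightarrow> bounded_measurable a b (\<lambda>x. \<Sum>i\<in>I. f i x)"
  by (induction I rule: infinite_finite_induct) (auto intro: bounded_measurable_add)

lemmas bounded_measurable_intros =
  bounded_measurable_const bounded_measurable_add bounded_measurable_mult bounded_measurable_diff
  bounded_measurable_uminus bounded_measurable_abs bounded_measurable_power2 bounded_measurable_sum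

lemma bounded_measurable_indicator_Ioo: "bounded_measurable a b (indicator {c<..<d})"
proof -
  have "indicator {c<..<d} \<in> borel_measurable (lebesgue_on {a..b})"
    by (intro measurable_restrict_space1 borel_measurable_indicator) simp
  then show ?thesis
    unfolding bounded_measurable_def by (intro conjI exI[of _ 1]) (auto simp: indicator_def)
qed

lemma bounded_measurable_subinterval:
  assumes "bounded_measurable a b f" "{c..d} \<subseteq> {a..b}"
  shows "bounded_measurable c d f"
proof -
  have "f \<in> borel_measurable (lebesgue_on {c..d})"
    by (rule measurable_restrict_mono[OF _ assms(2)])
      (use assms(1) in \<open>simp add: bounded_measurable_def\<close>)
  moreover obtain B where "\<forall>x\<in>{a..b}. \<bar>f x\<bar> \<le> B"
    using assms(1) unfolding bounded_measurable_def by blast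
  ultimately show ?thesis
    using assms(2) unfolding bounded_measurable_def by (intro conjI exI[of _ B] ballI) blast+
qed

lemma finite_measure_lebesgue_on_Icc: "finite_measure (lebesgue_on {a..b::real})"
  by (rule finite_measureI) (simp add: emeasure_restrict_space emeasure_lborel_Icc_eq)

text \<open>The interval has finite measure. As the class is closed under products, all L2 inner
  products of its members are well defined.\<close>

lemma bounded_measurable_integrable:
  assumes "bounded_measurable a b f"
  shows "integrable (lebesgue_on {a..b}) f"
proof -
  obtain B where "\<forall>x\<in>{a..b}. \<bar>f x\<bar> \<le> B"
    using assms unfolding bounded_measurable_def by blast
  then show ?thesis
    using assms finite_measure_lebesgue_on_Icc[of a b] unfolding bounded_measurable_def
    by (intro finite_measure.integrable_const_bound[where B = B] AE_I2) simp_all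
qed

lemma bounded_measurable_in_L2: "bounded_measurable a b f \<Longrightarrow> f \<in> L2_space a b"
  using bounded_measurable_integrable[OF bounded_measurable_power2]
  by (simp add: L2_space_def bounded_measurable_def)

lemma bounded_measurable_has_integral:
  "bounded_measurable a b f \<Longrightarrow> (f has_integral (\<integral>x. f x \<partial>lebesgue_on {a..b})) {a..b}"
  by (intro has_integral_integral_lebesgue_on bounded_measurable_integrable) simp_all

lemma bounded_measurable_integral_eq:
  "bounded_measurable a b f \<Longrightarrow> (\<integral>x. f x \<partial>lebesgue_on {a..b}) = integral {a..b} f"
  by (rule integral_unique[symmetric, OF bounded_measurable_has_integral])

section \<open>The L2 inner product\<close>

lemma L2_inner_commute: "L2_inner a b f g = L2_inner a b g f"
  by (simp add: L2_inner_def mult.commute)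

lemma L2_inner_self_nonneg: "0 \<le> L2_inner a b f f"
  by (simp add: L2_inner_def)

lemma AE_lebesgue_on_notin_finite:
  assumes "finite S"
  shows "AE x in lebesgue_on {a..b::real}. x \<notin> S"
proof -
  have "AE x in lebesgue. x \<notin> S"
    using assms by (intro AE_not_in) (simp add: negligible_finite flip: negligible_iff_null_sets)
  then show ?thesis
    by (subst AE_restrict_space_iff) auto
qed

lemma L2_inner_cong_AE:
  assumes "AE x in lebesgue_on {a..b}. f x = f' x" "AE x in lebesgue_on {a..b}. g x = g' x"
    and "f \<in> borel_measurable (lebesgue_on {a..b})" "f' \<in> borel_measurable (lebesgue_on {a..b})"
    and "g \<in> borel_measurable (lebesgue_on {a..b})" "g' \<in> borel_measurable (lebesgue_on {a..b})"
  shows "L2_inner a b f g = L2_inner a b f' g'"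
  unfolding L2_inner_def
  using assms by (intro integral_cong_AE borel_measurable_times) (auto elim: eventually_elim2)

text \<open>The top derivative of a spline has a merely conventional value at the mesh points; this
  removes these finitely many points from comparisons of integrals.\<close>

lemma L2_inner_cong_finite:
  assumes "finite S" "\<And>x. x \<in> {a..b} - S \<Longrightarrow> f x = f' x" "\<And>x. x \<in> {a..b} - S \<Longrightarrow> g x = g' x"
    and "bounded_measurable a b f" "bounded_measurable a b f'"
    and "bounded_measurable a b g" "bounded_measurable a b g'"
  shows "L2_inner a b f g = L2_inner a b f' g'"
proof -
  have "AE x in lebesgue_on {a..b}. x \<in> {a..b} - S"
    using AE_lebesgue_on_notin_finite[OF \<open>finite S\<close>, of a b] AE_space
    by eventually_elim auto
  then have "AE x in lebesgue_on {a..b}. f x = f' x" "AE x in lebesgue_on {a..b}. g x = g' x"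
    by (rule eventually_mono, use assms(2,3) in blast)+
  then show ?thesis
    using assms(4-7) by (intro L2_inner_cong_AE bounded_measurable_imp_measurable)
qed

lemma L2_inner_cmult_left: "L2_inner a b (\<lambda>x. c * f x) g = c * L2_inner a b f g"
  unfolding L2_inner_def by (simp add: mult.assoc)

lemma L2_inner_diff_left:
  assumes "bounded_measurable a b f" "bounded_measurable a b f'" "bounded_measurable a b g"
  shows "L2_inner a b (\<lambda>x. f x - f' x) g = L2_inner a b f g - L2_inner a b f' g"
  unfolding L2_inner_def left_diff_distrib
  by (intro Bochner_Integration.integral_diff bounded_measurable_integrable bounded_measurable_mult assms)

lemma L2_inner_add_left:
  assumes "bounded_measurable a b f" "bounded_measurable a b f'" "bounded_measurable a b g"
  shows "L2_inner a b (\<lambda>x. f x + f' x) g = L2_inner a b f g + L2_inner a b f' g"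
  unfolding L2_inner_def distrib_right
  by (intro Bochner_Integration.integral_add bounded_measurable_integrable bounded_measurable_mult assms)

text \<open>The quadratic F - 2 t I + t^2 G is the squared norm of f - t g, hence nonnegative for
  all t; its minimum gives the claim.\<close>

lemma L2_inner_Cauchy_Schwarz:
  assumes f: "bounded_measurable a b f" and g: "bounded_measurable a b g"
  shows "\<bar>L2_inner a b f g\<bar> \<le> sqrt (L2_inner a b f f) * sqrt (L2_inner a b g g)"
proof -
  define F G I where "F = L2_inner a b f f" and "G = L2_inner a b g g" and "I = L2_inner a b f g"
  have nonneg: "0 \<le> F" "0 \<le> G"
    by (simp_all add: F_def G_def L2_inner_self_nonneg)
  have quad: "0 \<le> F - 2 * t * I + t\<^sup>2 * G" for t
  proof -
    note [intro!] = bounded_measurable_intros f g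
    have "0 \<le> L2_inner a b (\<lambda>x. f x - t * g x) (\<lambda>x. f x - t * g x)"
      by (rule L2_inner_self_nonneg)
    also have "\<dots> = L2_inner a b f (\<lambda>x. f x - t * g x) - t * L2_inner a b g (\<lambda>x. f x - t * g x)"
      by (subst L2_inner_diff_left) (auto simp: L2_inner_cmult_left)
    also have "L2_inner a b f (\<lambda>x. f x - t * g x) = F - t * I"
      by (subst L2_inner_commute, subst L2_inner_diff_left)
        (auto simp: L2_inner_cmult_left F_def I_def L2_inner_commute)
    also have "L2_inner a b g (\<lambda>x. f x - t * g x) = I - t * G"
      by (subst L2_inner_commute, subst L2_inner_diff_left)
        (auto simp: L2_inner_cmult_left G_def I_def L2_inner_commute)
    finally show ?thesis
      by (simp add: algebra_simps power2_eq_square)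
  qed
  have "I\<^sup>2 \<le> F * G"
  proof (cases "G = 0")
    case False
    then have "G > 0" using nonneg by simp
    from quad[of "I / G"] have "0 \<le> (F * G - I\<^sup>2) / G"
      using \<open>G > 0\<close> by (simp add: field_simps power2_eq_square)
    then show ?thesis
      using \<open>G > 0\<close> by (simp add: zero_le_divide_iff)
  next
    case True
    have "I = 0"
    proof (rule ccontr)
      \<comment> \<open>With G = 0 the quadratic is linear in t, and at t = (F + 1) / I it equals -F
        - 2 < 0.\<close>
      assume "I \<noteq> 0"
      then show False
        using quad[of "(F + 1) / I"] True nonneg by simp
    qed
    then show ?thesis using nonneg by simp
  qed
  then have "\<bar>I\<bar> \<le> sqrt (F * G)"
    by (simp add: real_le_rsqrt)
  then show ?thesis
    by (simp add: F_def G_def I_def real_sqrt_mult)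
qed

lemma L1_le_L2:
  assumes "bounded_measurable a b f" "a \<le> b"
  shows "(\<integral>x. \<bar>f x\<bar> \<partial>lebesgue_on {a..b}) \<le> sqrt (b - a) * sqrt (L2_inner a b f f)"
proof -
  have "L2_inner a b (\<lambda>x. 1) (\<lambda>x. 1) = b - a"
    using assms(2) by (simp add: L2_inner_def measure_restrict_space)
  moreover have "L2_inner a b (\<lambda>x. \<bar>f x\<bar>) (\<lambda>x. \<bar>f x\<bar>) = L2_inner a b f f"
    by (simp add: L2_inner_def)
  moreover have "L2_inner a b (\<lambda>x. 1) (\<lambda>x. \<bar>f x\<bar>) = (\<integral>x. \<bar>f x\<bar> \<partial>lebesgue_on {a..b})"
    by (simp add: L2_inner_def)
  ultimately show ?thesis
    using L2_inner_Cauchy_Schwarz[of a b "\<lambda>x. 1" "\<lambda>x. \<bar>f x\<bar>"] assms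
    by (simp add: bounded_measurable_intros)
qed

text \<open>The sets over which g integrates to zero contain the closed intervals and are stable
  under complements and disjoint unions, so they include all Borel sets. A Lebesgue set differs from
  a Borel set by a null set, and a density with all integrals zero vanishes almost
  everywhere.\<close>

lemma AE_zero_of_interval_integrals:
  fixes g :: "real \<Rightarrow> real"
  assumes g: "integrable (lebesgue_on {a..b}) g"
    and zero: "\<And>c d. a \<le> c \<Longrightarrow> c \<le> d \<Longrightarrow> d \<le> b \<Longrightarrow> (LINT x:{c..d}|lebesgue_on {a..b}. g x) = 0"
    and "a \<le> b"
  shows "AE x in lebesgue_on {a..b}. g x = 0"
proof (rule sigma_finite_measure.density_zero[OF _ g])
  let ?M = "lebesgue_on {a..b}"
  show "sigma_finite_measure ?M"
    using finite_measure_lebesgue_on_Icc finite_measure.axioms(1) by blast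
  have sets_M: "A \<inter> {a..b} \<in> sets ?M" if "A \<in> sets lebesgue" for A
    using that by (simp add: sets_restrict_space_iff sets.Int)
  have set_int: "set_integrable ?M (A \<inter> {a..b}) g" if "A \<in> sets lebesgue" for A
    unfolding set_integrable_def using that by (intro integrable_mult_indicator g sets_M)
  have borel: "(LINT x:A \<inter> {a..b}|?M. g x) = 0" if "A \<in> sets borel" for A
    using that
  proof (induction rule: borel_set_induct)
    case empty
    then show ?case by (simp add: set_lebesgue_integral_def)
  next
    case (interval c d)
    show ?case
    proof (cases "max a c \<le> min b d")
      case True
      then show ?thesis using zero[of "max a c" "min b d"] by (simp add: Int_atLeastAtMost max.commute min.commute)
    next
      case False
      then show ?thesis by (simp add: Int_atLeastAtMost max.commute min.commute set_lebesgue_integral_def)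
    qed
  next
    case (compl A)
    have "(LINT x:{a..b}|?M. g x) = (LINT x:(A \<inter> {a..b}) \<union> (- A \<inter> {a..b})|?M. g x)"
      by (intro arg_cong[where f = "\<lambda>S. set_lebesgue_integral ?M S g"]) auto
    also have "\<dots> = (LINT x:A \<inter> {a..b}|?M. g x) + (LINT x:- A \<inter> {a..b}|?M. g x)"
      using compl(1) by (intro set_integral_Un set_int) auto
    finally show ?case using compl zero[of a b] \<open>a \<le> b\<close> by simp
  next
    case (union A)
    have meas: "A i \<inter> {a..b} \<in> sets ?M" for i
      by (intro sets_M sets_completionI_sets) (use union(2)[of i] in simp)
    have "(LINT x:(\<Union>i. A i \<inter> {a..b})|?M. g x) = (\<Sum>i. (LINT x:A i \<inter> {a..b}|?M. g x))"
    proof (rule lebesgue_integral_countable_add)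
      show "set_integrable ?M (\<Union>i. A i \<inter> {a..b}) g"
        unfolding set_integrable_def
        by (intro integrable_mult_indicator g sets.countable_UN) (use meas in blast)
    qed (use meas union(1) in \<open>auto simp: disjoint_family_on_def\<close>)
    moreover have "(\<Union>i. A i \<inter> {a..b}) = \<Union> (range A) \<inter> {a..b}"
      by blast
    ultimately show ?case using union by simp
  qed
  fix A assume "A \<in> sets ?M"
  then obtain A' where A': "A' \<in> sets lebesgue" "A = A' \<inter> {a..b}"
    by (auto simp: sets_restrict_space)
  then obtain S N N' where S: "A' = S \<union> N" "N \<subseteq> N'" "N' \<in> null_sets lborel" "S \<in> sets lborel"
    by (auto elim: sets_completionE)
  have "AE x in lebesgue. x \<notin> N'"
    using S(3) by (intro AE_not_in null_sets_completionI)
  then have "AE x in ?M. x \<notin> N'"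
    by (subst AE_restrict_space_iff) auto
  then have ae: "AE x in ?M. indicat_real A x *\<^sub>R g x = indicat_real (S \<inter> {a..b}) x *\<^sub>R g x"
    using S A' by (elim eventually_mono) (auto simp: indicator_def)
  have meas: "A \<in> sets ?M" "S \<inter> {a..b} \<in> sets ?M"
    using \<open>A \<in> sets ?M\<close> S(4) by (simp_all add: sets_M sets_completionI_sets)
  have "(LINT x:A|?M. g x) = (LINT x:S \<inter> {a..b}|?M. g x)"
    unfolding set_lebesgue_integral_def
    by (intro integral_cong_AE ae borel_measurable_scaleR borel_measurable_indicator meas
          borel_measurable_integrable[OF g])
  then show "(LINT x:A|?M. g x) = 0"
    using borel[of S] S by simp
qed


section \<open>Chains of derivatives\<close>

text \<open>\<open>D i\<close> stands for the \<open>i\<close>-th derivative of \<open>D 0\<close>. Only the top one may be discontinuous, and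
  derivatives are required only off the finite set \<open>S\<close>, so that both smooth functions and splines fit.\<close>

definition deriv_chain :: "real set \<Rightarrow> nat \<Rightarrow> real \<Rightarrow> real \<Rightarrow> (nat \<Rightarrow> real \<Rightarrow> real) \<Rightarrow> bool" where
  "deriv_chain S k a b D \<longleftrightarrow> finite S \<and> bounded_measurable a b (D k) \<and>
     (\<forall>i<k. continuous_on {a..b} (D i)) \<and>
     (\<forall>i<k. \<forall>x\<in>{a<..<b} - S. (D i has_real_derivative D (Suc i) x) (at x))"

lemma deriv_chain_bounded_measurable:
  "deriv_chain S k a b D \<Longrightarrow> i \<le> k \<Longrightarrow> bounded_measurable a b (D i)"
  unfolding deriv_chain_def by (metis bounded_measurable_continuous le_neq_implies_less)

lemma deriv_chain_continuous: "deriv_chain S k a b D \<Longrightarrow> i < k \<Longrightarrow> continuous_on {a..b} (D i)"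
  unfolding deriv_chain_def by blast

lemma deriv_chain_deriv:
  "deriv_chain S k a b D \<Longrightarrow> i < k \<Longrightarrow> x \<in> {a<..<b} \<Longrightarrow> x \<notin> S \<Longrightarrow>
     (D i has_real_derivative D (Suc i) x) (at x)"
  unfolding deriv_chain_def by blast

lemma deriv_chain_le: "deriv_chain S k a b D \<Longrightarrow> j \<le> k \<Longrightarrow> deriv_chain S j a b D"
  using deriv_chain_bounded_measurable[of S k a b D j] unfolding deriv_chain_def by auto

lemma deriv_chain_shift: "deriv_chain S (k + j) a b D \<Longrightarrow> deriv_chain S k a b (\<lambda>i. D (i + j))"
  unfolding deriv_chain_def by auto

lemma deriv_chain_subinterval:
  assumes "deriv_chain S k a b D" "{c..d} \<subseteq> {a..b}"
  shows "deriv_chain S k c d D"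
proof -
  have "{c<..<d} \<subseteq> {a<..<b}"
    using assms(2) by (auto simp: subset_iff) (meson atLeastAtMost_iff less_eq_real_def less_le_trans le_less_trans order_trans order_refl)+
  then show ?thesis
    using assms bounded_measurable_subinterval continuous_on_subset unfolding deriv_chain_def
    by (metis DiffD1 DiffD2 DiffI subsetD)
qed

lemma deriv_chain_lincomb:
  assumes D: "deriv_chain S k a b D" and E: "deriv_chain T k a b E"
  shows "deriv_chain (S \<union> T) k a b (\<lambda>i x. D i x - c * E i x)"
  unfolding deriv_chain_def
proof (intro conjI allI impI ballI)
  show "finite (S \<union> T)"
    using D E by (simp add: deriv_chain_def)
  show "bounded_measurable a b (\<lambda>x. D k x - c * E k x)"
    using D E by (intro bounded_measurable_intros deriv_chain_bounded_measurable) auto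
  show "continuous_on {a..b} (\<lambda>x. D i x - c * E i x)" if "i < k" for i
    using D E that by (intro continuous_intros deriv_chain_continuous) auto
  show "((\<lambda>x. D i x - c * E i x) has_real_derivative D (Suc i) x - c * E (Suc i) x) (at x)"
    if "i < k" "x \<in> {a<..<b} - (S \<union> T)" for i x
    using that
    by (intro DERIV_diff DERIV_cmult deriv_chain_deriv[OF D] deriv_chain_deriv[OF E]) auto
qed

lemma deriv_chain_diff:
  "deriv_chain S k a b D \<Longrightarrow> deriv_chain T k a b E \<Longrightarrow> deriv_chain (S \<union> T) k a b (\<lambda>i x. D i x - E i x)"
  using deriv_chain_lincomb[of S k a b D T E 1] by simp

text \<open>The fundamental theorem of calculus tolerates finitely many points without derivative as
  long as the function is continuous; the conditions in \<open>deriv_chain\<close> are chosen for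
  this.\<close>

lemma deriv_chain_has_integral:
  assumes D: "deriv_chain S k a b D" and "i < k" "a \<le> c" "c \<le> d" "d \<le> b"
  shows "(D (Suc i) has_integral D i d - D i c) {c..d}"
proof (rule fundamental_theorem_of_calculus_interior_strong)
  show "finite S" using D by (simp add: deriv_chain_def)
  show "continuous_on {c..d} (D i)"
    by (rule continuous_on_subset[OF deriv_chain_continuous[OF D \<open>i < k\<close>]]) (use assms in auto)
  show "(D i has_vector_derivative D (Suc i) x) (at x)" if "x \<in> {c<..<d} - S" for x
    using deriv_chain_deriv[OF D \<open>i < k\<close>, of x] that assms
    by (simp add: has_real_derivative_iff_has_vector_derivative)
qed (use assms in simp)

lemma deriv_chain_diff_le:
  assumes D: "deriv_chain S k a b D" and "i < k" "x \<in> {a..b}" "z \<in> {a..b}"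
  shows "\<bar>D i x - D i z\<bar> \<le> (\<integral>t. \<bar>D (Suc i) t\<bar> \<partial>lebesgue_on {a..b})"
proof -
  have bm: "bounded_measurable a b (D (Suc i))" "bounded_measurable a b (\<lambda>t. \<bar>D (Suc i) t\<bar>)"
    using D \<open>i < k\<close> by (auto intro!: bounded_measurable_intros deriv_chain_bounded_measurable)
  have *: "\<bar>D i d - D i c\<bar> \<le> (\<integral>t. \<bar>D (Suc i) t\<bar> \<partial>lebesgue_on {a..b})"
    if "a \<le> c" "c \<le> d" "d \<le> b" for c d
  proof -
    have sub: "{c..d} \<subseteq> {a..b}" using that by auto
    have int: "D (Suc i) integrable_on {c..d}" "(\<lambda>t. \<bar>D (Suc i) t\<bar>) integrable_on {c..d}"
      using bounded_measurable_has_integral bounded_measurable_subinterval[OF _ sub] bm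
      by (blast intro: has_integral_integrable)+
    have "\<bar>D i d - D i c\<bar> = \<bar>integral {c..d} (D (Suc i))\<bar>"
      using deriv_chain_has_integral[OF D \<open>i < k\<close> that] by (simp add: integral_unique)
    also have "\<dots> \<le> integral {c..d} (\<lambda>t. \<bar>D (Suc i) t\<bar>)"
      using integral_norm_bound_integral[OF int] by simp
    also have "\<dots> \<le> integral {a..b} (\<lambda>t. \<bar>D (Suc i) t\<bar>)"
      using bounded_measurable_has_integral[OF bm(2)]
      by (intro integral_subset_le sub int) (auto intro: has_integral_integrable)
    finally show ?thesis
      by (simp add: bounded_measurable_integral_eq[OF bm(2)])
  qed
  show ?thesis
    using *[of x z] *[of z x] assms by (cases "x \<le> z") (auto simp: abs_minus_commute)
qed

text \<open>Each order below k costs one integration over the interval, started at a zero of that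
  derivative; zeros of different orders may be unrelated. The step from order k + 1 to k keeps the
  L1 norm and gives no factor, whence the exponent k - i.\<close>

lemma deriv_chain_bound_of_zeros:
  assumes D: "deriv_chain S (Suc k) a b D"
    and zeros: "\<And>l. i \<le> l \<Longrightarrow> l \<le> k \<Longrightarrow> \<exists>z\<in>{a..b}. D l z = 0"
    and "i \<le> k" "x \<in> {a..b}"
  shows "\<bar>D i x\<bar> \<le> (b - a) ^ (k - i) * (\<integral>t. \<bar>D (Suc k) t\<bar> \<partial>lebesgue_on {a..b})"
  using \<open>i \<le> k\<close> \<open>x \<in> {a..b}\<close> zeros
proof (induction i arbitrary: x rule: inc_induct)
  case base
  then obtain z where "z \<in> {a..b}" "D k z = 0" by blast
  then show ?case
    using deriv_chain_diff_le[OF D, of k x z] base by simp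
next
  case (step i)
  let ?I = "\<integral>t. \<bar>D (Suc k) t\<bar> \<partial>lebesgue_on {a..b}"
  obtain z where z: "z \<in> {a..b}" "D i z = 0"
    using step by (meson le_refl less_imp_le)
  have "a \<le> b" using z by simp
  have bm: "bounded_measurable a b (\<lambda>t. \<bar>D (Suc i) t\<bar>)"
    using D step by (auto intro!: bounded_measurable_intros deriv_chain_bounded_measurable)
  have "\<bar>D i x\<bar> \<le> (\<integral>t. \<bar>D (Suc i) t\<bar> \<partial>lebesgue_on {a..b})"
    using deriv_chain_diff_le[OF D, of i x z] step z by simp
  also have "\<dots> \<le> (\<integral>t. (b - a) ^ (k - Suc i) * ?I \<partial>lebesgue_on {a..b})"
    using step
    by (intro integral_mono bounded_measurable_integrable bm) (auto simp: Suc_le_eq)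
  also have "\<dots> = (b - a) * ((b - a) ^ (k - Suc i) * ?I)"
    using \<open>a \<le> b\<close> by (simp add: measure_restrict_space)
  also have "\<dots> = (b - a) ^ (k - i) * ?I"
    using step(2) by (simp flip: power_Suc mult.assoc add: Suc_diff_Suc)
  finally show ?case .
qed

text \<open>The boundary terms are killed by \<open>E\<close> alone. Since only continuity off the
  top order enters, \<open>D\<close> can be a smooth function or a spline, and \<open>E\<close> a
  test function or a polynomial with zeros at the ends.\<close>

lemma deriv_chain_parts:
  assumes D: "deriv_chain S k a b D" and E: "deriv_chain T n a b E" and "a \<le> b"
    and "j \<le> n" "i + j \<le> k"
    and bdry: "\<And>l. l < j \<Longrightarrow> E l a = 0 \<and> E l b = 0"
  shows "L2_inner a b (D i) (E j) = (-1) ^ j * L2_inner a b (D (i + j)) (E 0)"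
  using \<open>j \<le> n\<close> \<open>i + j \<le> k\<close> bdry
proof (induction j arbitrary: i)
  case (Suc j)
  have bm: "bounded_measurable a b (D i)" "bounded_measurable a b (D (Suc i))"
    "bounded_measurable a b (E j)" "bounded_measurable a b (E (Suc j))"
    using D E Suc.prems by (auto intro!: deriv_chain_bounded_measurable)
  have "((\<lambda>x. D i x * E (Suc j) x + D (Suc i) x * E j x) has_integral
      D i b * E j b - D i a * E j a) {a..b}"
  proof (rule fundamental_theorem_of_calculus_interior_strong)
    show "finite (S \<union> T)" using D E by (simp add: deriv_chain_def)
    show "continuous_on {a..b} (\<lambda>x. D i x * E j x)"
      using Suc.prems
      by (intro continuous_intros deriv_chain_continuous[OF D] deriv_chain_continuous[OF E]) auto
    show "((\<lambda>x. D i x * E j x) has_vector_derivative D i x * E (Suc j) x + D (Suc i) x * E j x) (at x)"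
      if "x \<in> {a<..<b} - (S \<union> T)" for x
    proof -
      have "(D i has_real_derivative D (Suc i) x) (at x)" "(E j has_real_derivative E (Suc j) x) (at x)"
        using that Suc.prems by (auto intro: deriv_chain_deriv[OF D] deriv_chain_deriv[OF E])
      then show ?thesis
        unfolding has_real_derivative_iff_has_vector_derivative[symmetric]
        by (auto intro!: derivative_eq_intros)
    qed
  qed fact
  moreover have "((\<lambda>x. D i x * E (Suc j) x + D (Suc i) x * E j x) has_integral
      L2_inner a b (D i) (E (Suc j)) + L2_inner a b (D (Suc i)) (E j)) {a..b}"
    unfolding L2_inner_def
    by (intro has_integral_add bounded_measurable_has_integral bounded_measurable_mult bm)
  ultimately have "D i b * E j b - D i a * E j a =
      L2_inner a b (D i) (E (Suc j)) + L2_inner a b (D (Suc i)) (E j)"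
    by (rule has_integral_unique)
  moreover have "E j a = 0" "E j b = 0" using Suc.prems by auto
  ultimately have "L2_inner a b (D i) (E (Suc j)) = - L2_inner a b (D (Suc i)) (E j)"
    by simp
  also have "\<dots> = - ((-1) ^ j * L2_inner a b (D (Suc i + j)) (E 0))"
    using Suc.prems by (subst Suc.IH) auto
  finally show ?case by simp
qed simp

lemma deriv_chain_poly: "deriv_chain {} k a b (\<lambda>i. poly ((pderiv ^^ i) q))"
proof -
  have "continuous_on {a..b} (poly r)" for r :: "real poly"
    by (intro continuous_intros)
  then show ?thesis
    using poly_DERIV unfolding deriv_chain_def by (auto intro: bounded_measurable_continuous)
qed


section \<open>Rolle's theorem and Legendre polynomials\<close>

text \<open>n + 1 zeros leave n gaps, each with a zero of the derivative. The induction splits off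
  the largest zero and generalises the right end to the second largest, so that the new zero lies to
  the right of all the others.\<close>

lemma Rolle_zeros:
  fixes f f' :: "real \<Rightarrow> real"
  assumes "continuous_on {c..d} f" "\<And>x. x \<in> {c<..<d} \<Longrightarrow> (f has_real_derivative f' x) (at x)"
    and "Z \<subseteq> {c..d}" "finite Z" "card Z = Suc n" "\<And>z. z \<in> Z \<Longrightarrow> f z = 0"
  shows "\<exists>Y\<subseteq>{c<..<d}. finite Y \<and> card Y = n \<and> (\<forall>y\<in>Y. f' y = 0)"
  using assms
proof (induction n arbitrary: d Z)
  case 0
  then show ?case by (intro exI[of _ "{}"]) auto
next
  case (Suc n)
  define z where "z = Max Z"
  define Z0 where "Z0 = Z - {z}"
  define w where "w = Max Z0"
  have z: "z \<in> Z" "\<And>x. x \<in> Z \<Longrightarrow> x \<le> z"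
    using Suc.prems(4,5) unfolding z_def by (auto intro!: Max_in Max_ge)
  have Z0: "finite Z0" "card Z0 = Suc n" "Z0 \<subseteq> Z"
    using Suc.prems(4,5) z unfolding Z0_def by auto
  have w: "w \<in> Z0" "\<And>x. x \<in> Z0 \<Longrightarrow> x \<le> w"
    using Z0 unfolding w_def by (auto intro!: Max_in Max_ge)
  have "w < z" using z w unfolding Z0_def by force
  have range: "c \<le> w" "z \<le> d" using w Z0 z Suc.prems(3) by auto
  have "\<exists>Y\<subseteq>{c<..<w}. finite Y \<and> card Y = n \<and> (\<forall>y\<in>Y. f' y = 0)"
  proof (rule Suc.IH)
    show "continuous_on {c..w} f"
      by (rule continuous_on_subset[OF Suc.prems(1)]) (use range \<open>w < z\<close> in auto)
    show "Z0 \<subseteq> {c..w}" using w Z0 Suc.prems(3) by auto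
  qed (use Suc.prems Z0 range \<open>w < z\<close> in auto)
  then obtain Y where Y: "Y \<subseteq> {c<..<w}" "finite Y" "card Y = n" "\<forall>y\<in>Y. f' y = 0"
    by blast
  have "\<exists>y. w < y \<and> y < z \<and> DERIV f y :> 0"
  proof (rule Rolle[OF \<open>w < z\<close>])
    show "f w = f z" using Suc.prems(6) z w Z0 by auto
    show "continuous_on {w..z} f"
      by (rule continuous_on_subset[OF Suc.prems(1)]) (use range in auto)
    show "f differentiable (at x)" if "w < x" "x < z" for x
      using Suc.prems(2)[of x] that range real_differentiable_def by auto
  qed
  then obtain y where y: "w < y" "y < z" "DERIV f y :> 0" by blast
  then have "f' y = 0"
    using Suc.prems(2)[of y] range DERIV_unique by fastforce
  moreover have "y \<notin> Y" using Y y by auto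
  ultimately show ?case
    using Y y range \<open>w < z\<close> by (intro exI[of _ "insert y Y"]) (auto simp: subset_iff)
qed

text \<open>As long as l < s, both end points are zeros of the l-th derivative besides those inside,
  so Rolle turns n interior zeros into n + 1.\<close>

lemma deriv_chain_zeros_rising:
  assumes G: "deriv_chain {} K c d G" and "c < d"
    and Z: "Z \<subseteq> {c<..<d}" "finite Z" "\<And>z. z \<in> Z \<Longrightarrow> G 0 z = 0"
    and bdry: "\<And>l. l < s \<Longrightarrow> G l c = 0 \<and> G l d = 0"
    and "l \<le> s" "l \<le> K"
  shows "\<exists>Y\<subseteq>{c<..<d}. finite Y \<and> card Y = card Z + l \<and> (\<forall>y\<in>Y. G l y = 0)"
  using \<open>l \<le> s\<close> \<open>l \<le> K\<close>
proof (induction l)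
  case 0
  then show ?case using Z by auto
next
  case (Suc l)
  then obtain Y where Y: "Y \<subseteq> {c<..<d}" "finite Y" "card Y = card Z + l" "\<forall>y\<in>Y. G l y = 0"
    by auto
  have "c \<notin> Y" "d \<notin> Y" using Y by auto
  then have "card (insert c (insert d Y)) = Suc (card Z + Suc l)"
    using Y \<open>c < d\<close> by simp
  moreover have "insert c (insert d Y) \<subseteq> {c..d}"
    using Y(1) \<open>c < d\<close> by (auto simp: subset_iff)
  moreover have "G l z = 0" if "z \<in> insert c (insert d Y)" for z
  proof -
    have "G l c = 0" "G l d = 0" using bdry[of l] Suc.prems by simp_all
    then show ?thesis using that Y(4) by auto
  qed
  moreover have "finite (insert c (insert d Y))" using Y(2) by simp
  moreover have "l < K" using Suc.prems by simp
  moreover have "(G l has_real_derivative G (Suc l) z) (at z)" if "z \<in> {c<..<d}" for z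
    using deriv_chain_deriv[OF G \<open>l < K\<close> that] by simp
  ultimately show ?case
    using deriv_chain_continuous[OF G \<open>l < K\<close>] by (intro Rolle_zeros[where f = "G l"])
qed

text \<open>From order s on the end points contribute no zeros and every differentiation loses one;
  the count starts from the \<open>card Z + s\<close> zeros reached at order s.\<close>

lemma deriv_chain_zeros_falling:
  assumes G: "deriv_chain {} K c d G" and "c < d"
    and Z: "Z \<subseteq> {c<..<d}" "finite Z" "\<And>z. z \<in> Z \<Longrightarrow> G 0 z = 0"
    and bdry: "\<And>l. l < s \<Longrightarrow> G l c = 0 \<and> G l d = 0"
    and "s + l \<le> K" "l \<le> card Z + s"
  shows "\<exists>Y\<subseteq>{c<..<d}. finite Y \<and> card Y = card Z + s - l \<and> (\<forall>y\<in>Y. G (s + l) y = 0)"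
  using \<open>s + l \<le> K\<close> \<open>l \<le> card Z + s\<close>
proof (induction l)
  case 0
  then show ?case
    using deriv_chain_zeros_rising[OF G \<open>c < d\<close> Z bdry, of s] by simp
next
  case (Suc l)
  then obtain Y where Y: "Y \<subseteq> {c<..<d}" "finite Y" "card Y = card Z + s - l" "\<forall>y\<in>Y. G (s + l) y = 0"
    by auto
  have "card Y = Suc (card Z + s - Suc l)"
    using Y Suc.prems by simp
  moreover have "Y \<subseteq> {c..d}"
    using Y(1) by (auto simp: subset_iff)
  moreover have "continuous_on {c..d} (G (s + l))"
    using Suc.prems by (intro deriv_chain_continuous[OF G]) simp
  moreover have "(G (s + l) has_real_derivative G (s + Suc l) x) (at x)" if "x \<in> {c<..<d}" for x
    using deriv_chain_deriv[OF G, of "s + l" x] that Suc.prems by simp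
  ultimately show ?case
    using Y(2,4) by (intro Rolle_zeros[where f = "G (s + l)"]) blast+
qed

section \<open>Iterated derivatives of polynomials\<close>

lemma higher_pderiv_eq_0:
  fixes q :: "real poly"
  assumes "degree q < k"
  shows "(pderiv ^^ k) q = 0"
proof -
  have "degree ((pderiv ^^ (k - 1)) q) = 0"
    using assms by (simp add: degree_higher_pderiv)
  then have "pderiv ((pderiv ^^ (k - 1)) q) = 0"
    by (simp add: pderiv_eq_0_iff)
  then show ?thesis
    using assms by (cases k) auto
qed

text \<open>The leading coefficient of the k-th derivative is that of q times a rising factorial,
  which is positive.\<close>

lemma higher_pderiv_neq_0:
  fixes q :: "real poly"
  assumes "q \<noteq> 0" "k \<le> degree q"
  shows "(pderiv ^^ k) q \<noteq> 0"
proof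
  assume "(pderiv ^^ k) q = 0"
  then have "pochhammer (of_nat (Suc (degree q - k))) k * lead_coeff q = 0"
    using coeff_higher_pderiv[of k q "degree q - k"] assms by simp
  moreover have "pochhammer (real (Suc (degree q - k))) k > 0"
    by (intro pochhammer_pos) simp
  ultimately show False
    using assms by simp
qed

text \<open>Each differentiation uses up at most one factor \<open>A\<close>, so the product keeps
  vanishing at the roots of \<open>A\<close> up to order s - 1.\<close>

lemma higher_pderiv_power_mult:
  fixes A R :: "real poly"
  shows "l \<le> s \<Longrightarrow> \<exists>R'. (pderiv ^^ l) (A ^ s * R) = A ^ (s - l) * R'"
proof (induction l)
  case (Suc l)
  then obtain R' where R': "(pderiv ^^ l) (A ^ s * R) = A ^ (s - l) * R'" by auto
  obtain k where k: "s - l = Suc k" using Suc.prems by (metis Suc_diff_Suc Suc_le_lessD)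
  have "pderiv (A ^ Suc k * R') = A ^ k * (smult (of_nat (Suc k)) (pderiv A) * R' + A * pderiv R')"
    unfolding pderiv_mult pderiv_power_Suc by (simp add: algebra_simps del: of_nat_Suc)
  then show ?case
    using R' k by (metis Suc_diff_Suc Suc.prems Suc_le_lessD diff_Suc_Suc comp_apply funpow.simps(2) nat.inject)
qed auto

lemma poly_higher_pderiv_power_mult:
  fixes A R :: "real poly"
  assumes "l < s" "poly A t = 0"
  shows "poly ((pderiv ^^ l) (A ^ s * R)) t = 0"
  using higher_pderiv_power_mult[of l s A R] assms by (auto simp: power_0_left)

lemma higher_pderiv_pcompose_linear:
  "(pderiv ^^ k) (pcompose w [:\<beta>, \<gamma>:]) = smult (\<gamma> ^ k) (pcompose ((pderiv ^^ k) w) [:\<beta>, \<gamma>:])"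
  for \<gamma> :: real
  by (induction k) (simp_all add: pderiv_smult pderiv_pcompose pderiv_pCons mult.commute)

text \<open>This is (t - c)(t - d), given by its coefficients.\<close>

definition bubble :: "real \<Rightarrow> real \<Rightarrow> real poly" where
  "bubble c d = [:c * d, - (c + d), 1:]"

lemma bubble_simps [simp]:
  "poly (bubble c d) c = 0" "poly (bubble c d) d = 0" "degree (bubble c d) = 2" "bubble c d \<noteq> 0"
  by (simp_all add: bubble_def algebra_simps)

text \<open>Rodrigues' formula on [c, d] without the normalising factor: a nonzero multiple of the
  transported Legendre polynomial when c < d. Working on the cell itself keeps orthogonality free of
  changes of variable.\<close>

definition legendre_on :: "real \<Rightarrow> real \<Rightarrow> nat \<Rightarrow> real poly" where
  "legendre_on c d n = (pderiv ^^ n) (bubble c d ^ n)"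

text \<open>The polynomial omega of the overview for s = m + 1 and n = p - m. It vanishes to order s
  at both ends and at the zeros of the s-th derivative of the Legendre polynomial; its degree is
  then 2 s + (n - s) = p + 1.\<close>

definition nodal_poly :: "real \<Rightarrow> real \<Rightarrow> nat \<Rightarrow> nat \<Rightarrow> real poly" where
  "nodal_poly c d s n = bubble c d ^ s * (pderiv ^^ s) (legendre_on c d n)"

lemma L2_inner_higher_pderiv:
  assumes "c \<le> d" "\<And>l. l < s \<Longrightarrow> poly ((pderiv ^^ l) w) c = 0 \<and> poly ((pderiv ^^ l) w) d = 0"
  shows "L2_inner c d (poly q) (poly ((pderiv ^^ s) w)) =
    (-1) ^ s * L2_inner c d (poly ((pderiv ^^ s) q)) (poly w)"
  using deriv_chain_parts[OF deriv_chain_poly[of s c d q] deriv_chain_poly[of s c d w], of s 0] assms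
  by simp

text \<open>All n derivatives of Rodrigues' formula are moved to q, whose n-th derivative is
  zero.\<close>

lemma legendre_on_orthogonal:
  assumes "c \<le> d" "degree q < n"
  shows "L2_inner c d (poly q) (poly (legendre_on c d n)) = 0"
proof -
  have "L2_inner c d (poly q) (poly (legendre_on c d n)) =
      (-1) ^ n * L2_inner c d (poly ((pderiv ^^ n) q)) (poly (bubble c d ^ n))"
    unfolding legendre_on_def using poly_higher_pderiv_power_mult[where R = 1]
    by (intro L2_inner_higher_pderiv assms) auto
  then show ?thesis
    using assms by (simp add: higher_pderiv_eq_0 L2_inner_def)
qed

text \<open>Moving \<open>s\<close> derivatives off the product and then \<open>s\<close> derivatives off the Legendre polynomial
  maps \<open>q\<close> to a polynomial of no larger degree.\<close>

lemma nodal_poly_orthogonal: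
  assumes "c \<le> d" "degree q < n"
  shows "L2_inner c d (poly q) (poly ((pderiv ^^ s) (nodal_poly c d s n))) = 0"
proof -
  let ?A = "bubble c d" and ?L = "legendre_on c d n"
  define r where "r = ?A ^ s * (pderiv ^^ s) q"
  have vanish: "poly ((pderiv ^^ l) (?A ^ s * R)) c = 0 \<and> poly ((pderiv ^^ l) (?A ^ s * R)) d = 0"
    if "l < s" for l R
    using that by (simp add: poly_higher_pderiv_power_mult)
  have "L2_inner c d (poly q) (poly ((pderiv ^^ s) (nodal_poly c d s n))) =
      (-1) ^ s * L2_inner c d (poly ((pderiv ^^ s) q)) (poly (nodal_poly c d s n))"
    unfolding nodal_poly_def by (intro L2_inner_higher_pderiv assms vanish)
  also have "L2_inner c d (poly ((pderiv ^^ s) q)) (poly (nodal_poly c d s n)) =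
      L2_inner c d (poly ((pderiv ^^ s) ?L)) (poly r)"
    by (simp add: L2_inner_def nodal_poly_def r_def mult_ac)
  also have "L2_inner c d (poly ?L) (poly ((pderiv ^^ s) r)) =
      (-1) ^ s * L2_inner c d (poly ((pderiv ^^ s) ?L)) (poly r)"
    unfolding r_def by (intro L2_inner_higher_pderiv assms vanish)
  then have "L2_inner c d (poly ((pderiv ^^ s) ?L)) (poly r) =
      (-1) ^ s * L2_inner c d (poly ?L) (poly ((pderiv ^^ s) r))"
    by simp
  also have "L2_inner c d (poly ?L) (poly ((pderiv ^^ s) r)) = 0"
  \<comment> \<open>For s > \<open>degree q\<close> the degree count for r breaks down, as
    \<open>degree q - s\<close> is truncated to 0, but then r itself is zero.\<close>
  proof (cases "s \<le> degree q")
    case True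
    have "degree r \<le> 2 * s + (degree q - s)"
      unfolding r_def by (rule order.trans[OF degree_mult_le])
        (simp add: degree_power_eq degree_higher_pderiv mult.commute)
    then have "degree ((pderiv ^^ s) r) < n"
      using True assms by (simp add: degree_higher_pderiv)
    then show ?thesis
      using legendre_on_orthogonal[OF \<open>c \<le> d\<close>] L2_inner_commute by metis
  next
    case False
    then have "r = 0" by (simp add: r_def higher_pderiv_eq_0)
    then show ?thesis by (simp add: L2_inner_def)
  qed
  finally show ?thesis by simp
qed

lemma legendre_on_degree: "degree (legendre_on c d n) = n"
  by (simp add: legendre_on_def degree_higher_pderiv degree_power_eq)

lemma legendre_on_neq_0: "legendre_on c d n \<noteq> 0"
  unfolding legendre_on_def by (rule higher_pderiv_neq_0) (simp_all add: degree_power_eq)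

lemma nodal_poly_degree:
  assumes "s \<le> n"
  shows "degree (nodal_poly c d s n) = s + n" "nodal_poly c d s n \<noteq> 0"
proof -
  have nz: "(pderiv ^^ s) (legendre_on c d n) \<noteq> 0"
    using assms by (intro higher_pderiv_neq_0) (simp_all add: legendre_on_degree legendre_on_neq_0)
  then show "nodal_poly c d s n \<noteq> 0"
    by (simp add: nodal_poly_def)
  show "degree (nodal_poly c d s n) = s + n"
    using nz assms
    by (simp add: nodal_poly_def degree_mult_eq degree_power_eq degree_higher_pderiv legendre_on_degree)
qed

text \<open>\<open>bubble c d ^ n\<close> vanishes to order n at both ends and nowhere inside, which
  is the case \<open>Z = {}\<close> of the Rolle count: n + s differentiations leave n - s
  zeros.\<close>

lemma legendre_on_interior_zeros:
  assumes "c < d" "s \<le> n"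
  shows "\<exists>Z\<subseteq>{c<..<d}. finite Z \<and> card Z = n - s \<and>
    (\<forall>z\<in>Z. poly ((pderiv ^^ s) (legendre_on c d n)) z = 0)"
proof -
  have "poly ((pderiv ^^ l) (bubble c d ^ n)) c = 0 \<and> poly ((pderiv ^^ l) (bubble c d ^ n)) d = 0"
    if "l < n" for l
    using that poly_higher_pderiv_power_mult[where R = 1] by simp
  then have "\<exists>Y\<subseteq>{c<..<d}. finite Y \<and> card Y = n - s \<and>
      (\<forall>y\<in>Y. poly ((pderiv ^^ (n + s)) (bubble c d ^ n)) y = 0)"
    using deriv_chain_zeros_falling[OF deriv_chain_poly[of "n + s" c d "bubble c d ^ n"] \<open>c < d\<close>,
        of "{}" n s] assms by simp
  then show ?thesis
    by (simp add: legendre_on_def funpow_add add.commute[of n s])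
qed

text \<open>The affine map \<beta> + \<gamma> t from [c, d] onto [-1, 1] turns one Rodrigues formula
  into the other up to a nonzero factor, so zeros correspond to zeros.\<close>

lemma legendre_on_zero_imp_jacobi_node:
  assumes "c < d" and zero: "poly ((pderiv ^^ (m + 1)) (legendre_on c d (p - m))) t = 0"
  shows "(2 * t - (c + d)) / (d - c) \<in> jacobi_nodes p m"
proof -
  define n \<beta> \<gamma> where "n = p - m" and "\<beta> = - (c + d) / (d - c)" and "\<gamma> = 2 / (d - c)"
  have h: "d - c \<noteq> 0" using assms by simp
  have \<gamma>: "\<gamma> \<noteq> 0" using h by (simp add: \<gamma>_def)
  \<comment> \<open>This expresses \<beta> through \<gamma>, so that no denominator d - c is left to
    cancel.\<close>
  have "e / y = e * (2 / y) / 2" for e y :: real by simp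
  from this[of "- (c + d)" "d - c"]
  have \<beta>: "\<beta> = - (c + d) * \<gamma> / 2" by (simp only: \<beta>_def \<gamma>_def)
  have one: "(d - c) * \<gamma> / 2 = 1"
    using h by (simp add: \<gamma>_def)
  \<comment> \<open>The constant 1 is written as ((d - c) \<gamma> / 2)^2, so that the constant
    coefficient becomes \<gamma>^2 ((c + d)^2 - (d - c)^2) / 4 = \<gamma>^2 c d.\<close>
  have "[:-1, 0, 1:] \<circ>\<^sub>p [:\<beta>, \<gamma>:] = [:\<beta> ^ 2 - ((d - c) * \<gamma> / 2) ^ 2, 2 * \<beta> * \<gamma>, \<gamma> ^ 2:]"
    unfolding one by (simp add: pcompose_pCons power2_eq_square)
  also have "\<dots> = smult (\<gamma> ^ 2) (bubble c d)"
    by (simp add: bubble_def \<beta> field_simps power2_eq_square)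
  finally have bubble: "bubble c d = smult (1 / \<gamma> ^ 2) ([:-1, 0, 1:] \<circ>\<^sub>p [:\<beta>, \<gamma>:])"
    using \<gamma> by simp
  have power: "(w \<circ>\<^sub>p v) ^ k = (w ^ k) \<circ>\<^sub>p v" for w v :: "real poly" and k
    by (induction k) (simp_all add: pcompose_1 pcompose_mult)
  have "(pderiv ^^ (m + 1)) (legendre_on c d n) = (pderiv ^^ (m + 1 + n)) (bubble c d ^ n)"
    unfolding legendre_on_def by (simp add: funpow_add)
  also have "\<dots> = smult ((1 / \<gamma> ^ 2) ^ n * \<gamma> ^ (m + 1 + n))
      ((pderiv ^^ (m + 1 + n)) ([:-1, 0, 1:] ^ n) \<circ>\<^sub>p [:\<beta>, \<gamma>:])"
    unfolding bubble smult_power power higher_pderiv_smult higher_pderiv_pcompose_linear by simp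
  finally have "(1 / \<gamma> ^ 2) ^ n * \<gamma> ^ (m + 1 + n) *
      poly ((pderiv ^^ (m + 1 + n)) ([:-1, 0, 1:] ^ n)) (\<beta> + \<gamma> * t) = 0"
    using zero by (simp add: n_def poly_pcompose mult.commute del: funpow.simps)
  then have "poly ((pderiv ^^ (m + 1 + n)) ([:-1, 0, 1:] ^ n)) (\<beta> + \<gamma> * t) = 0"
    using \<gamma> by simp
  moreover have "\<beta> + \<gamma> * t = (2 * t - (c + d)) / (d - c)"
    by (simp add: \<beta>_def \<gamma>_def diff_divide_distrib add_divide_distrib)
  moreover have "(pderiv ^^ (m + 1)) (legendre_poly n) =
      smult (1 / (2 ^ n * fact n)) ((pderiv ^^ (m + 1 + n)) ([:-1, 0, 1:] ^ n))"
    unfolding legendre_poly_def higher_pderiv_smult by (simp add: funpow_add)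
  ultimately show ?thesis
    by (simp add: jacobi_nodes_def n_def del: funpow.simps)
qed


section \<open>The interpolation error on one cell\<close>

text \<open>The zeros are m + 1 at each end and p - 2m - 1 nodes inside. \<open>G\<close> is
  arbitrary because the count is applied both to u - W and to u - W minus a multiple of the nodal
  polynomial.\<close>

lemma hermite_jacobi_error_zeros:
  assumes "c < d" "m + 1 \<le> p - m"
    and G: "deriv_chain {} K c d G"
    and ends: "\<And>l. l \<le> m \<Longrightarrow> G l c = 0 \<and> G l d = 0"
    and nodes: "\<And>t. t \<in> {c<..<d} \<Longrightarrow>
      poly ((pderiv ^^ (m + 1)) (legendre_on c d (p - m))) t = 0 \<Longrightarrow> G 0 t = 0"
    and "l \<le> p" "l \<le> K"
  shows "\<exists>z\<in>{c..d}. G l z = 0"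
proof (cases "l \<le> m")
  case True
  then show ?thesis using ends \<open>c < d\<close> by (intro bexI[of _ c]) auto
next
  case False
  obtain Z where Z: "Z \<subseteq> {c<..<d}" "finite Z" "card Z = p - m - (m + 1)"
    "\<forall>z\<in>Z. poly ((pderiv ^^ (m + 1)) (legendre_on c d (p - m))) z = 0"
    using legendre_on_interior_zeros[OF assms(1,2)] by blast
  have "\<exists>Y\<subseteq>{c<..<d}. finite Y \<and> card Y = card Z + (m + 1) - (l - (m + 1)) \<and>
      (\<forall>y\<in>Y. G (m + 1 + (l - (m + 1))) y = 0)"
  proof (rule deriv_chain_zeros_falling[OF G \<open>c < d\<close> Z(1,2)])
    show "G 0 z = 0" if "z \<in> Z" for z
      using that Z(1,4) nodes by blast
    show "G i c = 0 \<and> G i d = 0" if "i < m + 1" for i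
      using that ends by simp
  qed (use False Z(3) assms(2,6,7) in simp_all)
  \<comment> \<open>Order l is left with (p - 2m - 1) + (m + 1) - (l - m - 1) = p + 1 - l zeros, at
    least one up to l = p.\<close>
  moreover have "card Z + (m + 1) - (l - (m + 1)) > 0"
    using Z(3) False assms(2) \<open>l \<le> p\<close> by simp
  ultimately obtain Y where "Y \<subseteq> {c<..<d}" "Y \<noteq> {}" "\<forall>y\<in>Y. G l y = 0"
    using False by (metis add_diff_inverse_nat card.empty less_irrefl not_less_eq_eq Suc_eq_plus1 not_le)
  then show ?thesis
    by (auto simp: subset_iff) (meson atLeastAtMost_iff less_imp_le)
qed

lemma L2_inner_bound_of_sup:
  assumes "bounded_measurable c d g" "bounded_measurable c d E" "\<And>x. x \<in> {c..d} \<Longrightarrow> \<bar>g x\<bar> \<le> M"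
  shows "\<bar>L2_inner c d g E\<bar> \<le> M * (\<integral>x. \<bar>E x\<bar> \<partial>lebesgue_on {c..d})"
proof -
  have "\<bar>L2_inner c d g E\<bar> \<le> (\<integral>x. \<bar>g x * E x\<bar> \<partial>lebesgue_on {c..d})"
    unfolding L2_inner_def by (rule integral_abs_bound)
  also have "\<dots> \<le> (\<integral>x. M * \<bar>E x\<bar> \<partial>lebesgue_on {c..d})"
    using assms
    by (intro integral_mono bounded_measurable_integrable bounded_measurable_intros)
      (auto simp: abs_mult intro!: mult_right_mono)
  finally show ?thesis by simp
qed

text \<open>One cell (c, d): \<open>D\<close> carries the derivatives of u, and \<open>q\<close> is
  the polynomial piece of W there.\<close>

context
  fixes c d :: real and m p :: nat and D :: "nat \<Rightarrow> real \<Rightarrow> real" and q :: "real poly"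
  assumes cd: "c < d" and pm: "2 * m + 1 \<le> p"
    and D: "deriv_chain {} (p + 2) c d D"
    and deg: "degree q \<le> p"
    and ends: "\<And>l t. l \<le> m \<Longrightarrow> t \<in> {c, d} \<Longrightarrow> poly ((pderiv ^^ l) q) t = D l t"
    and nodes: "\<And>\<mu>. \<mu> \<in> jacobi_nodes p m \<Longrightarrow>
      poly q ((c + d) / 2 + (d - c) * \<mu> / 2) = D 0 ((c + d) / 2 + (d - c) * \<mu> / 2)"
begin

lemma interpolation_error_nodes:
  assumes "poly ((pderiv ^^ (m + 1)) (legendre_on c d (p - m))) t = 0"
  shows "poly q t = D 0 t"
proof -
  have "(c + d) / 2 + (d - c) * ((2 * t - (c + d)) / (d - c)) / 2 = t"
    using cd by (simp add: field_simps)
  then show ?thesis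
    using nodes[OF legendre_on_zero_imp_jacobi_node[OF cd assms]] by metis
qed

text \<open>The error has a zero at every order up to p, and its derivative of order p + 1 is that
  of u because q has degree at most p.\<close>

lemma interpolation_error_le:
  assumes "k \<le> p" "x \<in> {c..d}"
  shows "\<bar>D k x - poly ((pderiv ^^ k) q) x\<bar> \<le>
    (d - c) ^ (p - k) * (\<integral>t. \<bar>D (p + 1) t\<bar> \<partial>lebesgue_on {c..d})"
proof -
  have G: "deriv_chain {} (Suc p) c d (\<lambda>l x. D l x - poly ((pderiv ^^ l) q) x)"
    using deriv_chain_diff[OF deriv_chain_le[OF D, of "Suc p"] deriv_chain_poly] by simp
  have "\<exists>z\<in>{c..d}. D l z - poly ((pderiv ^^ l) q) z = 0" if "l \<le> p" for l
    by (rule hermite_jacobi_error_zeros[OF cd _ G, where m = m and p = p])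
      (use that pm ends interpolation_error_nodes in auto)
  from deriv_chain_bound_of_zeros[OF G this \<open>k \<le> p\<close> \<open>x \<in> {c..d}\<close>] show ?thesis
    using deg by (simp add: higher_pderiv_eq_0 del: funpow.simps)
qed

text \<open>Subtracting the multiple of the nodal polynomial that makes the \<open>(p+1)\<close>-st derivative of the
  error vanish at \<open>c\<close> does not change the integral against \<open>r\<close>, but gains one power of the cell length.\<close>

lemma interpolation_error_superconvergence:
  assumes "degree r < p - m" "bounded_measurable c d E" "\<And>x. x \<in> {c<..<d} \<Longrightarrow> E x = poly r x"
  shows "\<bar>L2_inner c d (\<lambda>x. D (m + 1) x - poly ((pderiv ^^ (m + 1)) q) x) E\<bar> \<le>
    (d - c) ^ (p - m) * (\<integral>t. \<bar>D (p + 2) t\<bar> \<partial>lebesgue_on {c..d}) * (\<integral>t. \<bar>E t\<bar> \<partial>lebesgue_on {c..d})"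
proof -
  define \<omega> where "\<omega> = nodal_poly c d (m + 1) (p - m)"
  have deg\<omega>: "degree \<omega> = p + 1" "\<omega> \<noteq> 0"
    using nodal_poly_degree[of "m + 1" "p - m" c d] pm by (simp_all add: \<omega>_def)
  \<comment> \<open>\<omega> has degree exactly p + 1, so its derivative of that order is a nonzero
    constant, by which \<gamma> may divide.\<close>
  obtain \<kappa> where \<kappa>: "(pderiv ^^ (p + 1)) \<omega> = [:\<kappa>:]"
    using deg\<omega>(1) degree_higher_pderiv[of "p + 1" \<omega>] by (metis degree_eq_zeroE diff_self_eq_0)
  have "\<kappa> \<noteq> 0"
    using higher_pderiv_neq_0[of \<omega> "p + 1"] deg\<omega> \<kappa> by auto
  define \<gamma> where "\<gamma> = D (p + 1) c / \<kappa>"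
  define g where "g = (\<lambda>x. D (m + 1) x - poly ((pderiv ^^ (m + 1)) q) x)"
  define H where "H = (\<lambda>l x. (D l x - poly ((pderiv ^^ l) q) x) - \<gamma> * poly ((pderiv ^^ l) \<omega>) x)"
  have H: "deriv_chain {} (Suc (p + 1)) c d H"
    unfolding H_def
    using deriv_chain_lincomb[OF deriv_chain_diff[OF D deriv_chain_poly] deriv_chain_poly, of q \<gamma> \<omega>] by simp
  have zeros: "\<exists>z\<in>{c..d}. H l z = 0" if "l \<le> p + 1" for l
  proof (cases "l = p + 1")
    case True
    have "H (p + 1) c = 0"
      using deg \<kappa> \<open>\<kappa> \<noteq> 0\<close> unfolding H_def \<gamma>_def by (simp add: higher_pderiv_eq_0 del: funpow.simps)
    then show ?thesis using True cd by (intro bexI[of _ c]) auto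
  next
    case False
    show ?thesis
    \<comment> \<open>\<omega> satisfies the same homogeneous end point and node conditions as the
      error, so subtracting a multiple preserves the zeros up to order p.\<close>
    proof (rule hermite_jacobi_error_zeros[OF cd _ H, where m = m and p = p])
      show "H l c = 0 \<and> H l d = 0" if "l \<le> m" for l
        using that ends[of l]
        by (simp add: H_def \<omega>_def nodal_poly_def poly_higher_pderiv_power_mult del: power_Suc)
      show "H 0 t = 0" if "poly ((pderiv ^^ (m + 1)) (legendre_on c d (p - m))) t = 0" for t
        using that interpolation_error_nodes[OF that]
        by (simp add: H_def \<omega>_def nodal_poly_def del: funpow.simps)
    qed (use False that pm in auto)
  qed
  \<comment> \<open>At order p + 2 both q and \<omega> have disappeared and only
    \<open>D (p + 2)\<close> remains under the integral; the exponent is (p + 1) - (m + 1).\<close>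
  have bound: "\<bar>H (m + 1) x\<bar> \<le> (d - c) ^ (p - m) * (\<integral>t. \<bar>D (p + 2) t\<bar> \<partial>lebesgue_on {c..d})"
    if "x \<in> {c..d}" for x
    using deriv_chain_bound_of_zeros[OF H zeros, of "m + 1" x] that pm deg deg\<omega>
    by (simp add: H_def higher_pderiv_eq_0 del: funpow.simps)
  have bm: "bounded_measurable c d (H (m + 1))" "bounded_measurable c d (poly ((pderiv ^^ (m + 1)) \<omega>))"
    using pm
    by (auto intro!: deriv_chain_bounded_measurable[OF H] bounded_measurable_continuous[OF continuous_on_poly]
        continuous_on_id simp del: funpow.simps)
  have "L2_inner c d (poly r) (poly ((pderiv ^^ (m + 1)) \<omega>)) = 0"
    unfolding \<omega>_def using nodal_poly_orthogonal[of c d r "p - m" "m + 1"] assms cd by simp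
  moreover have "L2_inner c d (poly ((pderiv ^^ (m + 1)) \<omega>)) E = L2_inner c d (poly r) (poly ((pderiv ^^ (m + 1)) \<omega>))"
    using assms(3) bm(2) assms(2)
    by (subst L2_inner_commute, intro L2_inner_cong_finite[of "{c, d}"])
      (auto intro: bounded_measurable_continuous[OF continuous_on_poly])
  moreover have "L2_inner c d g E = L2_inner c d (H (m + 1)) E + \<gamma> * L2_inner c d (poly ((pderiv ^^ (m + 1)) \<omega>)) E"
  proof -
    have "g = (\<lambda>x. H (m + 1) x + \<gamma> * poly ((pderiv ^^ (m + 1)) \<omega>) x)"
      by (simp add: g_def H_def)
    then show ?thesis
      using bm assms(2) by (simp add: L2_inner_add_left L2_inner_cmult_left bounded_measurable_intros del: funpow.simps)
  qed
  ultimately have "L2_inner c d g E = L2_inner c d (H (m + 1)) E"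
    by simp
  then show ?thesis
    using L2_inner_bound_of_sup[OF bm(1) assms(2) bound] by (simp add: g_def)
qed

text \<open>The bound arises with the L1 norms of \<open>D (p + 1)\<close> and \<open>E\<close>;
  passing to L2 norms contributes sqrt (d - c) twice, which raises the exponent from p - k to p + 1
  - k.\<close>

lemma interpolation_error_L2_inner_le:
  assumes "k \<le> p" "bounded_measurable c d Q" "bounded_measurable c d E"
    and Q: "\<And>t. t \<in> {c..d} \<Longrightarrow> \<bar>Q t\<bar> \<le> B"
  shows "\<bar>L2_inner c d (\<lambda>t. Q t * (D k t - poly ((pderiv ^^ k) q) t)) E\<bar> \<le>
    B * (d - c) ^ (p + 1 - k) * (sqrt (L2_inner c d (D (p + 1)) (D (p + 1))) * sqrt (L2_inner c d E E))"
proof -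
  define A1 where "A1 = sqrt (L2_inner c d (D (p + 1)) (D (p + 1)))"
  define B1 where "B1 = sqrt (L2_inner c d E E)"
  have bm: "bounded_measurable c d (D k)" "bounded_measurable c d (D (p + 1))"
    using deriv_chain_bounded_measurable[OF D] \<open>k \<le> p\<close> by auto
  have poly: "bounded_measurable c d (poly r)" for r
    by (intro bounded_measurable_continuous continuous_intros)
  have "B \<ge> 0" using Q[of c] cd by fastforce
  have nonneg: "0 \<le> A1" "0 \<le> B1" by (simp_all add: A1_def B1_def L2_inner_self_nonneg)
  have "\<bar>L2_inner c d (\<lambda>t. Q t * (D k t - poly ((pderiv ^^ k) q) t)) E\<bar> \<le>
      (B * ((d - c) ^ (p - k) * (sqrt (d - c) * A1))) * (\<integral>t. \<bar>E t\<bar> \<partial>lebesgue_on {c..d})"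
  proof (rule L2_inner_bound_of_sup)
    show "bounded_measurable c d (\<lambda>t. Q t * (D k t - poly ((pderiv ^^ k) q) t))"
      by (intro bounded_measurable_intros assms bm poly)
    fix t assume t: "t \<in> {c..d}"
    have "\<bar>D k t - poly ((pderiv ^^ k) q) t\<bar> \<le> (d - c) ^ (p - k) * (sqrt (d - c) * A1)"
      unfolding A1_def using cd L1_le_L2[OF bm(2)]
      by (intro order.trans[OF interpolation_error_le[OF \<open>k \<le> p\<close> t]] mult_left_mono) auto
    then show "\<bar>Q t * (D k t - poly ((pderiv ^^ k) q) t)\<bar> \<le> B * ((d - c) ^ (p - k) * (sqrt (d - c) * A1))"
      unfolding abs_mult using Q[OF t] \<open>B \<ge> 0\<close> by (intro mult_mono) auto
  qed fact
  also have "\<dots> \<le> (B * ((d - c) ^ (p - k) * (sqrt (d - c) * A1))) * (sqrt (d - c) * B1)"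
    unfolding B1_def using cd L1_le_L2[OF assms(3)] nonneg \<open>B \<ge> 0\<close> by (intro mult_left_mono) auto
  also have "\<dots> = B * (d - c) ^ (p - k) * (sqrt (d - c))\<^sup>2 * (A1 * B1)"
    by (simp only: power2_eq_square mult_ac)
  also have "\<dots> = B * (d - c) ^ (p + 1 - k) * (A1 * B1)"
    using cd \<open>k \<le> p\<close> by (simp add: Suc_diff_le mult_ac)
  finally show ?thesis by (simp add: A1_def B1_def)
qed

text \<open>Orthogonality to \<open>r\<close> survives only a constant weight, so \<open>Q\<close>
  is split into \<open>Q c\<close> and \<open>Q t - Q c\<close>. The first part has the
  superconvergent bound; in the second the factor B' (d - c) supplies the missing power.\<close>

lemma interpolation_error_top_L2_inner_le:
  assumes "degree r < p - m" "bounded_measurable c d Q" "bounded_measurable c d E"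
    and E: "\<And>t. t \<in> {c<..<d} \<Longrightarrow> E t = poly r t"
    and Q: "\<bar>Q c\<bar> \<le> B" "\<And>t. t \<in> {c..d} \<Longrightarrow> \<bar>Q t - Q c\<bar> \<le> B' * (d - c)"
  shows "\<bar>L2_inner c d (\<lambda>t. Q t * (D (m + 1) t - poly ((pderiv ^^ (m + 1)) q) t)) E\<bar> \<le>
    B * (d - c) ^ (p - m + 1) * (sqrt (L2_inner c d (D (p + 2)) (D (p + 2))) * sqrt (L2_inner c d E E)) +
    B' * (d - c) ^ (p - m + 1) * (sqrt (L2_inner c d (D (p + 1)) (D (p + 1))) * sqrt (L2_inner c d E E))"
proof -
  define g where "g = (\<lambda>t. D (m + 1) t - poly ((pderiv ^^ (m + 1)) q) t)"
  define A2 where "A2 = sqrt (L2_inner c d (D (p + 2)) (D (p + 2)))"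
  define B1 where "B1 = sqrt (L2_inner c d E E)"
  have poly: "bounded_measurable c d (poly r)" for r
    by (intro bounded_measurable_continuous continuous_intros)
  have bm: "bounded_measurable c d g" "bounded_measurable c d (D (p + 2))"
    unfolding g_def using pm
    by (intro bounded_measurable_diff poly deriv_chain_bounded_measurable[OF D]; simp)+
  have nonneg: "0 \<le> A2" "0 \<le> B1" "0 \<le> B"
    using Q(1) by (auto simp: A2_def B1_def L2_inner_self_nonneg)
  have "\<bar>L2_inner c d g E\<bar> \<le> (d - c) ^ (p - m) * (\<integral>t. \<bar>D (p + 2) t\<bar> \<partial>lebesgue_on {c..d}) *
      (\<integral>t. \<bar>E t\<bar> \<partial>lebesgue_on {c..d})"
    unfolding g_def by (rule interpolation_error_superconvergence[OF assms(1,3) E])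
  also have "\<dots> \<le> (d - c) ^ (p - m) * (sqrt (d - c) * A2) * (sqrt (d - c) * B1)"
    unfolding A2_def B1_def using cd L1_le_L2[OF bm(2)] L1_le_L2[OF assms(3)]
    by (intro mult_mono) (auto intro!: mult_nonneg_nonneg simp: L2_inner_self_nonneg)
  also have "\<dots> = (d - c) ^ (p - m) * (sqrt (d - c))\<^sup>2 * (A2 * B1)"
    by (simp only: power2_eq_square mult_ac)
  also have "\<dots> = (d - c) ^ (p - m + 1) * (A2 * B1)"
    using cd by (simp add: mult_ac)
  finally have main: "\<bar>Q c * L2_inner c d g E\<bar> \<le> B * ((d - c) ^ (p - m + 1) * (A2 * B1))"
    unfolding abs_mult using Q(1) nonneg by (intro mult_mono) auto
  have "\<bar>L2_inner c d (\<lambda>t. (Q t - Q c) * (D (m + 1) t - poly ((pderiv ^^ (m + 1)) q) t)) E\<bar> \<le>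
      B' * (d - c) * (d - c) ^ (p + 1 - (m + 1)) *
        (sqrt (L2_inner c d (D (p + 1)) (D (p + 1))) * sqrt (L2_inner c d E E))"
    using pm Q(2) by (intro interpolation_error_L2_inner_le bounded_measurable_intros assms) auto
  moreover have "L2_inner c d (\<lambda>t. Q t * g t) E = L2_inner c d (\<lambda>t. Q c * g t + (Q t - Q c) * g t) E"
    by (simp add: algebra_simps)
  then have "L2_inner c d (\<lambda>t. Q t * g t) E =
      Q c * L2_inner c d g E + L2_inner c d (\<lambda>t. (Q t - Q c) * g t) E"
    using bm assms by (simp add: L2_inner_add_left L2_inner_cmult_left bounded_measurable_intros)
  ultimately show ?thesis
    using main by (simp add: g_def A2_def B1_def mult_ac)
qed

end


section \<open>Test functions\<close>

text \<open>Each level asks for some derivative instead of computing one, so closure under sums,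
  products and affine substitutions is a plain induction without formulas for iterated
  derivatives.\<close>

primrec differentiable_upto :: "nat \<Rightarrow> (real \<Rightarrow> real) \<Rightarrow> bool" where
  "differentiable_upto 0 f = True"
| "differentiable_upto (Suc k) f =
     (\<exists>f'. (\<forall>x. (f has_real_derivative f' x) (at x)) \<and> differentiable_upto k f')"

definition smooth :: "(real \<Rightarrow> real) \<Rightarrow> bool" where
  "smooth f \<longleftrightarrow> (\<forall>k. differentiable_upto k f)"

lemma differentiable_upto_SucD: "differentiable_upto (Suc k) f \<Longrightarrow> differentiable_upto k f"
proof (induction k arbitrary: f)
  case (Suc k)
  then obtain f' where "\<forall>x. (f has_real_derivative f' x) (at x)" "differentiable_upto (Suc k) f'"
    by (metis differentiable_upto.simps(2))
  then show ?case using Suc.IH by auto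
qed simp

lemma differentiable_upto_const: "differentiable_upto k (\<lambda>x. c)"
proof (induction k arbitrary: c)
  case (Suc k)
  then show ?case by (auto intro!: exI[of _ "\<lambda>x. 0"])
qed simp

lemma differentiable_upto_add:
  "differentiable_upto k f \<Longrightarrow> differentiable_upto k g \<Longrightarrow> differentiable_upto k (\<lambda>x. f x + g x)"
proof (induction k arbitrary: f g)
  case (Suc k)
  then obtain f' g' where
    "\<forall>x. (f has_real_derivative f' x) (at x)" "differentiable_upto k f'"
    "\<forall>x. (g has_real_derivative g' x) (at x)" "differentiable_upto k g'" by auto
  then show ?case
    by (auto intro!: exI[of _ "\<lambda>x. f' x + g' x"] Suc.IH DERIV_add)
qed simp

lemma differentiable_upto_mult:
  "differentiable_upto k f \<Longrightarrow> differentiable_upto k g \<Longrightarrow> differentiable_upto k (\<lambda>x. f x * g x)"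
proof (induction k arbitrary: f g)
  case (Suc k)
  obtain f' where f': "\<forall>x. (f has_real_derivative f' x) (at x)" "differentiable_upto k f'"
    using Suc.prems by auto
  obtain g' where g': "\<forall>x. (g has_real_derivative g' x) (at x)" "differentiable_upto k g'"
    using Suc.prems by auto
  have "differentiable_upto k (\<lambda>x. f' x * g x + g' x * f x)"
    by (rule differentiable_upto_add[OF Suc.IH[OF f'(2) differentiable_upto_SucD[OF Suc.prems(2)]]
            Suc.IH[OF g'(2) differentiable_upto_SucD[OF Suc.prems(1)]]])
  moreover have "\<forall>x. ((\<lambda>x. f x * g x) has_real_derivative f' x * g x + g' x * f x) (at x)"
    using f' g' by (auto intro: DERIV_mult)
  ultimately show ?case by auto
qed simp

lemma differentiable_upto_affine:
  "differentiable_upto k f \<Longrightarrow> differentiable_upto k (\<lambda>x. f (\<gamma> * x + \<beta>))"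
proof (induction k arbitrary: f)
  case (Suc k)
  then obtain f' where f': "\<forall>x. (f has_real_derivative f' x) (at x)" "differentiable_upto k f'"
    by auto
  have "((\<lambda>x. \<gamma> * x + \<beta>) has_real_derivative \<gamma>) (at x)" for x
    by (auto intro!: derivative_eq_intros)
  then have "((\<lambda>x. f (\<gamma> * x + \<beta>)) has_real_derivative f' (\<gamma> * x + \<beta>) * \<gamma>) (at x)" for x
    using f'(1) by (intro DERIV_chain2[where f = f]) blast+
  moreover have "differentiable_upto k (\<lambda>x. f' (\<gamma> * x + \<beta>) * \<gamma>)"
    using f' by (intro differentiable_upto_mult differentiable_upto_const Suc.IH)
  ultimately show ?case by (auto intro!: exI[of _ "\<lambda>x. f' (\<gamma> * x + \<beta>) * \<gamma>"])
qed simp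

lemma differentiable_upto_poly: "differentiable_upto k (poly q)"
proof (induction k arbitrary: q)
  case (Suc k)
  then show ?case by (auto intro!: exI[of _ "poly (pderiv q)"] poly_DERIV)
qed simp

lemma differentiable_upto_sum:
  "(\<And>i. i \<in> I \<Longrightarrow> differentiable_upto k (f i)) \<Longrightarrow> differentiable_upto k (\<lambda>x. \<Sum>i\<in>I. f i x)"
  by (induction I rule: infinite_finite_induct) (auto intro: differentiable_upto_add differentiable_upto_const)

section \<open>Evaluation of \<open>nderiv\<close> and its relation to smoothness\<close>

lemma nderiv_Suc_shift: "nderiv S (Suc k) u = nderiv S k (nderiv S 1 u)"
  by (induction k) simp_all

text \<open>Where \<open>at x within S\<close> is nontrivial the derivative within \<open>S\<close>
  is unique, so any family that differentiates step by step must be the family of iterated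
  derivatives.\<close>

lemma nderiv_eqI:
  assumes "\<And>x. x \<in> S \<Longrightarrow> at x within S \<noteq> bot"
    and D: "\<And>j x. j < k \<Longrightarrow> x \<in> S \<Longrightarrow> (D j has_real_derivative D (Suc j) x) (at x within S)"
    and "j \<le> k" "x \<in> S"
  shows "nderiv S j (D 0) x = D j x"
  using \<open>j \<le> k\<close> \<open>x \<in> S\<close>
proof (induction j arbitrary: x)
  case (Suc j)
  have "(nderiv S j (D 0) has_vector_derivative D (Suc j) x) (at x within S)"
    using Suc D[of j x]
    by (intro has_vector_derivative_transform[of x S "nderiv S j (D 0)" "D j"])
      (auto simp: has_real_derivative_iff_has_vector_derivative)
  then show ?case
    using assms(1) Suc.prems by (simp add: vector_derivative_within)
qed simp

lemma C_on_nderiv: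
  assumes "C_on k S u" "j < k" "x \<in> S"
  shows "(nderiv S j u has_real_derivative nderiv S (Suc j) u x) (at x within S)"
  using assms vector_derivative_works
  by (auto simp: C_on_def differentiable_on_def has_real_derivative_iff_has_vector_derivative)

lemma C_onI:
  assumes "\<And>x. x \<in> S \<Longrightarrow> at x within S \<noteq> bot"
    and D: "\<And>j x. j < k \<Longrightarrow> x \<in> S \<Longrightarrow> (D j has_real_derivative D (Suc j) x) (at x within S)"
    and "continuous_on S (D k)"
  shows "C_on k S (D 0)"
proof -
  have eq: "nderiv S j (D 0) x = D j x" if "j \<le> k" "x \<in> S" for j x
    using that by (intro nderiv_eqI[where k = k] assms)
  have "nderiv S j (D 0) differentiable_on S" if "j < k" for j
    unfolding differentiable_on_def
  proof
    fix x assume "x \<in> S"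
    have "(nderiv S j (D 0) has_vector_derivative D (Suc j) x) (at x within S)"
      using D[OF that \<open>x \<in> S\<close>] eq that \<open>x \<in> S\<close>
      by (intro has_vector_derivative_transform[of x S "nderiv S j (D 0)" "D j"])
        (auto simp: has_real_derivative_iff_has_vector_derivative)
    then show "nderiv S j (D 0) differentiable at x within S"
      using differentiableI_vector by blast
  qed
  moreover have "continuous_on S (nderiv S k (D 0))"
    using assms(3) eq by (subst continuous_on_cong[OF refl, of S _ "D k"]) auto
  ultimately show ?thesis by (simp add: C_on_def)
qed

lemma smooth_nderiv:
  assumes "smooth f"
  shows "(nderiv UNIV k f has_real_derivative nderiv UNIV (Suc k) f x) (at x)"
proof -
  have "differentiable_upto (Suc k) f"
    using assms by (simp add: smooth_def del: differentiable_upto.simps)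
  then show ?thesis
  proof (induction k arbitrary: f)
    case 0
    then obtain f' where "\<forall>x. (f has_vector_derivative f' x) (at x)"
      by (auto simp: has_real_derivative_iff_has_vector_derivative)
    then have "(f has_vector_derivative vector_derivative f (at x)) (at x)"
      by (metis vector_derivative_at)
    then show ?case
      by (simp add: has_real_derivative_iff_has_vector_derivative)
  next
    case (Suc k)
    then obtain f' where f': "\<forall>x. (f has_real_derivative f' x) (at x)" "differentiable_upto (Suc k) f'"
      by (metis differentiable_upto.simps(2))
    have "nderiv UNIV 1 f = f'"
      using f'(1) by (auto simp: has_real_derivative_iff_has_vector_derivative intro: vector_derivative_at)
    then show ?case
      using Suc.IH[OF f'(2)] by (simp only: nderiv_Suc_shift)
  qed
qed

text \<open>Translates the smoothness in the definition of \<open>test_functions\<close> into the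
  recursive predicate, for which closure properties are easy.\<close>

lemma smooth_iff_C_on: "smooth f \<longleftrightarrow> (\<forall>k. C_on k UNIV f)"
proof
  assume f: "smooth f"
  have "continuous_on UNIV (nderiv UNIV k f)" for k
    by (rule DERIV_continuous_on[of _ _ "nderiv UNIV (Suc k) f"]) (use smooth_nderiv[OF f] in auto)
  then show "\<forall>k. C_on k UNIV f"
    using C_onI[of UNIV _ "\<lambda>k. nderiv UNIV k f"] smooth_nderiv[OF f] by simp
next
  assume C: "\<forall>k. C_on k UNIV f"
  have "(nderiv UNIV j f has_real_derivative nderiv UNIV (Suc j) f x) (at x)" for j x
    using C_on_nderiv[of "Suc j" UNIV f j x] C by simp
  then have "differentiable_upto k (nderiv UNIV j f)" for k j
    by (induction k arbitrary: j) (auto simp del: nderiv.simps)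
  from this[of _ 0] show "smooth f" by (simp add: smooth_def)
qed

section \<open>Closure properties of test functions\<close>

lemma test_functions_iff:
  "\<phi> \<in> test_functions a b \<longleftrightarrow> smooth \<phi> \<and> (\<exists>c d. a < c \<and> d < b \<and> (\<forall>x. x \<notin> {c..d} \<longrightarrow> \<phi> x = 0))"
  unfolding test_functions_def smooth_iff_C_on by simp

lemma test_function_diff_cmult:
  assumes "\<phi> \<in> test_functions a b" "\<psi> \<in> test_functions a b"
  shows "(\<lambda>x. \<phi> x - c * \<psi> x) \<in> test_functions a b"
proof -
  obtain c1 d1 where 1: "a < c1" "d1 < b" "\<forall>x. x \<notin> {c1..d1} \<longrightarrow> \<phi> x = 0"
    using assms unfolding test_functions_iff by blast
  obtain c2 d2 where 2: "a < c2" "d2 < b" "\<forall>x. x \<notin> {c2..d2} \<longrightarrow> \<psi> x = 0"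
    using assms unfolding test_functions_iff by blast
  have "differentiable_upto k (\<lambda>x. \<phi> x + (- c) * \<psi> x)" for k
    using assms unfolding test_functions_iff smooth_def
    by (intro differentiable_upto_add differentiable_upto_mult differentiable_upto_const) auto
  moreover have "\<phi> x - c * \<psi> x = 0" if "x \<notin> {min c1 c2..max d1 d2}" for x
  proof -
    have "x \<notin> {c1..d1}" "x \<notin> {c2..d2}" using that by auto
    then show ?thesis using 1(3) 2(3) by simp
  qed
  moreover have "a < min c1 c2" "max d1 d2 < b"
    using 1 2 by auto
  moreover from \<open>\<And>k. differentiable_upto k _\<close> have "differentiable_upto k (\<lambda>x. \<phi> x - c * \<psi> x)" for k
    by simp
  ultimately show ?thesis
    unfolding test_functions_iff smooth_def
    by (intro conjI exI[of _ "min c1 c2"] exI[of _ "max d1 d2"]) blast+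
qed

lemma test_function_nderiv:
  assumes "\<phi> \<in> test_functions a b"
  shows "nderiv UNIV k \<phi> \<in> test_functions a b"
  using assms
proof (induction k arbitrary: \<phi>)
  case (Suc k)
  obtain c d where cd: "a < c" "d < b" "\<forall>x. x \<notin> {c..d} \<longrightarrow> \<phi> x = 0" and "smooth \<phi>"
    using Suc.prems unfolding test_functions_iff by blast
  let ?\<phi>' = "nderiv UNIV 1 \<phi>"
  have deriv: "(\<phi> has_real_derivative ?\<phi>' x) (at x)" for x
    using smooth_nderiv[OF \<open>smooth \<phi>\<close>, of 0 x] by simp
  have "?\<phi>' x = 0" if "x \<notin> {c..d}" for x
  proof -
    \<comment> \<open>\<phi> is zero on the open complement of [c, d], hence so is its derivative:
      the support does not grow.\<close>
    have "(\<phi> has_real_derivative 0) (at x)"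
      by (rule has_field_derivative_transform_within_open[of "\<lambda>x. 0" 0 x "- {c..d}"])
        (use that cd in auto)
    then show ?thesis using DERIV_unique deriv by blast
  qed
  moreover have "smooth ?\<phi>'"
    unfolding smooth_def
  proof
    fix k
    have "differentiable_upto (Suc k) \<phi>"
      using \<open>smooth \<phi>\<close> by (simp add: smooth_def del: differentiable_upto.simps)
    then obtain f' where "\<forall>x. (\<phi> has_real_derivative f' x) (at x)" "differentiable_upto k f'"
      by auto
    moreover from this have "f' = ?\<phi>'" using deriv DERIV_unique by blast
    ultimately show "differentiable_upto k ?\<phi>'" by simp
  qed
  ultimately have "?\<phi>' \<in> test_functions a b"
    using cd unfolding test_functions_iff by blast
  then show ?case
    using Suc.IH by (simp only: nderiv_Suc_shift)
qed simp

lemma test_function_boundary: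
  assumes "\<phi> \<in> test_functions a b"
  shows "nderiv UNIV k \<phi> a = 0" "nderiv UNIV k \<phi> b = 0"
  using test_function_nderiv[OF assms, of k] by (auto simp: test_functions_iff)

lemma test_function_chain:
  assumes "\<phi> \<in> test_functions a b"
  shows "deriv_chain {} k a b (\<lambda>i. nderiv UNIV i \<phi>)"
proof -
  have deriv: "(nderiv UNIV i \<phi> has_real_derivative nderiv UNIV (Suc i) \<phi> x) (at x)" for i x
    using assms unfolding test_functions_iff by (intro smooth_nderiv) blast
  have "continuous_on {a..b} (nderiv UNIV i \<phi>)" for i
    by (rule DERIV_continuous_on[of _ _ "nderiv UNIV (Suc i) \<phi>"])
      (use deriv has_field_derivative_at_within in blast)
  then show ?thesis
    using deriv unfolding deriv_chain_def by (auto intro: bounded_measurable_continuous)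
qed

lemma nderiv_UNIV_diff_cmult:
  assumes "smooth f" "smooth g"
  shows "nderiv UNIV k (\<lambda>x. f x - c * g x) = (\<lambda>x. nderiv UNIV k f x - c * nderiv UNIV k g x)"
proof
  fix x
  show "nderiv UNIV k (\<lambda>x. f x - c * g x) x = nderiv UNIV k f x - c * nderiv UNIV k g x"
  proof (rule nderiv_eqI[of UNIV k "\<lambda>i x. nderiv UNIV i f x - c * nderiv UNIV i g x" k x,
        unfolded nderiv.simps(1)])
    show "((\<lambda>x. nderiv UNIV j f x - c * nderiv UNIV j g x) has_real_derivative
        nderiv UNIV (Suc j) f x - c * nderiv UNIV (Suc j) g x) (at x)" for j x
      by (intro DERIV_diff DERIV_cmult smooth_nderiv assms)
  qed simp_all
qed

text \<open>An antiderivative is constant on either side of the support of \<psi>. Normalised to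
  vanish at a, it vanishes on the right as well because the integral of \<psi> is zero.\<close>

lemma test_function_antiderivative:
  assumes \<psi>: "\<psi> \<in> test_functions a b" and "a < b"
    and zero: "(\<integral>x. \<psi> x \<partial>lebesgue_on {a..b}) = 0"
  shows "\<exists>\<Phi>\<in>test_functions a b. \<forall>k. nderiv UNIV (Suc k) \<Phi> = nderiv UNIV k \<psi>"
proof -
  obtain c d where cd: "a < c" "d < b" "\<forall>x. x \<notin> {c..d} \<longrightarrow> \<psi> x = 0" and "smooth \<psi>"
    using \<psi> unfolding test_functions_iff by blast
  have "isCont \<psi> x" for x
    using smooth_nderiv[OF \<open>smooth \<psi>\<close>, of 0 x] DERIV_isCont by auto
  then obtain F where F: "\<And>x. (F has_vector_derivative \<psi> x) (at x)"
    using einterval_antiderivative[of "-\<infinity>" "\<infinity>" \<psi>] by auto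
  define \<Phi> where "\<Phi> = (\<lambda>x. F x - F a)"
  have \<Phi>: "(\<Phi> has_real_derivative \<psi> x) (at x)" for x
    using F[of x] unfolding \<Phi>_def has_real_derivative_iff_has_vector_derivative[symmetric]
    by (auto intro!: derivative_eq_intros)
  have "smooth \<Phi>"
    unfolding smooth_def
  proof
    fix k
    have "differentiable_upto (Suc k) \<Phi>"
      using \<Phi> \<open>smooth \<psi>\<close> by (auto simp: smooth_def)
    then show "differentiable_upto k \<Phi>" by (rule differentiable_upto_SucD)
  qed
  have const: "\<Phi> x = \<Phi> y" if "\<And>z. x < z \<Longrightarrow> z < y \<Longrightarrow> z \<notin> {c..d}" "x < y" for x y
  proof -
    have "continuous_on {x..y} \<Phi>"
      by (rule DERIV_continuous_on[of _ _ \<psi>]) (use \<Phi> has_field_derivative_at_within in blast)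
    then have "\<Phi> y = \<Phi> x"
    proof (intro DERIV_isconst_end[OF \<open>x < y\<close>])
      show "(\<Phi> has_real_derivative 0) (at z)" if "x < z" "z < y" for z
        using \<Phi>[of z] cd(3) \<open>\<And>z. x < z \<Longrightarrow> z < y \<Longrightarrow> z \<notin> {c..d}\<close>[OF that] by simp
    qed
    then show ?thesis by simp
  qed
  have "(\<psi> has_integral F b - F a) {a..b}"
    using F \<open>a < b\<close>
    by (intro fundamental_theorem_of_calculus) (auto intro: has_vector_derivative_at_within)
  moreover have "bounded_measurable a b \<psi>"
    using deriv_chain_bounded_measurable[OF test_function_chain[OF \<psi>], of 0 0] by simp
  ultimately have "F b = F a"
    using zero bounded_measurable_integral_eq[of a b \<psi>] by (simp add: integral_unique)
  then have ab: "\<Phi> a = 0" "\<Phi> b = 0" by (simp_all add: \<Phi>_def)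
  have "\<Phi> x = 0" if "x \<notin> {c..d}" for x
  proof -
    have "x < c \<or> d < x" using that by auto
    then consider "x < c" | "d < x" by blast
    then show ?thesis
    proof cases
      case 1
      then show ?thesis using const[of x a] const[of a x] ab cd
        by (cases x a rule: linorder_cases) auto
    next
      case 2
      then show ?thesis using const[of x b] const[of b x] ab cd
        by (cases x b rule: linorder_cases) auto
    qed
  qed
  then have "\<Phi> \<in> test_functions a b"
    using \<open>smooth \<Phi>\<close> cd unfolding test_functions_iff by blast
  moreover have "nderiv UNIV 1 \<Phi> = \<psi>"
    using \<Phi> by (auto simp: has_real_derivative_iff_has_vector_derivative intro: vector_derivative_at)
  ultimately show ?thesis
    using nderiv_Suc_shift by metis
qed

text \<open>For n = 0 this is the classical smooth function that is flat at 0. Division by powers of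
  x makes the span of the family closed under differentiation, so smoothness of all members is one
  induction.\<close>

definition flat_exp :: "nat \<Rightarrow> real \<Rightarrow> real" where
  "flat_exp n x = (if x > 0 then exp (- 1 / x) / x ^ n else 0)"

lemma flat_exp_deriv:
  "(flat_exp n has_real_derivative flat_exp (n + 2) x - n * flat_exp (n + 1) x) (at x)"
proof (cases x "0 :: real" rule: linorder_cases)
  case less
  show ?thesis
    by (rule has_field_derivative_transform_within_open[of "\<lambda>x. 0" _ x "{..<0}"])
      (use less in \<open>auto simp: flat_exp_def\<close>)
next
  case greater
  have "((\<lambda>x. exp (- 1 / x) / x ^ n) has_real_derivative flat_exp (n + 2) x - n * flat_exp (n + 1) x) (at x)"
  proof (rule DERIV_cong)
    have "((\<lambda>x. exp (- 1 / x)) has_real_derivative exp (- 1 / x) / x\<^sup>2) (at x)"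
      using greater by (auto intro!: derivative_eq_intros simp: power2_eq_square)
    then show "((\<lambda>x. exp (- 1 / x) / x ^ n) has_real_derivative
        (exp (- 1 / x) / x\<^sup>2 * x ^ n - exp (- 1 / x) * (real n * x ^ (n - Suc 0))) / (x ^ n * x ^ n)) (at x)"
      using greater by (intro DERIV_divide DERIV_pow) auto
    show "(exp (- 1 / x) / x\<^sup>2 * x ^ n - exp (- 1 / x) * (real n * x ^ (n - Suc 0))) / (x ^ n * x ^ n) =
        flat_exp (n + 2) x - n * flat_exp (n + 1) x"
      using greater by (cases n) (simp_all add: flat_exp_def field_simps power2_eq_square)
  qed
  then show ?thesis
    by (rule has_field_derivative_transform_within_open[of _ _ x "{0<..}"])
      (use greater in \<open>auto simp: flat_exp_def\<close>)
next
  case equal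
  \<comment> \<open>The difference quotient of \<open>flat_exp n\<close> at 0 is
    \<open>flat_exp (Suc n) h\<close>; on the right its limit is that of y^(n+1) / exp y at
    infinity, with y = 1 / h.\<close>
  have "((\<lambda>h. flat_exp (Suc n) h) \<longlongrightarrow> 0) (at 0)"
  proof (rule filterlim_split_at)
    show "((\<lambda>h. flat_exp (Suc n) h) \<longlongrightarrow> 0) (at_left 0)"
      by (rule tendsto_eventually) (auto simp: eventually_at_filter flat_exp_def)
    have "((\<lambda>h. inverse h ^ Suc n / exp (inverse h)) \<longlongrightarrow> 0) (at_right (0::real))"
      by (rule filterlim_compose[OF tendsto_power_div_exp_0 filterlim_inverse_at_top_right])
    moreover have "\<forall>\<^sub>F h in at_right 0. inverse h ^ Suc n / exp (inverse h) = flat_exp (Suc n) h"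
      by (auto simp: eventually_at_filter flat_exp_def exp_minus field_simps)
    ultimately show "((\<lambda>h. flat_exp (Suc n) h) \<longlongrightarrow> 0) (at_right 0)"
      by (rule Lim_transform_eventually)
  qed
  moreover have "flat_exp (Suc n) h = (flat_exp n (0 + h) - flat_exp n 0) / h" for h
    by (auto simp: flat_exp_def)
  ultimately have "(flat_exp n has_real_derivative 0) (at 0)"
    unfolding DERIV_def by simp
  then show ?thesis using equal by (simp add: flat_exp_def)
qed

lemma differentiable_upto_flat_exp: "differentiable_upto k (flat_exp n)"
proof (induction k arbitrary: n)
  case (Suc k)
  have "differentiable_upto k (\<lambda>x. flat_exp (n + 2) x + (- n) * flat_exp (n + 1) x)"
    by (intro differentiable_upto_add differentiable_upto_mult differentiable_upto_const Suc.IH)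
  then show ?case
    using flat_exp_deriv[of n] by (auto intro!: exI[of _ "\<lambda>x. flat_exp (n + 2) x - n * flat_exp (n + 1) x"])
qed simp

text \<open>The factors are positive for x > c + 1/(n+1) and for x < d - 1/(n+1) respectively, so
  the support is a compact part of (c, d). For fixed x inside, both arguments tend to infinity and
  both factors to 1: the bumps tend pointwise to the indicator of (c, d).\<close>

definition bump :: "nat \<Rightarrow> real \<Rightarrow> real \<Rightarrow> real \<Rightarrow> real" where
  "bump n c d x = flat_exp 0 (real (Suc n) * (x - c) - 1) * flat_exp 0 (real (Suc n) * (d - x) - 1)"

lemma bump_range: "0 \<le> bump n c d x" "bump n c d x \<le> 1"
  by (auto simp: bump_def flat_exp_def intro!: mult_le_one)

lemma differentiable_upto_bump: "differentiable_upto k (bump n c d)"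
proof -
  have "differentiable_upto k (\<lambda>x. flat_exp 0 (real (Suc n) * x + (- real (Suc n) * c - 1)) *
      flat_exp 0 ((- real (Suc n)) * x + (real (Suc n) * d - 1)))"
    by (intro differentiable_upto_mult differentiable_upto_affine differentiable_upto_flat_exp)
  moreover have "\<dots> = bump n c d"
    by (auto simp: bump_def fun_eq_iff algebra_simps)
  ultimately show ?thesis by simp
qed

lemma bump_eq_0:
  assumes "x \<notin> {c + 1 / real (Suc n)..d - 1 / real (Suc n)}"
  shows "bump n c d x = 0"
proof -
  have "real (Suc n) * (x - c) - 1 \<le> 0 \<or> real (Suc n) * (d - x) - 1 \<le> 0"
    using assms by (auto simp: field_simps)
  then show ?thesis by (auto simp: bump_def flat_exp_def)
qed

text \<open>These sums are the approximants of piecewise polynomials; all their supports keep the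
  distance 1/(n+1) from a and b.\<close>

lemma test_function_poly_bumps:
  assumes "finite J" "\<And>j. j \<in> J \<Longrightarrow> a \<le> c j \<and> d j \<le> b"
  shows "(\<lambda>x. \<Sum>j\<in>J. poly (q j) x * bump n (c j) (d j) x) \<in> test_functions a b"
proof -
  have "(\<Sum>j\<in>J. poly (q j) x * bump n (c j) (d j) x) = 0" if "x \<notin> {a + 1 / real (Suc n)..b - 1 / real (Suc n)}" for x
  proof (intro sum.neutral ballI)
    fix j assume "j \<in> J"
    then have "x \<notin> {c j + 1 / real (Suc n)..d j - 1 / real (Suc n)}"
      using assms(2)[of j] that by auto
    then show "poly (q j) x * bump n (c j) (d j) x = 0" by (simp add: bump_eq_0)
  qed
  moreover have "smooth (\<lambda>x. \<Sum>j\<in>J. poly (q j) x * bump n (c j) (d j) x)"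
    unfolding smooth_def
    by (intro allI differentiable_upto_sum differentiable_upto_mult differentiable_upto_poly differentiable_upto_bump)
  moreover have "a < a + 1 / real (Suc n)" "b - 1 / real (Suc n) < b" by simp_all
  ultimately show ?thesis unfolding test_functions_iff by blast
qed

lemma test_function_bump: "a \<le> c \<Longrightarrow> d \<le> b \<Longrightarrow> bump n c d \<in> test_functions a b"
  using test_function_poly_bumps[of "{0}" a "\<lambda>_. c" "\<lambda>_. d" b "\<lambda>_. 1" n] by simp

lemma bump_tendsto: "(\<lambda>n. bump n c d x) \<longlonglongrightarrow> indicator {c<..<d} x"
proof (cases "x \<in> {c<..<d}")
  case True
  have lim: "(\<lambda>n. flat_exp 0 (real (Suc n) * y - 1)) \<longlonglongrightarrow> 1" if "y > 0" for y :: real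
  proof -
    have top: "filterlim (\<lambda>n. real (Suc n) * y - 1) at_top sequentially"
    proof -
      have "filterlim (\<lambda>n. real (Suc n) * y) at_top sequentially"
        by (rule filterlim_at_top_mult_tendsto_pos[OF tendsto_const that
              filterlim_compose[OF filterlim_real_sequentially filterlim_Suc]])
      from filterlim_tendsto_add_at_top[OF tendsto_const this, of "-1"] show ?thesis by simp
    qed
    have "((\<lambda>z::real. exp (- 1 / z)) \<longlongrightarrow> exp 0) at_top"
      by (intro tendsto_exp tendsto_divide_0[OF tendsto_const] filterlim_at_top_imp_at_infinity filterlim_ident)
    then have "((\<lambda>z::real. exp (- 1 / z)) \<longlongrightarrow> 1) at_top" by simp
    moreover have "\<forall>\<^sub>F z in at_top. exp (- 1 / z) = flat_exp 0 z"
      using eventually_gt_at_top[of 0] by eventually_elim (simp add: flat_exp_def)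
    ultimately have "(flat_exp 0 \<longlongrightarrow> 1) at_top"
      by (rule Lim_transform_eventually)
    from filterlim_compose[OF this top] show ?thesis .
  qed
  have "(\<lambda>n. bump n c d x) \<longlonglongrightarrow> 1 * 1"
    unfolding bump_def by (intro tendsto_mult lim) (use True in auto)
  then show ?thesis using True by simp
next
  case False
  have "x \<notin> {c + 1 / real (Suc n)..d - 1 / real (Suc n)}" for n
  proof
    assume "x \<in> {c + 1 / real (Suc n)..d - 1 / real (Suc n)}"
    moreover have "1 / real (Suc n) > 0" by simp
    ultimately have "c < x" "x < d" unfolding atLeastAtMost_iff by linarith+
    then show False using False by simp
  qed
  then show ?thesis using False by (simp add: bump_eq_0)
qed


section \<open>Weak derivatives and Sobolev norms\<close>

text \<open>On a set of finite measure 1 + g^2 is an integrable majorant, by |y| <= 1 + y^2.\<close>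

lemma L2_space_integrable:
  assumes "g \<in> L2_space a b"
  shows "integrable (lebesgue_on {a..b}) g"
proof (rule Bochner_Integration.integrable_bound)
  show "integrable (lebesgue_on {a..b}) (\<lambda>x. 1 + (g x)\<^sup>2)"
    using assms bounded_measurable_integrable[of a b "\<lambda>x. 1"] by (simp add: L2_space_def)
  show "g \<in> borel_measurable (lebesgue_on {a..b})"
    using assms by (simp add: L2_space_def)
  have "\<bar>y\<bar> \<le> 1 + y\<^sup>2" for y :: real
    using zero_le_power2[of "\<bar>y\<bar> - 1"] by (simp add: power2_diff)
  then show "AE x in lebesgue_on {a..b}. norm (g x) \<le> norm (1 + (g x)\<^sup>2)"
    unfolding real_norm_def by (intro AE_I2 order.trans[OF _ abs_ge_self])
qed

lemma integrable_mult_bounded_measurable: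
  assumes g: "integrable (lebesgue_on {a..b}) g" and f: "bounded_measurable a b f"
  shows "integrable (lebesgue_on {a..b}) (\<lambda>x. g x * f x)"
proof -
  obtain B where B: "\<forall>x\<in>{a..b}. \<bar>f x\<bar> \<le> B"
    using f unfolding bounded_measurable_def by blast
  have "integrable (lebesgue_on {a..b}) (\<lambda>x. B * \<bar>g x\<bar>)"
    using g by simp
  then show ?thesis
  proof (rule Bochner_Integration.integrable_bound)
    show "(\<lambda>x. g x * f x) \<in> borel_measurable (lebesgue_on {a..b})"
      using g f unfolding bounded_measurable_def by auto
    have "\<bar>g x * f x\<bar> \<le> \<bar>B * \<bar>g x\<bar>\<bar>" if "x \<in> {a..b}" for x
    proof -
      have "\<bar>f x\<bar> * \<bar>g x\<bar> \<le> \<bar>B\<bar> * \<bar>g x\<bar>"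
        using B that by (intro mult_right_mono) force+
      then show ?thesis by (simp add: abs_mult mult.commute)
    qed
    then show "AE x in lebesgue_on {a..b}. norm (g x * f x) \<le> norm (B * \<bar>g x\<bar>)"
      by (intro AE_I2) simp
  qed
qed

text \<open>The fundamental lemma of the calculus of variations. Bumps are bounded by 1 and tend to
  the indicator of an open interval, so by dominated convergence g integrates to zero over every
  interval.\<close>

lemma AE_zero_of_test_functions:
  assumes g: "integrable (lebesgue_on {a..b}) g" and "a \<le> b"
    and test: "\<And>\<phi>. \<phi> \<in> test_functions a b \<Longrightarrow> L2_inner a b g \<phi> = 0"
  shows "AE x in lebesgue_on {a..b}. g x = 0"
proof (rule AE_zero_of_interval_integrals[OF g _ \<open>a \<le> b\<close>])
  fix c d assume cd: "a \<le> c" "c \<le> d" "d \<le> b"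
  let ?M = "lebesgue_on {a..b}"
  have bump: "bounded_measurable a b (bump n c d)" for n
    using deriv_chain_bounded_measurable[OF test_function_chain[OF test_function_bump[OF cd(1,3)]], of 0 0]
    by simp
  have "(\<lambda>n. \<integral>x. g x * bump n c d x \<partial>?M) \<longlonglongrightarrow> (\<integral>x. g x * indicator {c<..<d} x \<partial>?M)"
  proof (rule integral_dominated_convergence)
    show "(\<lambda>x. g x * indicator {c<..<d} x) \<in> borel_measurable ?M"
      "(\<lambda>x. g x * bump n c d x) \<in> borel_measurable ?M" for n
      using integrable_mult_bounded_measurable[OF g] bump bounded_measurable_indicator_Ioo by blast+
    show "integrable ?M (\<lambda>x. \<bar>g x\<bar>)" using g by simp
    show "AE x in ?M. (\<lambda>n. g x * bump n c d x) \<longlonglongrightarrow> g x * indicator {c<..<d} x"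
      by (intro AE_I2 tendsto_mult tendsto_const bump_tendsto)
    show "AE x in ?M. norm (g x * bump n c d x) \<le> \<bar>g x\<bar>" for n
      using bump_range by (intro AE_I2) (auto simp: abs_mult intro!: mult_left_le)
  qed
  moreover have "(\<integral>x. g x * bump n c d x \<partial>?M) = 0" for n
    using test[OF test_function_bump[OF cd(1,3)]] by (simp add: L2_inner_def)
  ultimately have "(\<integral>x. g x * indicator {c<..<d} x \<partial>?M) = 0"
    by (simp add: LIMSEQ_const_iff)
  moreover have "(LINT x:{c..d}|?M. g x) = (\<integral>x. g x * indicator {c<..<d} x \<partial>?M)"
    unfolding set_lebesgue_integral_def
  proof (rule integral_cong_AE)
    show "(\<lambda>x. indicat_real {c..d} x *\<^sub>R g x) \<in> borel_measurable ?M"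
    proof (intro borel_measurable_scaleR borel_measurable_integrable[OF g])
      show "indicat_real {c..d} \<in> borel_measurable ?M"
        by (intro measurable_restrict_space1 borel_measurable_indicator) simp
    qed
    show "(\<lambda>x. g x * indicator {c<..<d} x) \<in> borel_measurable ?M"
      using integrable_mult_bounded_measurable[OF g bounded_measurable_indicator_Ioo] by blast
    show "AE x in ?M. indicat_real {c..d} x *\<^sub>R g x = g x * indicator {c<..<d} x"
      by (rule eventually_mono[OF AE_lebesgue_on_notin_finite[of "{c, d}" a b]])
        (auto simp: indicator_def)
  qed
  ultimately show "(LINT x:{c..d}|?M. g x) = 0" by simp
qed

lemma deriv_chain_is_weak_deriv:
  assumes "deriv_chain S k a b D" "j \<le> k" "a \<le> b"
  shows "is_weak_deriv a b j (D 0) (D j)"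
  unfolding is_weak_deriv_def
proof
  fix \<phi> assume \<phi>: "\<phi> \<in> test_functions a b"
  show "L2_inner a b (D 0) (nderiv UNIV j \<phi>) = (-1) ^ j * L2_inner a b (D j) \<phi>"
    using deriv_chain_parts[OF assms(1) test_function_chain[OF \<phi>, of j] \<open>a \<le> b\<close>, of j 0]
      test_function_boundary[OF \<phi>] assms(2) by simp
qed

text \<open>The chosen representative and \<open>D j\<close> satisfy the same integration by parts
  formula against all test functions, so their difference is orthogonal to these and vanishes almost
  everywhere.\<close>

lemma deriv_chain_weak_deriv:
  assumes D: "deriv_chain S k a b D" and "j \<le> k" "a \<le> b"
  shows "weak_deriv a b j (D 0) \<in> L2_space a b"
    and "AE x in lebesgue_on {a..b}. weak_deriv a b j (D 0) x = D j x"
proof -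
  define g where "g = weak_deriv a b j (D 0)"
  have bm: "bounded_measurable a b (D j)"
    using D \<open>j \<le> k\<close> by (rule deriv_chain_bounded_measurable)
  have Dj: "is_weak_deriv a b j (D 0) (D j)"
    using assms by (rule deriv_chain_is_weak_deriv)
  have g: "g \<in> L2_space a b \<and> is_weak_deriv a b j (D 0) g"
    unfolding g_def weak_deriv_def
    by (rule someI[of _ "D j"]) (use bounded_measurable_in_L2[OF bm] Dj in blast)
  then show "weak_deriv a b j (D 0) \<in> L2_space a b" by (simp add: g_def)
  have int: "integrable (lebesgue_on {a..b}) g" "integrable (lebesgue_on {a..b}) (D j)"
    using g L2_space_integrable bounded_measurable_integrable[OF bm] by blast+
  have "AE x in lebesgue_on {a..b}. g x - D j x = 0"
  proof (rule AE_zero_of_test_functions[OF _ \<open>a \<le> b\<close>])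
    show "integrable (lebesgue_on {a..b}) (\<lambda>x. g x - D j x)" using int by simp
    fix \<phi> assume \<phi>: "\<phi> \<in> test_functions a b"
    have "bounded_measurable a b \<phi>"
      using deriv_chain_bounded_measurable[OF test_function_chain[OF \<phi>], of 0 0] by simp
    then have "L2_inner a b (\<lambda>x. g x - D j x) \<phi> = L2_inner a b g \<phi> - L2_inner a b (D j) \<phi>"
      using int unfolding L2_inner_def left_diff_distrib
      by (intro Bochner_Integration.integral_diff integrable_mult_bounded_measurable)
    also have "\<dots> = 0"
    proof -
      have "(-1) ^ j * L2_inner a b g \<phi> = (-1) ^ j * L2_inner a b (D j) \<phi>"
        using g Dj \<phi> unfolding is_weak_deriv_def by metis
      then show ?thesis by simp
    qed
    finally show "L2_inner a b (\<lambda>x. g x - D j x) \<phi> = 0" .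
  qed
  then show "AE x in lebesgue_on {a..b}. weak_deriv a b j (D 0) x = D j x"
    by (simp add: g_def)
qed

lemma deriv_chain_H_space:
  assumes D: "deriv_chain S k a b D" and "a \<le> b"
  shows "D 0 \<in> H_space k a b"
  unfolding H_space_def
  using bounded_measurable_in_L2[OF deriv_chain_bounded_measurable[OF D]]
    deriv_chain_is_weak_deriv[OF D _ \<open>a \<le> b\<close>] by blast

text \<open>From here on the Sobolev norm is computed from classical derivatives, and the choice
  made in \<open>weak_deriv\<close> has disappeared.\<close>

lemma deriv_chain_H_norm:
  assumes D: "deriv_chain S k a b D" and "a \<le> b"
  shows "H_norm k a b (D 0) = sqrt (\<Sum>j\<le>k. L2_inner a b (D j) (D j))"
proof -
  have "(\<integral>x. (weak_deriv a b j (D 0) x)\<^sup>2 \<partial>lebesgue_on {a..b}) = L2_inner a b (D j) (D j)" if "j \<le> k" for j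
  proof -
    have "D j \<in> borel_measurable (lebesgue_on {a..b})"
      using deriv_chain_bounded_measurable[OF D that] by (simp add: bounded_measurable_def)
    then have "L2_inner a b (weak_deriv a b j (D 0)) (weak_deriv a b j (D 0)) = L2_inner a b (D j) (D j)"
      using deriv_chain_weak_deriv[OF D that \<open>a \<le> b\<close>]
      by (intro L2_inner_cong_AE) (simp_all add: L2_space_def)
    then show ?thesis by (simp add: L2_inner_def power2_eq_square)
  qed
  then show ?thesis by (simp add: H_norm_def)
qed

lemma deriv_chain_bilinear_form:
  assumes D: "deriv_chain S k a b D" and E: "deriv_chain T l a b E" and "a \<le> b"
    and "m + 1 \<le> k" "m + 1 \<le> l" and P: "\<And>i. i \<le> m + 1 \<Longrightarrow> bounded_measurable a b (P i)"
  shows "bilinear_form m a b P (D 0) (E 0) = (\<Sum>i\<le>m + 1. L2_inner a b (\<lambda>x. P i x * D i x) (E i))"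
  unfolding bilinear_form_def
proof (rule sum.cong[OF refl])
  fix i assume "i \<in> {..m + 1}"
  then have i: "i \<le> m + 1" "i \<le> k" "i \<le> l" using assms by auto
  have meas: "P i \<in> borel_measurable (lebesgue_on {a..b})" "D i \<in> borel_measurable (lebesgue_on {a..b})"
    "E i \<in> borel_measurable (lebesgue_on {a..b})"
    using P i deriv_chain_bounded_measurable[OF D] deriv_chain_bounded_measurable[OF E]
    by (simp_all add: bounded_measurable_def)
  have "AE x in lebesgue_on {a..b}. P i x * weak_deriv a b i (D 0) x = P i x * D i x"
    using deriv_chain_weak_deriv(2)[OF D i(2) \<open>a \<le> b\<close>] by eventually_elim simp
  then show "(\<integral>x. P i x * weak_deriv a b i (D 0) x * weak_deriv a b i (E 0) x \<partial>lebesgue_on {a..b}) =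
      L2_inner a b (\<lambda>x. P i x * D i x) (E i)"
    unfolding L2_inner_def[symmetric]
    using meas deriv_chain_weak_deriv(1)[OF D i(2) \<open>a \<le> b\<close>] deriv_chain_weak_deriv[OF E i(3) \<open>a \<le> b\<close>]
    unfolding L2_space_def by (intro L2_inner_cong_AE borel_measurable_times) blast+
qed

text \<open>All derivatives below order k vanish at a, so the sup bound for functions with zeros
  applies; squared and integrated over [a, b] it gives two powers of the length per order.\<close>

lemma deriv_chain_Poincare:
  assumes W: "deriv_chain S k a b W" and zero: "\<And>l. l < k \<Longrightarrow> W l a = 0" and "i \<le> k" "a \<le> b"
  shows "L2_inner a b (W i) (W i) \<le> (b - a) ^ (2 * (k - i)) * L2_inner a b (W k) (W k)"
proof (cases "i = k")
  case False
  then obtain k' where k': "k = Suc k'" "i \<le> k'"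
    using \<open>i \<le> k\<close> by (cases k) auto
  define Q where "Q = L2_inner a b (W k) (W k)"
  have bm: "bounded_measurable a b (W i)" "bounded_measurable a b (W k)"
    using deriv_chain_bounded_measurable[OF W] \<open>i \<le> k\<close> by auto
  have bound: "\<bar>W i x\<bar> \<le> (b - a) ^ (k' - i) * (sqrt (b - a) * sqrt Q)" if "x \<in> {a..b}" for x
  proof -
    have "\<bar>W i x\<bar> \<le> (b - a) ^ (k' - i) * (\<integral>t. \<bar>W k t\<bar> \<partial>lebesgue_on {a..b})"
      unfolding k'(1)
    proof (rule deriv_chain_bound_of_zeros[OF _ _ k'(2) that])
      show "\<exists>z\<in>{a..b}. W l z = 0" if "l \<le> k'" for l
        using zero[of l] that k' \<open>a \<le> b\<close> by (intro bexI[of _ a]) auto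
    qed (use W k' in simp)
    also have "\<dots> \<le> (b - a) ^ (k' - i) * (sqrt (b - a) * sqrt Q)"
      unfolding Q_def using L1_le_L2[OF bm(2) \<open>a \<le> b\<close>] \<open>a \<le> b\<close> by (intro mult_left_mono) auto
    finally show ?thesis .
  qed
  have "\<bar>L2_inner a b (W i) (W i)\<bar> \<le>
      (b - a) ^ (k' - i) * (sqrt (b - a) * sqrt Q) * (\<integral>x. \<bar>W i x\<bar> \<partial>lebesgue_on {a..b})"
    by (rule L2_inner_bound_of_sup[OF bm(1) bm(1) bound])
  also have "(\<integral>x. \<bar>W i x\<bar> \<partial>lebesgue_on {a..b}) \<le>
      (\<integral>x. (b - a) ^ (k' - i) * (sqrt (b - a) * sqrt Q) \<partial>lebesgue_on {a..b})"
    using bound by (intro integral_mono bounded_measurable_integrable bounded_measurable_intros bm) auto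
  also have "\<dots> = (b - a) * ((b - a) ^ (k' - i) * (sqrt (b - a) * sqrt Q))"
    using \<open>a \<le> b\<close> by (simp add: measure_restrict_space)
  also have "(b - a) ^ (k' - i) * (sqrt (b - a) * sqrt Q) * \<dots> =
      (b - a) ^ (2 * (k' - i)) * (b - a) * (sqrt (b - a))\<^sup>2 * (sqrt Q)\<^sup>2"
    by (simp only: power2_eq_square mult_2 mult_2_right power_add mult_ac)
  also have "\<dots> = (b - a) ^ (2 * (k' - i)) * (b - a) * (b - a) * Q"
    using \<open>a \<le> b\<close> L2_inner_self_nonneg by (simp add: Q_def)
  also have "\<dots> = (b - a) ^ (2 * (k - i)) * Q"
    using k' by (simp add: Suc_diff_le power2_eq_square)
  finally have "L2_inner a b (W i) (W i) \<le> (b - a) ^ (2 * (k - i)) * Q"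
    using \<open>a \<le> b\<close> L2_inner_self_nonneg by (simp add: Q_def mult_left_mono)
  then show ?thesis by (simp add: Q_def)
qed simp

section \<open>Approximation by test functions and membership in \<open>H0_space\<close>\<close>

lemma L2_inner_add_self_le:
  assumes "bounded_measurable a b f" "bounded_measurable a b g"
  shows "L2_inner a b (\<lambda>x. f x + g x) (\<lambda>x. f x + g x) \<le> 2 * L2_inner a b f f + 2 * L2_inner a b g g"
proof -
  have "L2_inner a b (\<lambda>x. f x + g x) (\<lambda>x. f x + g x) \<le>
      (\<integral>x. 2 * (f x * f x) + 2 * (g x * g x) \<partial>lebesgue_on {a..b})"
    unfolding L2_inner_def
  proof (intro integral_mono bounded_measurable_integrable bounded_measurable_intros assms)
    fix x
    show "(f x + g x) * (f x + g x) \<le> 2 * (f x * f x) + 2 * (g x * g x)"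
      using zero_le_square[of "f x - g x"] by (simp add: algebra_simps)
  qed
  also have "\<dots> = 2 * L2_inner a b f f + 2 * L2_inner a b g g"
    unfolding L2_inner_def using assms
    by (subst Bochner_Integration.integral_add)
      (auto intro!: bounded_measurable_integrable bounded_measurable_intros)
  finally show ?thesis .
qed

text \<open>The integrals of the bumps tend to b - a > 0, so some bump has a positive integral by
  which it can be divided.\<close>

lemma test_function_with_mean_one:
  assumes "a < b"
  shows "\<exists>\<eta>\<in>test_functions a b. (\<integral>x. \<eta> x \<partial>lebesgue_on {a..b}) = 1"
proof -
  have bm: "bounded_measurable a b (bump n a b)" for n
    using deriv_chain_bounded_measurable[OF test_function_chain[OF test_function_bump], of a a b b 0 0 n]
    by simp
  have "(\<lambda>n. \<integral>x. bump n a b x \<partial>lebesgue_on {a..b}) \<longlonglongrightarrow> (\<integral>x. indicator {a<..<b} x \<partial>lebesgue_on {a..b})"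
  proof (rule integral_dominated_convergence)
    show "indicat_real {a<..<b} \<in> borel_measurable (lebesgue_on {a..b})"
      "bump n a b \<in> borel_measurable (lebesgue_on {a..b})" for n
      using bm[of n] bounded_measurable_indicator_Ioo[of a b a b] by (simp_all add: bounded_measurable_def)
    show "integrable (lebesgue_on {a..b}) (\<lambda>x. 1 :: real)"
      using bounded_measurable_integrable bounded_measurable_const by blast
    show "AE x in lebesgue_on {a..b}. norm (bump n a b x) \<le> 1" for n
      using bump_range by (intro AE_I2) simp
  qed (use bump_tendsto in simp)
  moreover have "(\<integral>x. indicator {a<..<b} x \<partial>lebesgue_on {a..b}) = b - a"
  proof -
    have "{a<..<b} \<inter> {a..b} = {a<..<b}" by auto
    then have "(\<integral>x. indicat_real {a<..<b} x \<partial>lebesgue_on {a..b}) = measure (lebesgue_on {a..b}) {a<..<b}"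
      by simp
    also have "\<dots> = measure lebesgue {a<..<b}"
      by (rule measure_restrict_space) auto
    finally show ?thesis using assms by simp
  qed
  ultimately have "\<forall>\<^sub>F n in sequentially. 0 < (\<integral>x. bump n a b x \<partial>lebesgue_on {a..b})"
    using assms by (intro order_tendstoD(1)) auto
  then obtain n where n: "0 < (\<integral>x. bump n a b x \<partial>lebesgue_on {a..b})"
    using eventually_happens by force
  \<comment> \<open>A rescaling of the bump by the inverse of its integral, put into the form \<phi>
    - c \<psi> for which closure of the test functions is proved.\<close>
  define \<eta> where "\<eta> = (\<lambda>x. bump n a b x - (1 - 1 / (\<integral>x. bump n a b x \<partial>lebesgue_on {a..b})) * bump n a b x)"
  have "\<eta> = (\<lambda>x. 1 / (\<integral>x. bump n a b x \<partial>lebesgue_on {a..b}) * bump n a b x)"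
    by (simp add: \<eta>_def algebra_simps)
  then have "(\<integral>x. \<eta> x \<partial>lebesgue_on {a..b}) = 1"
    using n by simp
  moreover have "\<eta> \<in> test_functions a b"
    unfolding \<eta>_def by (intro test_function_diff_cmult test_function_bump) simp_all
  ultimately show ?thesis by blast
qed

text \<open>Approximants of the derivative are corrected by a multiple of one fixed test function to have mean
  zero, so that their antiderivatives are test functions again.\<close>

lemma deriv_chain_test_function_approx:
  assumes "a < b" "deriv_chain S k a b D" "\<And>i. i < k \<Longrightarrow> D i a = 0 \<and> D i b = 0"
    and "\<And>\<epsilon>. \<epsilon> > 0 \<Longrightarrow> \<exists>\<phi>\<in>test_functions a b. L2_inner a b (\<lambda>x. D k x - \<phi> x) (\<lambda>x. D k x - \<phi> x) < \<epsilon>"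
    and "\<epsilon> > 0"
  shows "\<exists>\<phi>\<in>test_functions a b.
    L2_inner a b (\<lambda>x. D k x - nderiv UNIV k \<phi> x) (\<lambda>x. D k x - nderiv UNIV k \<phi> x) < \<epsilon>"
  using assms(2-)
proof (induction k arbitrary: D \<epsilon>)
  case (Suc k)
  obtain \<eta> where \<eta>: "\<eta> \<in> test_functions a b" "(\<integral>x. \<eta> x \<partial>lebesgue_on {a..b}) = 1"
    using test_function_with_mean_one[OF \<open>a < b\<close>] by blast
  define M where "M = L2_inner a b (nderiv UNIV k \<eta>) (nderiv UNIV k \<eta>)"
  define K where "K = (b - a) ^ (2 * k + 1) * M"
  have "0 \<le> K" using \<open>a < b\<close> by (simp add: K_def M_def L2_inner_self_nonneg)
  \<comment> \<open>The corrected approximant will have squared error at most 2 (1 + K) Q, where Q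
    is the squared error before the correction.\<close>
  define \<epsilon>' where "\<epsilon>' = \<epsilon> / (2 * (1 + K))"
  have "\<epsilon>' > 0" using Suc.prems \<open>0 \<le> K\<close> by (simp add: \<epsilon>'_def)
  have D': "deriv_chain S k a b (\<lambda>i. D (Suc i))"
    using deriv_chain_shift[of S k 1 a b D] Suc.prems(1) by simp
  obtain \<phi> where \<phi>: "\<phi> \<in> test_functions a b" and
    small: "L2_inner a b (\<lambda>x. D (Suc k) x - nderiv UNIV k \<phi> x) (\<lambda>x. D (Suc k) x - nderiv UNIV k \<phi> x) < \<epsilon>'"
    using Suc.IH[OF D' _ _ \<open>\<epsilon>' > 0\<close>] Suc.prems(2,3) by auto
  define W where "W = (\<lambda>i x. D (Suc i) x - nderiv UNIV i \<phi> x)"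
  define Q where "Q = L2_inner a b (W k) (W k)"
  define I where "I = (\<integral>x. \<phi> x \<partial>lebesgue_on {a..b})"
  have W: "deriv_chain S k a b W"
    unfolding W_def using deriv_chain_diff[OF D' test_function_chain[OF \<phi>]] by simp
  have bmW: "bounded_measurable a b (W i)" if "i \<le> k" for i
    using deriv_chain_bounded_measurable[OF W that] .
  have bm\<phi>: "bounded_measurable a b (nderiv UNIV i \<psi>)" if "\<psi> \<in> test_functions a b" for \<psi> i
    using deriv_chain_bounded_measurable[OF test_function_chain[OF that, of i], of i] by simp
  \<comment> \<open>\<open>D 0\<close> vanishes at both ends, so \<open>D 1\<close> has integral
    zero: the integral I of \<phi> is pure error and is small along with W.\<close>
  have "(\<integral>x. W 0 x \<partial>lebesgue_on {a..b}) = - I"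
  proof -
    have bm: "bounded_measurable a b (D (Suc 0))" "bounded_measurable a b \<phi>"
      using deriv_chain_bounded_measurable[OF Suc.prems(1), of "Suc 0"] bm\<phi>[OF \<phi>, of 0] by simp_all
    have "(D (Suc 0) has_integral 0) {a..b}"
      using deriv_chain_has_integral[OF Suc.prems(1), of 0 a b] Suc.prems(2)[of 0] \<open>a < b\<close> by simp
    then have "(\<integral>x. D (Suc 0) x \<partial>lebesgue_on {a..b}) = 0"
      using bounded_measurable_integral_eq[OF bm(1)] by (simp add: integral_unique)
    then show ?thesis
      unfolding W_def I_def using bm
      by (simp add: Bochner_Integration.integral_diff bounded_measurable_integrable)
  qed
  then have "\<bar>I\<bar> \<le> (\<integral>x. \<bar>W 0 x\<bar> \<partial>lebesgue_on {a..b})"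
    by (metis abs_minus_cancel integral_abs_bound)
  also have "\<dots> \<le> sqrt (b - a) * sqrt (L2_inner a b (W 0) (W 0))"
    using \<open>a < b\<close> by (intro L1_le_L2 bmW) auto
  finally have "\<bar>I\<bar>\<^sup>2 \<le> (sqrt (b - a) * sqrt (L2_inner a b (W 0) (W 0)))\<^sup>2"
    by (intro power_mono) auto
  also have "\<dots> = (b - a) * L2_inner a b (W 0) (W 0)"
    using \<open>a < b\<close> by (simp add: power_mult_distrib L2_inner_self_nonneg)
  \<comment> \<open>The derivatives of W below order k vanish at a, so the error Q at order k
    controls W itself.\<close>
  also have "\<dots> \<le> (b - a) * ((b - a) ^ (2 * k) * Q)"
    unfolding Q_def
    using deriv_chain_Poincare[OF W, of 0] Suc.prems(2) test_function_boundary[OF \<phi>] \<open>a < b\<close>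
    by (intro mult_left_mono) (simp_all add: W_def)
  finally have I: "I\<^sup>2 \<le> (b - a) ^ (2 * k + 1) * Q" by simp
  define \<psi> where "\<psi> = (\<lambda>x. \<phi> x - I * \<eta> x)"
  have "(\<integral>x. \<psi> x \<partial>lebesgue_on {a..b}) = 0"
    using bm\<phi>[OF \<phi>, of 0] bm\<phi>[OF \<eta>(1), of 0] \<eta>(2)
    by (simp add: \<psi>_def I_def Bochner_Integration.integral_diff bounded_measurable_integrable)
  moreover have "\<psi> \<in> test_functions a b"
    unfolding \<psi>_def by (intro test_function_diff_cmult \<phi> \<eta>)
  ultimately obtain \<Phi> where \<Phi>: "\<Phi> \<in> test_functions a b" "nderiv UNIV (Suc k) \<Phi> = nderiv UNIV k \<psi>"
    using test_function_antiderivative[OF _ \<open>a < b\<close>, of \<psi>] by blast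
  have "nderiv UNIV k \<psi> = (\<lambda>x. nderiv UNIV k \<phi> x - I * nderiv UNIV k \<eta> x)"
    unfolding \<psi>_def using \<phi> \<eta> by (intro nderiv_UNIV_diff_cmult) (auto simp: test_functions_iff)
  then have "(\<lambda>x. D (Suc k) x - nderiv UNIV (Suc k) \<Phi> x) = (\<lambda>x. W k x + I * nderiv UNIV k \<eta> x)"
    unfolding \<Phi>(2) by (simp add: W_def algebra_simps)
  moreover have "L2_inner a b (\<lambda>x. W k x + I * nderiv UNIV k \<eta> x) (\<lambda>x. W k x + I * nderiv UNIV k \<eta> x)
      \<le> 2 * Q + 2 * (I\<^sup>2 * M)"
  proof -
    have "L2_inner a b (\<lambda>x. I * nderiv UNIV k \<eta> x) (\<lambda>x. I * nderiv UNIV k \<eta> x) = I\<^sup>2 * M"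
      by (simp add: L2_inner_def M_def power2_eq_square mult_ac)
    then show ?thesis
      unfolding Q_def
      using L2_inner_add_self_le[of a b "W k" "\<lambda>x. I * nderiv UNIV k \<eta> x"] bmW bm\<phi> \<eta>(1)
      by (simp add: bounded_measurable_intros)
  qed
  moreover have "2 * Q + 2 * (I\<^sup>2 * M) \<le> 2 * Q + 2 * ((b - a) ^ (2 * k + 1) * Q * M)"
    using I by (intro add_left_mono mult_left_mono mult_right_mono) (simp_all add: M_def L2_inner_self_nonneg)
  moreover have "\<dots> = 2 * (1 + K) * Q" by (simp add: K_def algebra_simps)
  moreover have "\<dots> < \<epsilon>"
    using small \<open>0 \<le> K\<close> by (simp add: Q_def W_def \<epsilon>'_def field_simps)
  ultimately show ?case
    using \<Phi>(1) by (intro bexI[of _ \<Phi>]) simp_all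
qed simp

text \<open>The Poincare inequality bounds every derivative of \<open>D 0\<close> minus a test
  function by the top one, so approximating \<open>D k\<close> in L2 suffices; K sums the constants
  of all orders.\<close>

lemma deriv_chain_H0_space:
  assumes "a < b" and D: "deriv_chain S k a b D" and zero: "\<And>i. i < k \<Longrightarrow> D i a = 0 \<and> D i b = 0"
    and approx: "\<And>\<epsilon>. \<epsilon> > 0 \<Longrightarrow>
      \<exists>\<phi>\<in>test_functions a b. L2_inner a b (\<lambda>x. D k x - \<phi> x) (\<lambda>x. D k x - \<phi> x) < \<epsilon>"
  shows "D 0 \<in> H0_space k a b"
  unfolding H0_space_def
proof (intro CollectI conjI allI impI)
  show "D 0 \<in> H_space k a b"
    using deriv_chain_H_space[OF D] \<open>a < b\<close> by simp
  fix \<epsilon> :: real assume "\<epsilon> > 0"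
  define K where "K = (\<Sum>i\<le>k. (b - a) ^ (2 * (k - i)))"
  have "K > 0"
    unfolding K_def using \<open>a < b\<close> by (intro sum_pos) auto
  then obtain \<phi> where \<phi>: "\<phi> \<in> test_functions a b" and
    small: "L2_inner a b (\<lambda>x. D k x - nderiv UNIV k \<phi> x) (\<lambda>x. D k x - nderiv UNIV k \<phi> x) < \<epsilon>\<^sup>2 / K"
    using deriv_chain_test_function_approx[OF \<open>a < b\<close> D zero approx, of "\<epsilon>\<^sup>2 / K"] \<open>\<epsilon> > 0\<close> by auto
  define W where "W = (\<lambda>i x. D i x - nderiv UNIV i \<phi> x)"
  have W: "deriv_chain S k a b W"
    unfolding W_def using deriv_chain_diff[OF D test_function_chain[OF \<phi>]] by simp
  have "(\<Sum>i\<le>k. L2_inner a b (W i) (W i)) \<le> (\<Sum>i\<le>k. (b - a) ^ (2 * (k - i)) * L2_inner a b (W k) (W k))"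
    using zero test_function_boundary[OF \<phi>] \<open>a < b\<close>
    by (intro sum_mono deriv_chain_Poincare[OF W]) (auto simp: W_def)
  also have "\<dots> = K * L2_inner a b (W k) (W k)"
    by (simp add: K_def sum_distrib_right)
  also have "\<dots> < \<epsilon>\<^sup>2"
    using small \<open>K > 0\<close> by (simp add: W_def field_simps)
  finally have "H_norm k a b (W 0) < \<epsilon>"
    using deriv_chain_H_norm[OF W] \<open>a < b\<close> \<open>\<epsilon> > 0\<close> by (simp add: real_less_lsqrt)
  then show "\<exists>\<phi>\<in>test_functions a b. H_norm k a b (\<lambda>x. D 0 x - \<phi> x) < \<epsilon>"
    using \<phi> by (auto simp: W_def)
qed

text \<open>Each indicator is replaced by the bump on the same interval. Pointwise convergence with
  the common majorant B^2 for the squared error gives L2 convergence, jumps notwithstanding.\<close>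

lemma piecewise_poly_test_function_approx:
  fixes q :: "'i \<Rightarrow> real poly" and c d :: "'i \<Rightarrow> real"
  assumes "finite J" "\<And>j. j \<in> J \<Longrightarrow> a \<le> c j \<and> d j \<le> b" "\<epsilon> > 0"
  defines "E \<equiv> \<lambda>x. \<Sum>j\<in>J. poly (q j) x * indicator {c j<..<d j} x"
  shows "\<exists>\<phi>\<in>test_functions a b. L2_inner a b (\<lambda>x. E x - \<phi> x) (\<lambda>x. E x - \<phi> x) < \<epsilon>"
proof -
  define \<phi> where "\<phi> = (\<lambda>n x. \<Sum>j\<in>J. poly (q j) x * bump n (c j) (d j) x)"
  define B where "B = (\<lambda>x. \<Sum>j\<in>J. \<bar>poly (q j) x\<bar>)"
  have \<phi>: "\<phi> n \<in> test_functions a b" for n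
    unfolding \<phi>_def using assms by (intro test_function_poly_bumps)
  have poly: "bounded_measurable a b (poly r)" for r
    by (intro bounded_measurable_continuous continuous_intros)
  have bm: "bounded_measurable a b E" "bounded_measurable a b B" "bounded_measurable a b (\<phi> n)" for n
    using deriv_chain_bounded_measurable[OF test_function_chain[OF \<phi>[of n]], of 0 0]
    by (auto simp: E_def B_def intro!: bounded_measurable_intros bounded_measurable_indicator_Ioo poly)
  have bound: "\<bar>E x - \<phi> n x\<bar> \<le> B x" for n x
  proof -
    have "E x - \<phi> n x = (\<Sum>j\<in>J. poly (q j) x * (indicator {c j<..<d j} x - bump n (c j) (d j) x))"
      by (simp add: E_def \<phi>_def sum_subtractf right_diff_distrib)
    also have "\<bar>\<dots>\<bar> \<le> B x"
      unfolding B_def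
    proof (rule order.trans[OF sum_abs sum_mono])
      fix j
      have "\<bar>indicat_real {c j<..<d j} x - bump n (c j) (d j) x\<bar> \<le> 1"
        using bump_range[of n "c j" "d j" x] by (auto simp: indicator_def)
      then show "\<bar>poly (q j) x * (indicator {c j<..<d j} x - bump n (c j) (d j) x)\<bar> \<le> \<bar>poly (q j) x\<bar>"
        by (simp add: abs_mult mult_left_le)
    qed
    finally show ?thesis .
  qed
  have "(\<lambda>n. L2_inner a b (\<lambda>x. E x - \<phi> n x) (\<lambda>x. E x - \<phi> n x)) \<longlonglongrightarrow> (\<integral>x. 0 \<partial>lebesgue_on {a..b})"
    unfolding L2_inner_def
  proof (rule integral_dominated_convergence)
    have "bounded_measurable a b (\<lambda>x. (E x - \<phi> n x) * (E x - \<phi> n x))" for n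
      by (intro bounded_measurable_intros bm)
    then show "(\<lambda>x. (E x - \<phi> n x) * (E x - \<phi> n x)) \<in> borel_measurable (lebesgue_on {a..b})" for n
      by (simp add: bounded_measurable_def)
    show "integrable (lebesgue_on {a..b}) (\<lambda>x. B x * B x)"
      by (intro bounded_measurable_integrable bounded_measurable_intros bm)
    show "AE x in lebesgue_on {a..b}. (\<lambda>n. (E x - \<phi> n x) * (E x - \<phi> n x)) \<longlonglongrightarrow> 0"
    proof (rule AE_I2)
      fix x
      have "(\<lambda>n. \<phi> n x) \<longlonglongrightarrow> E x"
        unfolding \<phi>_def E_def by (intro tendsto_intros bump_tendsto)
      then have "(\<lambda>n. (E x - \<phi> n x) * (E x - \<phi> n x)) \<longlonglongrightarrow> (E x - E x) * (E x - E x)"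
        by (intro tendsto_intros)
      then show "(\<lambda>n. (E x - \<phi> n x) * (E x - \<phi> n x)) \<longlonglongrightarrow> 0" by simp
    qed
    have "(E x - \<phi> n x) * (E x - \<phi> n x) \<le> B x * B x" for n x
      using mult_mono[OF bound[of x n] bound[of x n]] order.trans[OF abs_ge_zero bound[of x n]]
      by (simp flip: abs_mult)
    then show "AE x in lebesgue_on {a..b}. norm ((E x - \<phi> n x) * (E x - \<phi> n x)) \<le> B x * B x" for n
      by (intro AE_I2) simp
  qed simp
  then have "\<forall>\<^sub>F n in sequentially. L2_inner a b (\<lambda>x. E x - \<phi> n x) (\<lambda>x. E x - \<phi> n x) < \<epsilon>"
    using \<open>\<epsilon> > 0\<close> by (intro order_tendstoD(2)) auto
  then obtain n where "L2_inner a b (\<lambda>x. E x - \<phi> n x) (\<lambda>x. E x - \<phi> n x) < \<epsilon>"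
    using eventually_happens by force
  then show ?thesis using \<phi> by blast
qed


section \<open>Splines\<close>

lemma at_within_Icc_neq_bot:
  assumes "a < b" "x \<in> {a..b::real}"
  shows "at x within {a..b} \<noteq> bot"
proof -
  have "x islimpt {a..b}"
    using assms by (intro connected_imp_perfect) (auto intro: exI[of _ a] exI[of _ b])
  then show ?thesis by (simp add: trivial_limit_within)
qed

lemma C_on_deriv_chain:
  assumes "C_on k {a..b} u"
  shows "deriv_chain {} k a b (\<lambda>i. nderiv {a..b} i u)"
proof -
  have cont: "continuous_on {a..b} (nderiv {a..b} i u)" if "i \<le> k" for i
    using assms that unfolding C_on_def
    by (cases "i = k") (auto intro: differentiable_imp_continuous_on)
  have "(nderiv {a..b} i u has_real_derivative nderiv {a..b} (Suc i) u x) (at x)"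
    if "i < k" "x \<in> {a<..<b}" for i x
    using C_on_nderiv[OF assms, of i x] that by (simp add: at_within_Icc_at)
  then show ?thesis
    using cont unfolding deriv_chain_def by (auto intro: bounded_measurable_continuous)
qed

lemma C_on_diff:
  assumes "a < b" "C_on k {a..b} f" "C_on k {a..b} g"
  shows "C_on k {a..b} (\<lambda>x. f x - g x)"
    and "j \<le> k \<Longrightarrow> x \<in> {a..b} \<Longrightarrow>
      nderiv {a..b} j (\<lambda>x. f x - g x) x = nderiv {a..b} j f x - nderiv {a..b} j g x"
proof -
  define D where "D = (\<lambda>j x. nderiv {a..b} j f x - nderiv {a..b} j g x)"
  have D: "(D j has_real_derivative D (Suc j) x) (at x within {a..b})" if "j < k" "x \<in> {a..b}" for j x
    unfolding D_def using that assms by (intro DERIV_diff C_on_nderiv)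
  have D0: "D 0 = (\<lambda>x. f x - g x)" by (simp add: D_def)
  have "continuous_on {a..b} (D k)"
    using assms unfolding D_def C_on_def by (intro continuous_intros) auto
  then show "C_on k {a..b} (\<lambda>x. f x - g x)"
    using C_onI[of "{a..b}" k D] at_within_Icc_neq_bot[OF \<open>a < b\<close>] D by (simp add: D0)
  show "nderiv {a..b} j (\<lambda>x. f x - g x) x = nderiv {a..b} j f x - nderiv {a..b} j g x"
    if "j \<le> k" "x \<in> {a..b}"
    using nderiv_eqI[of "{a..b}" k D j x] at_within_Icc_neq_bot[OF \<open>a < b\<close>] D that
    by (simp add: D0) (simp add: D_def)
qed

lemma nderiv_eq_poly:
  assumes "a \<le> c" "d \<le> b" "\<And>t. t \<in> {c<..<d} \<Longrightarrow> v t = poly q t" "t \<in> {c<..<d}"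
  shows "nderiv {a..b} i v t = poly ((pderiv ^^ i) q) t"
  using assms(4)
proof (induction i arbitrary: t)
  case (Suc i)
  have "(poly ((pderiv ^^ i) q) has_vector_derivative poly ((pderiv ^^ Suc i) q) t) (at t)"
    using poly_DERIV by (simp add: has_real_derivative_iff_has_vector_derivative[symmetric])
  then have "(nderiv {a..b} i v has_vector_derivative poly ((pderiv ^^ Suc i) q) t) (at t)"
    by (rule has_vector_derivative_transform_within_open[of _ _ _ "{c<..<d}"]) (use Suc in auto)
  moreover have "at t within {a..b} = at t"
    using Suc.prems assms by (intro at_within_Icc_at) auto
  ultimately show ?case by (simp add: vector_derivative_at)
qed (use assms in simp)

section \<open>Partitions and their cells\<close>

lemma partition_less:
  assumes "is_partition a b N x" "i < j" "j \<le> N"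
  shows "x i < x j"
  using \<open>i < j\<close> \<open>j \<le> N\<close>
proof (induction j)
  case (Suc j)
  have "x j < x (Suc j)"
    using assms(1) Suc.prems unfolding is_partition_def by force
  then show ?case using Suc by (cases "i = j") auto
qed simp

lemma partition_mono: "is_partition a b N x \<Longrightarrow> i \<le> j \<Longrightarrow> j \<le> N \<Longrightarrow> x i \<le> x j"
  using partition_less[of a b N x i j] by (cases "i = j") auto

lemma partition_bounds:
  assumes "is_partition a b N x" "j \<in> {1..N}"
  shows "a \<le> x (j - 1)" "x (j - 1) < x j" "x j \<le> b"
  using partition_mono[OF assms(1), of 0 "j - 1"] partition_mono[OF assms(1), of j N] assms
  by (auto simp: is_partition_def)

lemma partition_cell_unique:
  assumes "is_partition a b N x" "i \<in> {1..N}" "j \<in> {1..N}"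
    "t \<in> {x (i - 1)<..<x i}" "t \<in> {x (j - 1)<..<x j}"
  shows "i = j"
proof (rule ccontr)
  assume "i \<noteq> j"
  then consider "i \<le> j - 1" | "j \<le> i - 1" by linarith
  then show False
  proof cases
    case 1
    then have "x i \<le> x (j - 1)" using assms(3) by (intro partition_mono[OF assms(1)]) auto
    then show False using assms(4,5) by simp
  next
    case 2
    then have "x j \<le> x (i - 1)" using assms(2) by (intro partition_mono[OF assms(1)]) auto
    then show False using assms(4,5) by simp
  qed
qed

lemma partition_cell_exists:
  assumes "is_partition a b N x" "t \<in> {a<..<b}" "t \<notin> x ` {0..N}"
  shows "\<exists>j\<in>{1..N}. t \<in> {x (j - 1)<..<x j}"
proof -
  \<comment> \<open>The first mesh point beyond t is the right end of its cell.\<close>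
  define j where "j = (LEAST j. t < x j)"
  have "t < x N" using assms by (simp add: is_partition_def)
  then have j: "t < x j" "j \<le> N"
    unfolding j_def by (rule LeastI, rule Least_le)
  have "j \<noteq> 0"
  proof
    assume "j = 0"
    then show False using j assms by (simp add: is_partition_def)
  qed
  then have "\<not> t < x (j - 1)"
    unfolding j_def by (intro not_less_Least) simp
  moreover have "x (j - 1) \<noteq> t" using assms(3) j by auto
  ultimately show ?thesis
    using j \<open>j \<noteq> 0\<close> by (intro bexI[of _ j]) auto
qed

text \<open>A spline is only C^m, so \<open>nderiv\<close> of higher order carries no information at
  a mesh point. Above order m the derivatives are therefore glued from the polynomial pieces, with
  value 0 at the mesh points; up to order m the continuous \<open>nderiv\<close> is kept.\<close>

definition spline_derivs ::
  "nat \<Rightarrow> nat \<Rightarrow> (nat \<Rightarrow> real) \<Rightarrow> (nat \<Rightarrow> real poly) \<Rightarrow> (real \<Rightarrow> real) \<Rightarrow> nat \<Rightarrow> real \<Rightarrow> real" where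
  "spline_derivs m N x q v i =
     (if i \<le> m then nderiv {x 0..x N} i v
      else (\<lambda>t. \<Sum>j\<in>{1..N}. poly ((pderiv ^^ i) (q j)) t * indicator {x (j - 1)<..<x j} t))"

lemma spline_derivs_0 [simp]: "spline_derivs m N x q v 0 = v"
  by (simp add: spline_derivs_def)

context
  fixes a b :: real and m N :: nat and x :: "nat \<Rightarrow> real" and q :: "nat \<Rightarrow> real poly" and v :: "real \<Rightarrow> real"
  assumes part: "is_partition a b N x"
    and C: "C_on m {a..b} v"
    and poly: "\<And>j t. j \<in> {1..N} \<Longrightarrow> t \<in> {x (j - 1)<..<x j} \<Longrightarrow> v t = poly (q j) t"
begin

lemma spline_derivs_eq_poly:
  assumes "j \<in> {1..N}" "t \<in> {x (j - 1)<..<x j}"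
  shows "spline_derivs m N x q v i t = poly ((pderiv ^^ i) (q j)) t"
proof (cases "i \<le> m")
  case True
  then show ?thesis
    using nderiv_eq_poly[of a "x (j - 1)" "x j" b v "q j" t i] partition_bounds[OF part assms(1)]
      poly[OF assms(1)] assms(2) part
    by (simp add: spline_derivs_def is_partition_def)
next
  case False
  have "indicator {x (l - 1)<..<x l} t = (if l = j then 1 else 0 :: real)" if "l \<in> {1..N}" for l
  proof (cases "l = j")
    case False
    then have "t \<notin> {x (l - 1)<..<x l}"
      using partition_cell_unique[OF part that assms(1) _ assms(2)] by blast
    then show ?thesis using False by simp
  qed (use assms(2) in simp)
  then have "(\<Sum>l\<in>{1..N}. poly ((pderiv ^^ i) (q l)) t * indicator {x (l - 1)<..<x l} t) =
      (\<Sum>l\<in>{1..N}. if l = j then poly ((pderiv ^^ i) (q l)) t else 0)"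
    by (intro sum.cong) auto
  then show ?thesis
    using False assms(1) by (simp add: spline_derivs_def)
qed

text \<open>The mesh points form the exceptional set. Inside a cell every member is a polynomial;
  across mesh points only continuity of the orders up to m is asked, which \<open>C_on\<close>
  gives.\<close>

lemma spline_derivs_chain: "deriv_chain (x ` {0..N}) (m + 1) a b (spline_derivs m N x q v)"
  unfolding deriv_chain_def
proof (intro conjI allI impI ballI)
  show "finite (x ` {0..N})" by simp
  have "bounded_measurable a b (poly r)" for r
    by (intro bounded_measurable_continuous continuous_intros)
  then have "bounded_measurable a b
      (\<lambda>t. \<Sum>j\<in>{1..N}. poly ((pderiv ^^ (m + 1)) (q j)) t * indicator {x (j - 1)<..<x j} t)"
    by (intro bounded_measurable_sum bounded_measurable_mult bounded_measurable_indicator_Ioo)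
  then show "bounded_measurable a b (spline_derivs m N x q v (m + 1))"
    by (simp add: spline_derivs_def del: funpow.simps)
  have "x 0 = a" "x N = b" using part by (auto simp: is_partition_def)
  then show "continuous_on {a..b} (spline_derivs m N x q v i)" if "i < m + 1" for i
    using deriv_chain_continuous[OF C_on_deriv_chain[OF C], of i] C that
    by (cases "i = m") (auto simp: spline_derivs_def C_on_def)
  fix i t assume t: "t \<in> {a<..<b} - x ` {0..N}"
  then obtain j where j: "j \<in> {1..N}" "t \<in> {x (j - 1)<..<x j}"
    using partition_cell_exists[OF part] by blast
  have "(spline_derivs m N x q v i has_real_derivative poly ((pderiv ^^ Suc i) (q j)) t) (at t)"
  proof (rule has_field_derivative_transform_within_open)
    show "(poly ((pderiv ^^ i) (q j)) has_real_derivative poly ((pderiv ^^ Suc i) (q j)) t) (at t)"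
      using poly_DERIV by simp
    show "poly ((pderiv ^^ i) (q j)) y = spline_derivs m N x q v i y" if "y \<in> {x (j - 1)<..<x j}" for y
      using spline_derivs_eq_poly[OF j(1) that] by simp
  qed (use j in auto)
  then show "(spline_derivs m N x q v i has_real_derivative spline_derivs m N x q v (Suc i) t) (at t)"
    using spline_derivs_eq_poly[OF j] by simp
qed

text \<open>The conditions at a and b cover all orders below m + 1, and the derivative of order m +
  1 is piecewise polynomial, hence an L2 limit of test functions.\<close>

lemma spline_in_H0_space:
  assumes "vanishing_boundary_derivs m a b v"
  shows "v \<in> H0_space (m + 1) a b"
proof -
  have ab: "x 0 = a" "x N = b" "a < b"
    using part partition_less[OF part, of 0 N] by (auto simp: is_partition_def)
  have "spline_derivs m N x q v 0 \<in> H0_space (m + 1) a b"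
  proof (rule deriv_chain_H0_space[OF \<open>a < b\<close> spline_derivs_chain])
    show "spline_derivs m N x q v i a = 0 \<and> spline_derivs m N x q v i b = 0" if "i < m + 1" for i
      using assms that ab by (simp add: spline_derivs_def vanishing_boundary_derivs_def)
    fix \<epsilon> :: real assume "\<epsilon> > 0"
    then show "\<exists>\<phi>\<in>test_functions a b. L2_inner a b
        (\<lambda>t. spline_derivs m N x q v (m + 1) t - \<phi> t) (\<lambda>t. spline_derivs m N x q v (m + 1) t - \<phi> t) < \<epsilon>"
      using piecewise_poly_test_function_approx[of "{1..N}" a "\<lambda>j. x (j - 1)" x b \<epsilon>
          "\<lambda>j. (pderiv ^^ (m + 1)) (q j)"] partition_bounds[OF part]
      by (simp add: spline_derivs_def del: funpow.simps)
  qed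
  then show ?thesis by simp
qed

end

lemma spline_space0_diff:
  assumes "is_partition a b N x" "W \<in> spline_space0 p m N x" "U \<in> spline_space0 p m N x"
  shows "(\<lambda>t. W t - U t) \<in> spline_space0 p m N x"
proof -
  have ab: "x 0 < x N"
    using partition_less[OF assms(1), of 0 N] assms(1) by (auto simp: is_partition_def)
  have C: "C_on m {x 0..x N} W" "C_on m {x 0..x N} U"
    using assms by (auto simp: spline_space0_def spline_space_def)
  have "\<exists>r :: real poly. degree r \<le> p \<and> (\<forall>t\<in>{x (j - 1)<..<x j}. W t - U t = poly r t)" if "j \<in> {1..N}" for j
  proof -
    have *: "\<exists>r :: real poly. degree r \<le> p \<and> (\<forall>t\<in>{x (j - 1)<..<x j}. v t = poly r t)"
      if "v \<in> spline_space0 p m N x" for v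
      using that \<open>j \<in> {1..N}\<close> by (simp add: spline_space0_def spline_space_def)
    obtain q where "degree q \<le> p" "\<forall>t\<in>{x (j - 1)<..<x j}. W t = poly q t"
      using *[OF assms(2)] by blast
    moreover obtain r where "degree r \<le> p" "\<forall>t\<in>{x (j - 1)<..<x j}. U t = poly r t"
      using *[OF assms(3)] by blast
    ultimately show ?thesis
      by (intro exI[of _ "q - r"]) (auto intro: degree_diff_le)
  qed
  moreover have "vanishing_boundary_derivs m (x 0) (x N) (\<lambda>t. W t - U t)"
    using assms C_on_diff(2)[OF ab C] ab
    by (auto simp: spline_space0_def vanishing_boundary_derivs_def)
  ultimately show ?thesis
    using C_on_diff(1)[OF ab C] by (auto simp: spline_space0_def spline_space_def)
qed

section \<open>Summation over the cells and the mesh size\<close>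

lemma partition_integral:
  assumes part: "is_partition a b N x" and f: "bounded_measurable a b f"
  shows "(\<integral>t. f t \<partial>lebesgue_on {a..b}) = (\<Sum>j\<in>{1..N}. \<integral>t. f t \<partial>lebesgue_on {x (j - 1)..x j})"
proof -
  have bm: "bounded_measurable (x i) (x j) f" if "i \<le> j" "j \<le> N" for i j
  proof (rule bounded_measurable_subinterval[OF f])
    show "{x i..x j} \<subseteq> {a..b}"
      using partition_mono[OF part, of 0 i] partition_mono[OF part, of j N] that part
      by (auto simp: is_partition_def)
  qed
  have "integral {x 0..x n} f = (\<Sum>j\<in>{1..n}. integral {x (j - 1)..x j} f)" if "n \<le> N" for n
    using that
  proof (induction n)
    case (Suc n)
    have "integral {x 0..x n} f + integral {x n..x (Suc n)} f = integral {x 0..x (Suc n)} f"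
      using Suc.prems bounded_measurable_has_integral[OF bm[of 0 "Suc n"]]
      by (intro Henstock_Kurzweil_Integration.integral_combine partition_mono[OF part])
        (auto intro: has_integral_integrable)
    then show ?case using Suc by simp
  qed simp
  from this[of N] have "integral {a..b} f = (\<Sum>j\<in>{1..N}. integral {x (j - 1)..x j} f)"
    using part by (simp add: is_partition_def)
  also have "\<dots> = (\<Sum>j\<in>{1..N}. \<integral>t. f t \<partial>lebesgue_on {x (j - 1)..x j})"
    by (intro sum.cong refl) (subst bounded_measurable_integral_eq; auto intro: bm)
  finally show ?thesis
    using bounded_measurable_integral_eq[OF f] by simp
qed

lemma partition_L2_inner:
  assumes "is_partition a b N x" "bounded_measurable a b f" "bounded_measurable a b g"
  shows "L2_inner a b f g = (\<Sum>j\<in>{1..N}. L2_inner (x (j - 1)) (x j) f g)"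
  unfolding L2_inner_def using assms by (intro partition_integral bounded_measurable_mult)

text \<open>The discrete Cauchy-Schwarz inequality over the cells. It lets local estimates add up to
  a global one with a constant that does not grow with N.\<close>

lemma partition_Cauchy_Schwarz:
  assumes "is_partition a b N x" "bounded_measurable a b f" "bounded_measurable a b g"
  shows "(\<Sum>j\<in>{1..N}. sqrt (L2_inner (x (j - 1)) (x j) f f) * sqrt (L2_inner (x (j - 1)) (x j) g g)) \<le>
    sqrt (L2_inner a b f f) * sqrt (L2_inner a b g g)"
proof -
  have "L2_set (\<lambda>j. sqrt (L2_inner (x (j - 1)) (x j) h h)) {1..N} = sqrt (L2_inner a b h h)"
    if "bounded_measurable a b h" for h
    using partition_L2_inner[OF assms(1) that that] by (simp add: L2_set_def L2_inner_self_nonneg)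
  then show ?thesis
    using L2_set_mult_ineq[of "\<lambda>j. sqrt (L2_inner (x (j - 1)) (x j) f f)"
        "\<lambda>j. sqrt (L2_inner (x (j - 1)) (x j) g g)" "{1..N}"] assms
    by (simp add: L2_inner_self_nonneg)
qed

lemma mesh_max_ge:
  assumes "j \<in> {1..N}"
  shows "x j - x (j - 1) \<le> mesh_max N x"
  unfolding mesh_max_def using assms by (intro Max_ge) auto

lemma mesh_max_bounds:
  assumes "is_partition a b N x"
  shows "0 < mesh_max N x" "mesh_max N x \<le> b - a"
proof -
  have "1 \<in> {1..N}" using assms by (simp add: is_partition_def)
  then show "0 < mesh_max N x"
    using mesh_max_ge[of 1 N x] partition_bounds(2)[OF assms, of 1] by linarith
  show "mesh_max N x \<le> b - a"
    unfolding mesh_max_def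
  proof (subst Max_le_iff)
    show "\<forall>h\<in>(\<lambda>j. x j - x (j - 1)) ` {1..N}. h \<le> b - a"
    proof (rule ballI, elim imageE)
      fix h j assume "h = x j - x (j - 1)" "j \<in> {1..N}"
      then show "h \<le> b - a" using partition_bounds[OF assms, of j] by linarith
    qed
  qed (use \<open>1 \<in> {1..N}\<close> in auto)
qed


section \<open>The consistency error\<close>

lemma C_on_bound:
  assumes "C_on k {a..b} P"
  shows "\<exists>B. \<forall>t\<in>{a..b}. \<bar>nderiv {a..b} k P t\<bar> \<le> B"
  using assms bounded_measurable_continuous[of a b "nderiv {a..b} k P"]
  by (simp add: C_on_def bounded_measurable_def)

lemma C_on_le:
  assumes "C_on k {a..b} u" "j \<le> k"
  shows "C_on j {a..b} u"
proof (cases "j = k")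
  case False
  then show ?thesis
    using assms by (auto simp: C_on_def differentiable_imp_continuous_on)
qed (use assms in simp)

text \<open>A real \<open>SUP\<close> bounds its members only if the set is bounded above; this
  comes from continuity of each coefficient on the compact interval and the finite range of
  k.\<close>

lemma P_max_bound:
  assumes "\<And>k. k \<le> m + 1 \<Longrightarrow> C_on p {a..b} (P k)" "k \<le> m + 1" "t \<in> {a..b}"
  shows "\<bar>P k t\<bar> \<le> P_max m a b P"
proof -
  have "\<exists>B. \<forall>t\<in>{a..b}. \<bar>P k t\<bar> \<le> B" if "k \<le> m + 1" for k
    using C_on_bound[OF C_on_le[OF assms(1)[OF that], of 0]] by simp
  then obtain B where B: "\<And>k t. k \<le> m + 1 \<Longrightarrow> t \<in> {a..b} \<Longrightarrow> \<bar>P k t\<bar> \<le> B k"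
    by metis
  have "bdd_above ((\<lambda>(k, t). \<bar>P k t\<bar>) ` ({0..m + 1} \<times> {a..b}))"
  proof (rule bdd_aboveI2)
    show "(\<lambda>(k, t). \<bar>P k t\<bar>) z \<le> Max (B ` {0..m + 1})" if "z \<in> {0..m + 1} \<times> {a..b}" for z
    proof -
      obtain k t where z: "z = (k, t)" by fastforce
      then have z: "z = (k, t)" "k \<le> m + 1" "t \<in> {a..b}" using that by auto
      have "\<bar>P k t\<bar> \<le> B k" using B z by simp
      also have "\<dots> \<le> Max (B ` {0..m + 1})" using z by (intro Max_ge) auto
      finally show ?thesis using z by simp
    qed
  qed
  then have "(\<lambda>(k, t). \<bar>P k t\<bar>) (k, t) \<le> P_max m a b P"
    unfolding P_max_def by (rule cSUP_upper2[of _ _ "(k, t)"]) (use assms in auto)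
  then show ?thesis by simp
qed

text \<open>The mean value theorem; its intermediate point lies inside (a, b), where the derivative
  within \<open>{a..b}\<close> is the ordinary one.\<close>

lemma dP_max_Lipschitz:
  assumes C: "C_on 1 {a..b} (P (m + 1))" and "a \<le> c" "c \<le> t" "t \<le> b"
  shows "\<bar>P (m + 1) t - P (m + 1) c\<bar> \<le> dP_max m a b P * (t - c)"
proof (cases "c = t")
  case False
  then have "c < t" using assms by simp
  have chain: "deriv_chain {} 1 a b (\<lambda>i. nderiv {a..b} i (P (m + 1)))"
    by (rule C_on_deriv_chain[OF C])
  have deriv: "(P (m + 1) has_real_derivative nderiv {a..b} 1 (P (m + 1)) z) (at z)" if "c < z" "z < t" for z
    using deriv_chain_deriv[OF chain, of 0 z] that assms by simp
  have "continuous_on {c..t} (P (m + 1))"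
    by (rule continuous_on_subset[of "{a..b}"])
      (use deriv_chain_continuous[OF chain, of 0] assms in auto)
  then obtain l z where z: "c < z" "z < t" "DERIV (P (m + 1)) z :> l" "P (m + 1) t - P (m + 1) c = (t - c) * l"
    using MVT[OF \<open>c < t\<close>, of "P (m + 1)"] deriv real_differentiable_def by metis
  then have "l = nderiv {a..b} 1 (P (m + 1)) z"
    using DERIV_unique deriv by blast
  have "\<bar>nderiv {a..b} 1 (P (m + 1)) z\<bar> \<le> dP_max m a b P"
    unfolding dP_max_def
  proof (rule cSUP_upper)
    show "bdd_above ((\<lambda>x. \<bar>nderiv {a..b} 1 (P (m + 1)) x\<bar>) ` {a..b})"
      using C_on_bound[OF C] by (meson bdd_aboveI2)
  qed (use z assms in auto)
  then show ?thesis
    using z \<open>c < t\<close> \<open>l = _\<close> by (simp add: abs_mult mult.commute[of "t - c"] mult_right_mono del: nderiv.simps)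
qed simp

text \<open>\<open>E k\<close> is the derivative of order \<open>k\<close> of the test function $e$ in $a(W - u, e)$; apart from its
  piecewise polynomial top derivative only boundedness is used.\<close>

locale interpolation_setting =
  fixes m p N :: nat and a b :: real and P :: "nat \<Rightarrow> real \<Rightarrow> real" and u W :: "real \<Rightarrow> real"
    and x :: "nat \<Rightarrow> real" and q r :: "nat \<Rightarrow> real poly" and E :: "nat \<Rightarrow> real \<Rightarrow> real"
  assumes pm: "2 * m + 1 \<le> p" and part: "is_partition a b N x"
    and P: "\<And>k. k \<le> m + 1 \<Longrightarrow> C_on p {a..b} (P k)"
    and u: "C_on (p + 2) {a..b} u"
    and W: "C_on m {a..b} W" "\<And>j t. j \<in> {1..N} \<Longrightarrow> t \<in> {x (j - 1)..x j} \<Longrightarrow> W t = poly (q j) t"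
    and deg: "\<And>j. j \<in> {1..N} \<Longrightarrow> degree (q j) \<le> p"
    and ends: "\<And>j k t. j \<in> {1..N} \<Longrightarrow> k \<le> m \<Longrightarrow> t \<in> {x (j - 1), x j} \<Longrightarrow>
      poly ((pderiv ^^ k) (q j)) t = nderiv {a..b} k u t"
    and nodes: "\<And>j \<mu>. j \<in> {1..N} \<Longrightarrow> \<mu> \<in> jacobi_nodes p m \<Longrightarrow>
      poly (q j) ((x (j - 1) + x j) / 2 + (x j - x (j - 1)) * \<mu> / 2) =
        u ((x (j - 1) + x j) / 2 + (x j - x (j - 1)) * \<mu> / 2)"
    and E: "\<And>k. k \<le> m + 1 \<Longrightarrow> bounded_measurable a b (E k)"
    and E_top: "\<And>j t. j \<in> {1..N} \<Longrightarrow> t \<in> {x (j - 1)<..<x j} \<Longrightarrow> E (m + 1) t = poly (r j) t"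
    and deg_r: "\<And>j. j \<in> {1..N} \<Longrightarrow> degree (r j) < p - m"
begin

abbreviation "Du \<equiv> \<lambda>i. nderiv {a..b} i u"
abbreviation "DW \<equiv> spline_derivs m N x q W"
abbreviation "H \<equiv> mesh_max N x"
abbreviation "L2 \<equiv> \<lambda>f. sqrt (L2_inner a b f f)"

lemma Du_chain: "deriv_chain {} (p + 2) a b Du"
  by (rule C_on_deriv_chain[OF u])

lemma DW_chain: "deriv_chain (x ` {0..N}) (m + 1) a b DW"
  using W(2) by (intro spline_derivs_chain[OF part W(1)]) auto

lemma P_bounded_measurable: "k \<le> m + 1 \<Longrightarrow> bounded_measurable a b (P k)"
  using C_on_le[OF P, of k 0] by (auto simp: C_on_def intro: bounded_measurable_continuous)

lemma Pmax_nonneg: "0 \<le> P_max m a b P"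
proof -
  have "a \<in> {a..b}"
    using partition_mono[OF part, of 0 N] part by (auto simp: is_partition_def)
  then show ?thesis
    using P_max_bound[OF P, where k = 0 and t = a] by (meson abs_ge_zero le0 order_trans)
qed

lemma dPmax_nonneg: "0 \<le> dP_max m a b P"
proof -
  have "a < b"
    using partition_less[OF part, of 0 N] part by (auto simp: is_partition_def)
  then show ?thesis
    using order.trans[OF abs_ge_zero dP_max_Lipschitz[where c = a and t = b]] C_on_le[OF P[OF order.refl], of 1] pm
    by (auto simp: zero_le_mult_iff)
qed

lemma cell_bounded_measurable:
  assumes "j \<in> {1..N}" "bounded_measurable a b f"
  shows "bounded_measurable (x (j - 1)) (x j) f"
proof (rule bounded_measurable_subinterval[OF assms(2)])
  show "{x (j - 1)..x j} \<subseteq> {a..b}"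
    using partition_bounds[OF part assms(1)] by auto
qed

text \<open>Inside a cell \<open>DW k\<close> is the derivative of the polynomial piece of W, and
  the two end points form a null set. The sign appears because the cell estimates are stated for u -
  W.\<close>

lemma cell_L2_inner_eq:
  assumes j: "j \<in> {1..N}" and "k \<le> m + 1"
  shows "L2_inner (x (j - 1)) (x j) (\<lambda>t. P k t * (DW k t - Du k t)) (E k) =
    - L2_inner (x (j - 1)) (x j) (\<lambda>t. P k t * (Du k t - poly ((pderiv ^^ k) (q j)) t)) (E k)"
proof -
  have poly: "bounded_measurable (x (j - 1)) (x j) (poly s)" for s
    by (intro bounded_measurable_continuous continuous_intros)
  have bm: "bounded_measurable (x (j - 1)) (x j) (P k)" "bounded_measurable (x (j - 1)) (x j) (E k)"
    "bounded_measurable (x (j - 1)) (x j) (Du k)" "bounded_measurable (x (j - 1)) (x j) (DW k)"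
    using assms(2) pm
    by (intro cell_bounded_measurable[OF j] P_bounded_measurable E
        deriv_chain_bounded_measurable[OF Du_chain] deriv_chain_bounded_measurable[OF DW_chain]; simp)+
  have "L2_inner (x (j - 1)) (x j) (\<lambda>t. P k t * (DW k t - Du k t)) (E k) =
      L2_inner (x (j - 1)) (x j) (\<lambda>t. (-1) * (P k t * (Du k t - poly ((pderiv ^^ k) (q j)) t))) (E k)"
  proof (rule L2_inner_cong_finite[of "{x (j - 1), x j}"])
    fix t assume "t \<in> {x (j - 1)..x j} - {x (j - 1), x j}"
    then have "DW k t = poly ((pderiv ^^ k) (q j)) t"
      using W(2) by (intro spline_derivs_eq_poly[OF part W(1) _ j]) auto
    then show "P k t * (DW k t - Du k t) = (-1) * (P k t * (Du k t - poly ((pderiv ^^ k) (q j)) t))"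
      by (simp add: algebra_simps)
  qed (intro bounded_measurable_intros bm poly | simp)+
  then show ?thesis
    unfolding L2_inner_cmult_left by simp
qed

lemma cell_interpolation:
  assumes j: "j \<in> {1..N}"
  shows "deriv_chain {} (p + 2) (x (j - 1)) (x j) Du"
  using partition_bounds[OF part j] by (intro deriv_chain_subinterval[OF Du_chain]) auto

text \<open>The exponent p + 1 - k is at least p - m + 1. Each cell length is replaced by H before
  the local norms are summed.\<close>

lemma consistency_lower:
  assumes "k \<le> m"
  shows "\<bar>L2_inner a b (\<lambda>t. P k t * (DW k t - Du k t)) (E k)\<bar> \<le>
    P_max m a b P * H ^ (p + 1 - k) * (L2 (Du (p + 1)) * L2 (E k))"
proof -
  let ?c = "\<lambda>j. x (j - 1)"
  let ?L2 = "\<lambda>j f. sqrt (L2_inner (x (j - 1)) (x j) f f)"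
  have k: "k \<le> m + 1" "k \<le> p" using assms pm by auto
  have bm: "bounded_measurable a b (\<lambda>t. P k t * (DW k t - Du k t))"
    using k
    by (auto intro!: bounded_measurable_intros P_bounded_measurable
        deriv_chain_bounded_measurable[OF Du_chain] deriv_chain_bounded_measurable[OF DW_chain])
  have cell: "\<bar>L2_inner (?c j) (x j) (\<lambda>t. P k t * (DW k t - Du k t)) (E k)\<bar> \<le>
      P_max m a b P * H ^ (p + 1 - k) * (?L2 j (Du (p + 1)) * ?L2 j (E k))" if j: "j \<in> {1..N}" for j
  proof -
    note bounds = partition_bounds[OF part j]
    have "\<bar>L2_inner (?c j) (x j) (\<lambda>t. P k t * (DW k t - Du k t)) (E k)\<bar> =
        \<bar>L2_inner (?c j) (x j) (\<lambda>t. P k t * (Du k t - poly ((pderiv ^^ k) (q j)) t)) (E k)\<bar>"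
      unfolding cell_L2_inner_eq[OF j k(1)] by simp
    also have "\<dots> \<le> P_max m a b P * (x j - ?c j) ^ (p + 1 - k) * (?L2 j (Du (p + 1)) * ?L2 j (E k))"
    proof (rule interpolation_error_L2_inner_le[OF bounds(2) pm cell_interpolation[OF j] deg[OF j]])
      show "\<bar>P k t\<bar> \<le> P_max m a b P" if "t \<in> {?c j..x j}" for t
        using that bounds by (intro P_max_bound[OF P] k) auto
      show "bounded_measurable (?c j) (x j) (P k)" "bounded_measurable (?c j) (x j) (E k)"
        using k by (intro cell_bounded_measurable[OF j] P_bounded_measurable E; simp)+
    qed (use ends[OF j] nodes[OF j] k in auto)
    also have "\<dots> \<le> P_max m a b P * H ^ (p + 1 - k) * (?L2 j (Du (p + 1)) * ?L2 j (E k))"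
      using bounds mesh_max_ge[OF j, of x] Pmax_nonneg
      by (intro mult_right_mono mult_left_mono power_mono) (auto simp: L2_inner_self_nonneg)
    finally show ?thesis .
  qed
  have "\<bar>L2_inner a b (\<lambda>t. P k t * (DW k t - Du k t)) (E k)\<bar> \<le>
      (\<Sum>j\<in>{1..N}. P_max m a b P * H ^ (p + 1 - k) * (?L2 j (Du (p + 1)) * ?L2 j (E k)))"
    unfolding partition_L2_inner[OF part bm E[OF k(1)]]
    by (rule order.trans[OF sum_abs sum_mono[OF cell]])
  also have "\<dots> \<le> P_max m a b P * H ^ (p + 1 - k) * (L2 (Du (p + 1)) * L2 (E k))"
    unfolding sum_distrib_left[symmetric] using Pmax_nonneg mesh_max_bounds(1)[OF part] k
    by (intro mult_left_mono partition_Cauchy_Schwarz[OF part] E deriv_chain_bounded_measurable[OF Du_chain])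
      auto
  finally show ?thesis .
qed

text \<open>Each cell freezes the coefficient at its own left end point, so its variation there is
  at most P'_max times the cell length.\<close>

lemma consistency_top:
  "\<bar>L2_inner a b (\<lambda>t. P (m + 1) t * (DW (m + 1) t - Du (m + 1) t)) (E (m + 1))\<bar> \<le>
    P_max m a b P * H ^ (p - m + 1) * (L2 (Du (p + 2)) * L2 (E (m + 1))) +
    dP_max m a b P * H ^ (p - m + 1) * (L2 (Du (p + 1)) * L2 (E (m + 1)))"
proof -
  let ?k = "m + 1"
  let ?c = "\<lambda>j. x (j - 1)"
  let ?L2 = "\<lambda>j f. sqrt (L2_inner (x (j - 1)) (x j) f f)"
  have C1: "C_on 1 {a..b} (P ?k)"
    using C_on_le[OF P, of ?k 1] pm by simp
  have bm: "bounded_measurable a b (\<lambda>t. P ?k t * (DW ?k t - Du ?k t))"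
    using pm
    by (intro bounded_measurable_mult bounded_measurable_diff P_bounded_measurable
        deriv_chain_bounded_measurable[OF Du_chain] deriv_chain_bounded_measurable[OF DW_chain]; simp)
  have cell: "\<bar>L2_inner (?c j) (x j) (\<lambda>t. P ?k t * (DW ?k t - Du ?k t)) (E ?k)\<bar> \<le>
      P_max m a b P * H ^ (p - m + 1) * (?L2 j (Du (p + 2)) * ?L2 j (E ?k)) +
      dP_max m a b P * H ^ (p - m + 1) * (?L2 j (Du (p + 1)) * ?L2 j (E ?k))" if j: "j \<in> {1..N}" for j
  proof -
    note bounds = partition_bounds[OF part j]
    have "\<bar>L2_inner (?c j) (x j) (\<lambda>t. P ?k t * (DW ?k t - Du ?k t)) (E ?k)\<bar> =
        \<bar>L2_inner (?c j) (x j) (\<lambda>t. P ?k t * (Du ?k t - poly ((pderiv ^^ ?k) (q j)) t)) (E ?k)\<bar>"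
      unfolding cell_L2_inner_eq[OF j order.refl] by simp
    also have "\<dots> \<le>
        P_max m a b P * (x j - ?c j) ^ (p - m + 1) * (?L2 j (Du (p + 2)) * ?L2 j (E ?k)) +
        dP_max m a b P * (x j - ?c j) ^ (p - m + 1) * (?L2 j (Du (p + 1)) * ?L2 j (E ?k))"
    proof (rule interpolation_error_top_L2_inner_le[OF bounds(2) pm cell_interpolation[OF j] deg[OF j] _ _ deg_r[OF j]])
      show "\<bar>P ?k (?c j)\<bar> \<le> P_max m a b P"
        using bounds by (intro P_max_bound[OF P]) auto
      show "\<bar>P ?k t - P ?k (?c j)\<bar> \<le> dP_max m a b P * (x j - ?c j)" if "t \<in> {?c j..x j}" for t
        using that bounds dPmax_nonneg
        by (intro order.trans[OF dP_max_Lipschitz[where c = "?c j" and m = m and P = P, OF C1]] mult_left_mono) auto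
      show "bounded_measurable (?c j) (x j) (P ?k)" "bounded_measurable (?c j) (x j) (E ?k)"
        by (intro cell_bounded_measurable[OF j] P_bounded_measurable E; simp)+
    qed (use ends[OF j] nodes[OF j] E_top[OF j] in auto)
    also have "\<dots> \<le>
        P_max m a b P * H ^ (p - m + 1) * (?L2 j (Du (p + 2)) * ?L2 j (E ?k)) +
        dP_max m a b P * H ^ (p - m + 1) * (?L2 j (Du (p + 1)) * ?L2 j (E ?k))"
      using bounds mesh_max_ge[OF j, of x] Pmax_nonneg dPmax_nonneg
      by (intro add_mono mult_right_mono mult_left_mono power_mono) (auto simp: L2_inner_self_nonneg)
    finally show ?thesis .
  qed
  have "\<bar>L2_inner a b (\<lambda>t. P ?k t * (DW ?k t - Du ?k t)) (E ?k)\<bar> \<le>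
      (\<Sum>j\<in>{1..N}. P_max m a b P * H ^ (p - m + 1) * (?L2 j (Du (p + 2)) * ?L2 j (E ?k)) +
        dP_max m a b P * H ^ (p - m + 1) * (?L2 j (Du (p + 1)) * ?L2 j (E ?k)))"
    unfolding partition_L2_inner[OF part bm E[OF order.refl]]
    by (rule order.trans[OF sum_abs sum_mono[OF cell]])
  also have "\<dots> \<le> P_max m a b P * H ^ (p - m + 1) * (L2 (Du (p + 2)) * L2 (E ?k)) +
      dP_max m a b P * H ^ (p - m + 1) * (L2 (Du (p + 1)) * L2 (E ?k))"
    unfolding sum.distrib sum_distrib_left[symmetric]
    using Pmax_nonneg dPmax_nonneg mesh_max_bounds(1)[OF part]
    by (intro add_mono mult_left_mono partition_Cauchy_Schwarz[OF part] E
        deriv_chain_bounded_measurable[OF Du_chain]) auto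
  finally show ?thesis .
qed

text \<open>The exponents p + 1 - k are reduced to the common p - m + 1 at the price of H^(m-k),
  where H is at most b - a. The factor m + 1 counts the orders k <= m.\<close>

lemma consistency:
  assumes B: "\<And>k. k \<le> m + 1 \<Longrightarrow> L2 (E k) \<le> B" and A: "L2 (Du (p + 1)) \<le> A" "L2 (Du (p + 2)) \<le> A"
  shows "\<bar>\<Sum>k\<le>m + 1. L2_inner a b (\<lambda>t. P k t * (DW k t - Du k t)) (E k)\<bar> \<le>
    (real (m + 1) * P_max m a b P * max 1 (b - a) ^ m + P_max m a b P + dP_max m a b P) *
      A * H ^ (p - m + 1) * B"
proof -
  have H: "0 < H" "H \<le> max 1 (b - a)"
    using mesh_max_bounds[OF part] by auto
  have nonneg: "0 \<le> A" "0 \<le> B" "0 \<le> L2 f" for f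
    using A(1) B[of 0] by (auto simp: L2_inner_self_nonneg intro: order.trans[rotated])
  have lower: "\<bar>L2_inner a b (\<lambda>t. P k t * (DW k t - Du k t)) (E k)\<bar> \<le>
      P_max m a b P * max 1 (b - a) ^ m * (A * H ^ (p - m + 1) * B)" if "k \<le> m" for k
  proof -
    have "p + 1 - k = m - k + (p - m + 1)"
      using that pm by simp
    then have "H ^ (p + 1 - k) = H ^ (m - k) * H ^ (p - m + 1)"
      by (simp only: power_add)
    \<comment> \<open>The maximum with 1 makes the bound monotone in the exponent, so the single
      power m serves all k.\<close>
    also have "\<dots> \<le> max 1 (b - a) ^ m * H ^ (p - m + 1)"
    proof (intro mult_right_mono)
      have "H ^ (m - k) \<le> max 1 (b - a) ^ (m - k)" using H by (intro power_mono) auto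
      also have "\<dots> \<le> max 1 (b - a) ^ m" by (intro power_increasing) auto
      finally show "H ^ (m - k) \<le> max 1 (b - a) ^ m" .
    qed (use H in simp)
    finally have *: "H ^ (p + 1 - k) \<le> max 1 (b - a) ^ m * H ^ (p - m + 1)" .
    have "P_max m a b P * H ^ (p + 1 - k) * (L2 (Du (p + 1)) * L2 (E k)) \<le>
        P_max m a b P * (max 1 (b - a) ^ m * H ^ (p - m + 1)) * (A * B)"
    proof (rule mult_mono[OF mult_left_mono[OF * Pmax_nonneg]])
      show "L2 (Du (p + 1)) * L2 (E k) \<le> A * B"
        using that by (intro mult_mono[OF A(1) B nonneg(1,3)]) simp
      show "0 \<le> P_max m a b P * (max 1 (b - a) ^ m * H ^ (p - m + 1))"
        using Pmax_nonneg H by simp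
      show "0 \<le> L2 (Du (p + 1)) * L2 (E k)"
        by (rule mult_nonneg_nonneg[OF nonneg(3) nonneg(3)])
    qed
    then show ?thesis
      using consistency_lower[OF that] by (simp add: mult_ac)
  qed
  have top: "\<bar>L2_inner a b (\<lambda>t. P (m + 1) t * (DW (m + 1) t - Du (m + 1) t)) (E (m + 1))\<bar> \<le>
      (P_max m a b P + dP_max m a b P) * (A * H ^ (p - m + 1) * B)"
  proof -
    have "P_max m a b P * H ^ (p - m + 1) * (L2 (Du (p + 2)) * L2 (E (m + 1))) +
        dP_max m a b P * H ^ (p - m + 1) * (L2 (Du (p + 1)) * L2 (E (m + 1))) \<le>
        P_max m a b P * H ^ (p - m + 1) * (A * B) + dP_max m a b P * H ^ (p - m + 1) * (A * B)"
      using Pmax_nonneg dPmax_nonneg H(1)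
      by (intro add_mono mult_left_mono mult_mono[OF _ B nonneg(1,3)] A) simp_all
    then show ?thesis
      using consistency_top by (simp add: algebra_simps)
  qed
  have "\<bar>\<Sum>k\<le>m + 1. L2_inner a b (\<lambda>t. P k t * (DW k t - Du k t)) (E k)\<bar> \<le>
      (\<Sum>k\<le>m + 1. \<bar>L2_inner a b (\<lambda>t. P k t * (DW k t - Du k t)) (E k)\<bar>)"
    by (rule sum_abs)
  also have "\<dots> = (\<Sum>k\<le>m. \<bar>L2_inner a b (\<lambda>t. P k t * (DW k t - Du k t)) (E k)\<bar>) +
      \<bar>L2_inner a b (\<lambda>t. P (m + 1) t * (DW (m + 1) t - Du (m + 1) t)) (E (m + 1))\<bar>"
    by simp
  also have "\<dots> \<le> (\<Sum>k\<le>m. P_max m a b P * max 1 (b - a) ^ m * (A * H ^ (p - m + 1) * B)) +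
      (P_max m a b P + dP_max m a b P) * (A * H ^ (p - m + 1) * B)"
    using lower by (intro add_mono sum_mono top) auto
  finally show ?thesis by (simp add: algebra_simps)
qed

end


lemma H_norm_nonneg [simp]: "0 \<le> H_norm k a b v"
  by (simp add: H_norm_def sum_nonneg)

theorem theorem4p4:
  fixes \<alpha> :: real
  assumes "\<alpha> > 0"
  shows "\<exists>C :: nat \<Rightarrow> nat \<Rightarrow> real \<Rightarrow> real \<Rightarrow> real \<Rightarrow> real.
    \<forall>(m::nat) (p::nat) (a::real) (b::real) (P :: nat \<Rightarrow> real \<Rightarrow> real) (f :: real \<Rightarrow> real) (u :: real \<Rightarrow> real)
       (\<beta>::real) (N::nat) (x :: nat \<Rightarrow> real) (W :: real \<Rightarrow> real) (U :: real \<Rightarrow> real).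
      2 * m + 1 \<le> p \<longrightarrow> a < b \<longrightarrow>
      C_on p {a..b} f \<longrightarrow>
      (\<forall>k\<le>m+1. C_on p {a..b} (P k)) \<longrightarrow>
      (\<forall>t\<in>{a..b}. P (m+1) t > 0) \<longrightarrow>
      elliptic \<alpha> m a b P \<longrightarrow>
      C_on (p+2) {a..b} u \<longrightarrow>
      vanishing_boundary_derivs m a b u \<longrightarrow>
      (\<forall>v\<in>H0_space (m+1) a b. L2_inner a b f v = bilinear_form m a b P u v) \<longrightarrow>
      is_partition a b N x \<longrightarrow>
      0 < \<beta> \<longrightarrow> \<beta> * mesh_max N x \<le> mesh_min N x \<longrightarrow>
      W \<in> spline_space0 p m N x \<longrightarrow>
      is_hermite_jacobi_interpolant p m N x u W \<longrightarrow>
      U \<in> spline_space0 p m N x \<longrightarrow>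
      (\<forall>V\<in>spline_space0 p m N x. L2_inner a b f V = bilinear_form m a b P U V) \<longrightarrow>
      H_norm (m+1) a b (\<lambda>t. W t - U t)
        \<le> C p m (P_max m a b P) (dP_max m a b P) (b - a) * H_norm (p+2) a b u
            * mesh_max N x ^ (p - m + 1)"
proof (intro exI[of _ "\<lambda>p m B B' l. (real (m + 1) * B * max 1 l ^ m + B + B') / \<alpha>"] allI impI)
  fix m p N :: nat and a b \<beta> :: real and P :: "nat \<Rightarrow> real \<Rightarrow> real" and f u W U :: "real \<Rightarrow> real"
    and x :: "nat \<Rightarrow> real"
  assume pm: "2 * m + 1 \<le> p" and "a < b" and P: "\<forall>k\<le>m+1. C_on p {a..b} (P k)"
    and ell: "elliptic \<alpha> m a b P" and u: "C_on (p+2) {a..b} u"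
    and weak: "\<forall>v\<in>H0_space (m+1) a b. L2_inner a b f v = bilinear_form m a b P u v"
    and part: "is_partition a b N x"
    and W_spline: "W \<in> spline_space0 p m N x" and interp: "is_hermite_jacobi_interpolant p m N x u W"
    and U_spline: "U \<in> spline_space0 p m N x"
    and galerkin: "\<forall>V\<in>spline_space0 p m N x. L2_inner a b f V = bilinear_form m a b P U V"
  have ab: "x 0 = a" "x N = b" using part by (auto simp: is_partition_def)
  have C: "C_on m {a..b} W" "C_on m {a..b} U"
    using W_spline U_spline ab by (simp_all add: spline_space0_def spline_space_def)
  obtain q where q: "\<forall>j\<in>{1..N}. degree (q j) \<le> p \<and> (\<forall>t\<in>{x (j-1)..x j}. W t = poly (q j) t) \<and>
      (\<forall>k\<le>m. \<forall>t\<in>{x (j-1), x j}. poly ((pderiv ^^ k) (q j)) t = nderiv {a..b} k u t) \<and>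
      (\<forall>\<mu>\<in>jacobi_nodes p m. poly (q j) ((x (j-1) + x j) / 2 + (x j - x (j-1)) * \<mu> / 2) =
        u ((x (j-1) + x j) / 2 + (x j - x (j-1)) * \<mu> / 2))"
    using interp ab unfolding is_hermite_jacobi_interpolant_def Let_def by metis
  have "\<forall>j\<in>{1..N}. \<exists>s :: real poly. degree s \<le> p \<and> (\<forall>t\<in>{x (j-1)<..<x j}. U t = poly s t)"
    using U_spline by (simp add: spline_space0_def spline_space_def)
  then obtain s where s: "\<forall>j\<in>{1..N}. degree (s j) \<le> p \<and> (\<forall>t\<in>{x (j-1)<..<x j}. U t = poly (s j) t)"
    by metis
  have W_poly: "W t = poly (q j) t" and U_poly: "U t = poly (s j) t"
    if "j \<in> {1..N}" "t \<in> {x (j-1)<..<x j}" for j t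
    using bspec[OF q that(1)] bspec[OF s that(1)] that(2)
    by (meson greaterThanLessThan_iff atLeastAtMost_iff less_imp_le)+
  let ?DW = "spline_derivs m N x q W" and ?DU = "spline_derivs m N x s U" and ?Du = "\<lambda>i. nderiv {a..b} i u"
  define E where "E = (\<lambda>i t. ?DW i t - ?DU i t)"
  define e where "e = (\<lambda>t. W t - U t)"
  define B where "B = H_norm (m + 1) a b e"
  define A where "A = H_norm (p + 2) a b u"
  have DW: "deriv_chain (x ` {0..N}) (m + 1) a b ?DW" and DU: "deriv_chain (x ` {0..N}) (m + 1) a b ?DU"
    by (rule spline_derivs_chain[OF part C(1) W_poly], assumption+)
      (rule spline_derivs_chain[OF part C(2) U_poly], assumption+)
  have E_chain: "deriv_chain (x ` {0..N}) (m + 1) a b E"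
    using deriv_chain_diff[OF DW DU] by (simp add: E_def)
  have E0: "E 0 = e" by (simp add: E_def e_def)
  have Du: "deriv_chain {} (p + 2) a b ?Du" by (rule C_on_deriv_chain[OF u])
  \<comment> \<open>On a cell the top derivative of e is the (m+1)-st derivative of a polynomial of
    degree at most p, hence of degree at most p - m - 1, as the orthogonality requires.\<close>
  have setting: "interpolation_setting m p N a b P u W x q (\<lambda>j. (pderiv ^^ (m + 1)) (q j - s j)) E"
  proof
    show "2 * m + 1 \<le> p" "is_partition a b N x" "C_on (p + 2) {a..b} u" "C_on m {a..b} W"
      by (fact pm part u C)+
    show "C_on p {a..b} (P k)" if "k \<le> m + 1" for k using P that by blast
    show "bounded_measurable a b (E k)" if "k \<le> m + 1" for k
      by (rule deriv_chain_bounded_measurable[OF E_chain that])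
    fix j assume j: "j \<in> {1..N}"
    have "degree (q j - s j) \<le> p" using bspec[OF q j] bspec[OF s j] by (intro degree_diff_le) blast+
    then show "degree ((pderiv ^^ (m + 1)) (q j - s j)) < p - m"
      using pm by (simp add: degree_higher_pderiv del: funpow.simps)
    have higher_diff: "(pderiv ^^ i) (q j - s j) = (pderiv ^^ i) (q j) - (pderiv ^^ i) (s j)" for i
      using higher_pderiv_add[of i "q j - s j" "s j"] by (simp add: algebra_simps)
    fix t assume t: "t \<in> {x (j - 1)<..<x j}"
    show "E (m + 1) t = poly ((pderiv ^^ (m + 1)) (q j - s j)) t"
      unfolding E_def higher_diff
      using spline_derivs_eq_poly[OF part C(1) W_poly j t] spline_derivs_eq_poly[OF part C(2) U_poly j t]
      by (simp del: funpow.simps)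
  qed (use q in blast)+
  note consistency = interpolation_setting.consistency[OF setting]
    and Pmax_nonneg = interpolation_setting.Pmax_nonneg[OF setting]
    and dPmax_nonneg = interpolation_setting.dPmax_nonneg[OF setting]
    and P_bounded_measurable = interpolation_setting.P_bounded_measurable[OF setting]
  have e_spline: "e \<in> spline_space0 p m N x"
    unfolding e_def by (rule spline_space0_diff[OF part W_spline U_spline])
  \<comment> \<open>This serves twice: to insert e into the weak equation for u and into the
    ellipticity inequality.\<close>
  have "e \<in> H0_space (m + 1) a b"
  proof (rule spline_in_H0_space[OF part])
    show "C_on m {a..b} e" "vanishing_boundary_derivs m a b e"
      using e_spline ab by (simp_all add: spline_space0_def spline_space_def)
    show "e t = poly (q j - s j) t" if "j \<in> {1..N}" "t \<in> {x (j-1)<..<x j}" for j t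
      using W_poly[OF that] U_poly[OF that] by (simp add: e_def)
  qed
  have norm: "H_norm (m + 1) a b e = sqrt (\<Sum>k\<le>m + 1. L2_inner a b (E k) (E k))"
    using deriv_chain_H_norm[OF E_chain] \<open>a < b\<close> by (simp add: E0)
  have bm: "bounded_measurable a b (P k)" "bounded_measurable a b (E k)" "bounded_measurable a b (?DW k)"
    "bounded_measurable a b (?DU k)" "bounded_measurable a b (?Du k)" if "k \<le> m + 1" for k
    using that pm P_bounded_measurable deriv_chain_bounded_measurable[OF E_chain] deriv_chain_bounded_measurable[OF DW]
      deriv_chain_bounded_measurable[OF DU] deriv_chain_bounded_measurable[OF Du] by auto
  have form: "bilinear_form m a b P (D 0) e = (\<Sum>k\<le>m + 1. L2_inner a b (\<lambda>t. P k t * D k t) (E k))"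
    if "deriv_chain S l a b D" "m + 1 \<le> l" for S l D
    using deriv_chain_bilinear_form[OF that(1) E_chain _ that(2), of P] bm \<open>a < b\<close> by (simp add: E0)
  \<comment> \<open>Both sides equal (f, e).\<close>
  have "bilinear_form m a b P U e = bilinear_form m a b P u e"
    using weak galerkin e_spline \<open>e \<in> H0_space (m + 1) a b\<close> by metis
  then have galerkin_sum: "(\<Sum>k\<le>m + 1. L2_inner a b (\<lambda>t. P k t * ?DU k t) (E k)) =
      (\<Sum>k\<le>m + 1. L2_inner a b (\<lambda>t. P k t * ?Du k t) (E k))"
    using form[OF DU order.refl] form[OF Du] pm
    by (simp only: spline_derivs_0 nderiv.simps(1))
  have split: "(\<Sum>k\<le>m + 1. L2_inner a b (\<lambda>t. P k t * (D k t - D' k t)) (E k)) =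
      (\<Sum>k\<le>m + 1. L2_inner a b (\<lambda>t. P k t * D k t) (E k)) - (\<Sum>k\<le>m + 1. L2_inner a b (\<lambda>t. P k t * D' k t) (E k))"
    if "\<And>k. k \<le> m + 1 \<Longrightarrow> bounded_measurable a b (D k) \<and> bounded_measurable a b (D' k)" for D D'
    unfolding sum_subtractf[symmetric] right_diff_distrib
    using that bm by (intro sum.cong refl L2_inner_diff_left bounded_measurable_mult) auto
  have diff: "?DW k t - ?DU k t = E k t" for k t by (simp only: E_def)
  \<comment> \<open>a(W, e) - a(u, e) = a(W, e) - a(U, e) = a(e, e), carried out on the sums of L2
    inner products, where linearity is elementary.\<close>
  have "(\<Sum>k\<le>m + 1. L2_inner a b (\<lambda>t. P k t * (?DW k t - ?Du k t)) (E k)) =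
      (\<Sum>k\<le>m + 1. L2_inner a b (\<lambda>t. P k t * E k t) (E k))"
    using split[of ?DW ?DU, OF conjI[OF bm(3,4)], unfolded diff]
      split[of ?DW ?Du, OF conjI[OF bm(3,5)]] galerkin_sum by linarith
  also have "\<dots> = bilinear_form m a b P e e"
    using form[OF E_chain] by (simp add: E0)
  also have "\<dots> \<ge> \<alpha> * B\<^sup>2"
    using ell \<open>e \<in> H0_space (m + 1) a b\<close> unfolding elliptic_def B_def by blast
  finally have lower: "\<alpha> * B\<^sup>2 \<le> (\<Sum>k\<le>m + 1. L2_inner a b (\<lambda>t. P k t * (?DW k t - ?Du k t)) (E k))" .
  \<comment> \<open>One summand of the squared norm is at most the whole; this supplies the bounds A
    and B asked for by \<open>consistency\<close>.\<close>
  have term_le: "sqrt (L2_inner a b (D k) (D k)) \<le> sqrt (\<Sum>k\<le>n. L2_inner a b (D k) (D k))"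
    if "k \<le> n" for D and n k :: nat
    using that by (intro real_sqrt_le_mono member_le_sum) (auto simp: L2_inner_self_nonneg)
  have "\<bar>\<Sum>k\<le>m + 1. L2_inner a b (\<lambda>t. P k t * (?DW k t - ?Du k t)) (E k)\<bar> \<le>
      (real (m + 1) * P_max m a b P * max 1 (b - a) ^ m + P_max m a b P + dP_max m a b P) *
        A * mesh_max N x ^ (p - m + 1) * B"
    unfolding A_def B_def norm deriv_chain_H_norm[OF Du less_imp_le[OF \<open>a < b\<close>], simplified nderiv.simps(1)]
    by (intro consistency term_le) simp_all
  with lower have "\<alpha> * B * B \<le> (real (m + 1) * P_max m a b P * max 1 (b - a) ^ m + P_max m a b P + dP_max m a b P) *
      A * mesh_max N x ^ (p - m + 1) * B"
    by (simp add: power2_eq_square)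
  moreover have "0 \<le> B" "0 \<le> A"
    by (simp_all add: A_def B_def H_norm_def sum_nonneg)
  moreover have "0 \<le> (real (m + 1) * P_max m a b P * max 1 (b - a) ^ m + P_max m a b P + dP_max m a b P) *
      A * mesh_max N x ^ (p - m + 1)"
    using Pmax_nonneg dPmax_nonneg \<open>0 \<le> A\<close> mesh_max_bounds(1)[OF part]
    by (intro mult_nonneg_nonneg add_nonneg_nonneg) auto
  \<comment> \<open>One factor B cancels; for B = 0 the right-hand side only has to be
    nonnegative.\<close>
  ultimately have "\<alpha> * B \<le> (real (m + 1) * P_max m a b P * max 1 (b - a) ^ m + P_max m a b P + dP_max m a b P) *
      A * mesh_max N x ^ (p - m + 1)"
    by (cases "B = 0") (auto simp del: mult_eq_0_iff)
  then show "H_norm (m+1) a b (\<lambda>t. W t - U t) \<le>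
      (real (m + 1) * P_max m a b P * max 1 (b - a) ^ m + P_max m a b P + dP_max m a b P) / \<alpha> *
        H_norm (p+2) a b u * mesh_max N x ^ (p - m + 1)"
    using \<open>\<alpha> > 0\<close> by (simp add: A_def B_def e_def field_simps)
qed

end
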